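(* Let $V,Q\in L_\infty(0,1)$ be complex-valued. There exists a fixed $n_0>0$ independent of $\alpha,\beta\in[0,1]$ such that for $n\geqslant n_0$ the eigenvalues $\lambda_n=\lambda_n(\alpha,\beta)$ of the operator $\mathcal{H}(\alpha,\beta)$ are simple and can be represented as $$\lambda_n(\alpha,\beta)=\Bigg(\pi n+\frac{1}{\pi n}\sum_{i=0}^\infty\frac{\rho_i(n,\alpha,\beta)}{(\pi n)^i}\Bigg)^2,$$ where the series converges uniformly in $\alpha,\beta\in[0,1]$ and $n\geqslant n_0$. The coefficients $\rho_i(n,\alpha,\beta)$ are given by the recurrent formulas $$\rho_0=(-1)^n\omega_0,\qquad \rho_1=(-1)^n\omega_1,\qquad \rho_i=(-1)^n\omega_i-\sum_{s=1}^{[i/2]}H_{s,i-2s},\quad i\geqslant2,$$ (all quantities taken at $(n,\alpha,\beta)$), where $[\cdot]$ is the integer part of a number and $$\omega_i(n,\alpha,\beta)=\sum_{p=0}^i\sum_{t=0}^{i-p}E_{t,i+1-t-p}(n,\alpha,\beta)\sum_{\substack{\zeta\in\mathbb{Z}_+^t\\|\zeta|=p}}\rho_{\zeta_1}(n,\alpha,\beta)\cdots\rho_{\zeta_t}(n,\alpha,\beta),\quad i\geqslant0,$$ $$E_{t,l}(n,\alpha,\beta)=\sum_{j=\max\{0,l-t-1\}}^{l-1}\frac{(-1)^{l-j-1}(l-1)!\,\partial_z^{\,t-l+j+1}f_j(\pi n,\alpha,\beta)}{(l-j-1)!\,j!\,(t-l+j+1)!},\quad t\geqslant0,\ l\geqslant1,$$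 $$H_{s,m}(n,\alpha,\beta)=\frac{(-1)^s}{(2s+1)!}\sum_{\substack{\nu\in\mathbb{Z}_+^{2s+1}\\|\nu|=m}}\rho_{\nu_1}(n,\alpha,\beta)\cdots\rho_{\nu_{2s+1}}(n,\alpha,\beta),\quad s\geqslant1,\ m\geqslant0,$$ and for $t=0$ the inner sum over $\zeta$ in $\omega_i$ is understood as $1$ if $p=0$ and as $0$ if $p>0$. The estimates $$|\rho_i(n,\alpha,\beta)|\leqslant c_1c_2^i$$ hold, where $c_1,c_2$ are some constants independent of $i\geqslant 0$, $n\geqslant 1$, and $\alpha,\beta\in[0,1]$. For each $N\geqslant1$ the remainder of the series satisfies $$\bigg|\sum_{i=N}^\infty\frac{\rho_i(n,\alpha,\beta)}{(\pi n)^i}\bigg|\leqslant\frac{2c_1c_2^N}{\pi^Nn^N}\quad\text{for}\quad n\geqslant n_0.$$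
   Context: $\mathcal{E}:L^2(0,1)\to L^2(\mathbb{R})$ is the operator of continuation by zero outside $(0,1)$, $\mathcal{R}:L^2(\mathbb{R})\to L^2(0,1)$ is the operator of restriction to $(0,1)$, and for $\alpha\in[-1,1]$ the translation operator in $L^2(\mathbb{R})$ is $(\mathcal{T}(\alpha)y)(x)=y(x+\alpha)$. For $V,Q\in L_\infty(0,1)$ complex-valued and $\alpha,\beta\in[0,1]$, put $\mathcal{B}(\alpha,\beta)=V\mathcal{R}\mathcal{T}(\alpha)\mathcal{E}+Q\mathcal{R}\mathcal{T}(-\beta)\mathcal{E}$. The operator $\mathcal{A}y=-y''$ in $L^2(0,1)$ has domain $\mathfrak{D}(\mathcal{A})=\{y\in W_2^2(0,1):y'(0)=y'(1)=0\}$. The operator $\mathcal{H}(\alpha,\beta)=\mathcal{A}+\mathcal{B}(\alpha,\beta)$ in $L^2(0,1)$ has domain $\mathfrak{D}(\mathcal{A})$; that is, $(\mathcal{H}(\alpha,\beta)y)(x)=-y''(x)+V(x)y(x+\alpha)+Q(x)y(x-\beta)$, where $y$ is continued by zero outside $[0,1]$. Its spectrum consists of countably many eigenvalues accumulating only at infinity; they are denoted $\lambda_n=\lambda_n(\alpha,\beta)$, $n=0,1,2,\dots$, and enumerated in ascending order of their absolute values (counting multiplicities). In the space $C[0,1]$, for $z\in\mathbb{C}$, define the linear operators $$(\mathcal{M}(z,\alpha,\beta)u)(x)=\int_0^x(\mathcal{B}(\alpha,\beta)u)(t)\sin z(x-t)\,dt,\qquad(\mathcal{L}(z,\alpha,\beta)u)(x)=\int_0^x(\mathcal{B}(\alpha,\beta)u)(t)\cos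 z(x-t)\,dt,$$ and the functions $$f_j(z,\alpha,\beta)=\Big(\mathcal{L}(z,\alpha,\beta)\,(\mathcal{M}(z,\alpha,\beta))^j\,\Phi(\cdot,z)\Big)\Big|_{x=1},\quad j\geqslant0,\qquad\Phi(x,z)=\cos zx.$$ $\partial_z^mf_j$ is the $m$th derivative of $f_j$ in $z$. $\mathbb{Z}_+$ is the set of non-negative integers, and $|\zeta|=\zeta_1+\dots+\zeta_t$ for $\zeta\in\mathbb{Z}_+^t$. *)

theory Defs
  imports "HOL-Analysis.Analysis" "HOL-Library.Function_Algebras"
begin

text \<open>
  Elements of \<open>L\<^sup>2(0,1)\<close> and \<open>L\<^sub>\<infinity>(0,1)\<close> are represented by total functions \<open>real \<Rightarrow> complex\<close>
  whose values outside \<open>(0,1)\<close> are irrelevant, up to equality almost everywhere on \<open>(0,1)\<close>.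
\<close>

abbreviation leb01 :: "real measure" where
  "leb01 \<equiv> lebesgue_on {0<..<1}"

definition L_inf :: "(real \<Rightarrow> complex) set" where
  "L_inf = {g. g \<in> borel_measurable leb01 \<and> (\<exists>C. AE x in leb01. norm (g x) \<le> C)}"

definition L_two :: "(real \<Rightarrow> complex) set" where
  "L_two = {g. g \<in> borel_measurable leb01 \<and> integrable leb01 (\<lambda>x. (norm (g x))\<^sup>2)}"

definition continuation :: "(real \<Rightarrow> complex) \<Rightarrow> real \<Rightarrow> complex" where
  "continuation y x = (if x \<in> {0<..<1} then y x else 0)"

text \<open>The value \<open>0\<close> outside \<open>(0,1)\<close> is only a choice of representative in \<open>L\<^sup>2(0,1)\<close>.\<close>
definition restriction :: "(real \<Rightarrow> complex) \<Rightarrow> real \<Rightarrow> complex" where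
  "restriction y x = (if x \<in> {0<..<1} then y x else 0)"

definition translation :: "real \<Rightarrow> (real \<Rightarrow> complex) \<Rightarrow> real \<Rightarrow> complex" where
  "translation \<alpha> y x = y (x + \<alpha>)"

definition B_op ::
  "(real \<Rightarrow> complex) \<Rightarrow> (real \<Rightarrow> complex) \<Rightarrow> real \<Rightarrow> real \<Rightarrow> (real \<Rightarrow> complex) \<Rightarrow> real \<Rightarrow> complex" where
  "B_op V Q \<alpha> \<beta> y x =
     V x * restriction (translation \<alpha> (continuation y)) x
   + Q x * restriction (translation (- \<beta>) (continuation y)) x"


text \<open>
  \<open>W22 y y' y''\<close>: \<open>y\<close> is the \<open>C\<^sup>1[0,1]\<close> representative of an element of \<open>W\<^sub>2\<^sup>2(0,1)\<close>, its derivative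
  \<open>y'\<close> is absolutely continuous on \<open>[0,1]\<close>, and \<open>y''\<close> is the second derivative.
  Requiring \<open>y\<close> to vanish off \<open>[0,1]\<close> makes the representative unique as a function on the reals,
  so that linear independence of such functions is linear independence in \<open>L\<^sup>2(0,1)\<close>.
\<close>
definition W22 :: "(real \<Rightarrow> complex) \<Rightarrow> (real \<Rightarrow> complex) \<Rightarrow> (real \<Rightarrow> complex) \<Rightarrow> bool" where
  "W22 y y' y'' \<longleftrightarrow>
     (\<forall>x. x \<notin> {0..1} \<longrightarrow> y x = 0) \<and>
     (\<forall>x\<in>{0..1}. (y has_vector_derivative y' x) (at x within {0..1})) \<and>
     y'' \<in> L_two \<and>
     (\<forall>x\<in>{0..1}. y' x = y' 0 + (LINT t:{0..x}|lebesgue. y'' t))"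

text \<open>
  The operator \<open>\<H>(\<alpha>,\<beta>)\<close> as a relation: \<open>H_op V Q \<alpha> \<beta> y w\<close> says that \<open>y\<close> lies in the domain
  and that the class of \<open>w\<close> in \<open>L\<^sup>2(0,1)\<close> is the image of \<open>y\<close>.
\<close>
definition H_op ::
  "(real \<Rightarrow> complex) \<Rightarrow> (real \<Rightarrow> complex) \<Rightarrow> real \<Rightarrow> real \<Rightarrow> (real \<Rightarrow> complex) \<Rightarrow> (real \<Rightarrow> complex) \<Rightarrow> bool"
where
  "H_op V Q \<alpha> \<beta> y w \<longleftrightarrow>
     (\<exists>y' y''. W22 y y' y'' \<and> y' 0 = 0 \<and> y' 1 = 0 \<and>
        (AE x in leb01. w x = - y'' x + B_op V Q \<alpha> \<beta> y x))"

definition is_eigenvalue ::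
  "(real \<Rightarrow> complex) \<Rightarrow> (real \<Rightarrow> complex) \<Rightarrow> real \<Rightarrow> real \<Rightarrow> complex \<Rightarrow> bool" where
  "is_eigenvalue V Q \<alpha> \<beta> \<mu> \<longleftrightarrow> (\<exists>y. y \<noteq> (\<lambda>x. 0) \<and> H_op V Q \<alpha> \<beta> y (\<lambda>x. \<mu> * y x))"

text \<open>\<open>ker_pow V Q \<alpha> \<beta> \<mu> k\<close> is the kernel of \<open>(\<H>(\<alpha>,\<beta>) - \<mu>)\<^sup>k\<close>.\<close>
fun ker_pow ::
  "(real \<Rightarrow> complex) \<Rightarrow> (real \<Rightarrow> complex) \<Rightarrow> real \<Rightarrow> real \<Rightarrow> complex \<Rightarrow> nat \<Rightarrow> (real \<Rightarrow> complex) set"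
where
  "ker_pow V Q \<alpha> \<beta> \<mu> 0 = {\<lambda>x. 0}"
| "ker_pow V Q \<alpha> \<beta> \<mu> (Suc k) =
     {y. \<exists>w\<in>ker_pow V Q \<alpha> \<beta> \<mu> k. H_op V Q \<alpha> \<beta> y (\<lambda>x. \<mu> * y x + w x)}"

definition root_subspace ::
  "(real \<Rightarrow> complex) \<Rightarrow> (real \<Rightarrow> complex) \<Rightarrow> real \<Rightarrow> real \<Rightarrow> complex \<Rightarrow> (real \<Rightarrow> complex) set" where
  "root_subspace V Q \<alpha> \<beta> \<mu> = (\<Union>k. ker_pow V Q \<alpha> \<beta> \<mu> k)"

interpretation cfun: vector_space "\<lambda>(c::complex) (y::real \<Rightarrow> complex) x. c * y x"
  by unfold_locales (auto simp: fun_eq_iff algebra_simps)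

text \<open>The algebraic multiplicity of \<open>\<mu>\<close> is finite and equal to \<open>m\<close>.\<close>
definition has_multiplicity ::
  "(real \<Rightarrow> complex) \<Rightarrow> (real \<Rightarrow> complex) \<Rightarrow> real \<Rightarrow> real \<Rightarrow> complex \<Rightarrow> nat \<Rightarrow> bool" where
  "has_multiplicity V Q \<alpha> \<beta> \<mu> m \<longleftrightarrow>
     (\<exists>b. finite b \<and> card b = m \<and> cfun.independent b \<and> cfun.span b = root_subspace V Q \<alpha> \<beta> \<mu>)"

definition simple_eigenvalue ::
  "(real \<Rightarrow> complex) \<Rightarrow> (real \<Rightarrow> complex) \<Rightarrow> real \<Rightarrow> real \<Rightarrow> complex \<Rightarrow> bool" where
  "simple_eigenvalue V Q \<alpha> \<beta> \<mu> \<longleftrightarrow> is_eigenvalue V Q \<alpha> \<beta> \<mu> \<and> has_multiplicity V Q \<alpha> \<beta> \<mu> 1"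

text \<open>
  \<open>lam\<close> lists all eigenvalues in ascending order of absolute values, each repeated according to
  its multiplicity; the order among eigenvalues of equal absolute value is arbitrary.
\<close>
definition enumerates_eigenvalues ::
  "(real \<Rightarrow> complex) \<Rightarrow> (real \<Rightarrow> complex) \<Rightarrow> real \<Rightarrow> real \<Rightarrow> (nat \<Rightarrow> complex) \<Rightarrow> bool" where
  "enumerates_eigenvalues V Q \<alpha> \<beta> lam \<longleftrightarrow>
     mono (\<lambda>n. norm (lam n)) \<and>
     (\<forall>n. is_eigenvalue V Q \<alpha> \<beta> (lam n)) \<and>
     (\<forall>\<mu>. is_eigenvalue V Q \<alpha> \<beta> \<mu> \<longrightarrow>
        finite {n. lam n = \<mu>} \<and> has_multiplicity V Q \<alpha> \<beta> \<mu> (card {n. lam n = \<mu>}))"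


definition M_op ::
  "(real \<Rightarrow> complex) \<Rightarrow> (real \<Rightarrow> complex) \<Rightarrow> complex \<Rightarrow> real \<Rightarrow> real \<Rightarrow> (real \<Rightarrow> complex) \<Rightarrow> real \<Rightarrow> complex"
where
  "M_op V Q z \<alpha> \<beta> u x =
     (LINT t:{0..x}|lebesgue. B_op V Q \<alpha> \<beta> u t * sin (z * of_real (x - t)))"

definition L_op ::
  "(real \<Rightarrow> complex) \<Rightarrow> (real \<Rightarrow> complex) \<Rightarrow> complex \<Rightarrow> real \<Rightarrow> real \<Rightarrow> (real \<Rightarrow> complex) \<Rightarrow> real \<Rightarrow> complex"
where
  "L_op V Q z \<alpha> \<beta> u x =
     (LINT t:{0..x}|lebesgue. B_op V Q \<alpha> \<beta> u t * cos (z * of_real (x - t)))"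

definition f_coeff ::
  "(real \<Rightarrow> complex) \<Rightarrow> (real \<Rightarrow> complex) \<Rightarrow> nat \<Rightarrow> complex \<Rightarrow> real \<Rightarrow> real \<Rightarrow> complex" where
  "f_coeff V Q j z \<alpha> \<beta> =
     L_op V Q z \<alpha> \<beta> ((M_op V Q z \<alpha> \<beta> ^^ j) (\<lambda>x. cos (z * of_real x))) 1"

text \<open>
  Truncated subtraction on \<open>nat\<close> turns \<open>max {0, l - t - 1}\<close> into \<open>l - t - 1\<close>; the other differences
  are non-negative in the summation range. Only \<open>l \<ge> 1\<close> is meaningful.
\<close>
definition E_coeff ::
  "(real \<Rightarrow> complex) \<Rightarrow> (real \<Rightarrow> complex) \<Rightarrow> nat \<Rightarrow> nat \<Rightarrow> nat \<Rightarrow> real \<Rightarrow> real \<Rightarrow> complex" where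
  "E_coeff V Q t l n \<alpha> \<beta> =
     (\<Sum>j = l - t - 1..l - 1.
        (-1) ^ (l - j - 1) * fact (l - 1)
          * (deriv ^^ (t + j + 1 - l)) (\<lambda>z. f_coeff V Q j z \<alpha> \<beta>) (of_real (pi * real n))
        / (fact (l - j - 1) * fact j * fact (t + j + 1 - l)))"

text \<open>
  Multi-indices in \<open>\<int>\<^sub>+\<^sup>t\<close> are lists of length \<open>t\<close>. For \<open>t = 0\<close> the sum is \<open>1\<close> if \<open>p = 0\<close>
  and \<open>0\<close> if \<open>p > 0\<close>.
\<close>
definition multi_sum :: "(nat \<Rightarrow> complex) \<Rightarrow> nat \<Rightarrow> nat \<Rightarrow> complex" where
  "multi_sum r t p = (\<Sum>\<zeta> | length \<zeta> = t \<and> sum_list \<zeta> = p. prod_list (map r \<zeta>))"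

definition omega ::
  "(real \<Rightarrow> complex) \<Rightarrow> (real \<Rightarrow> complex) \<Rightarrow> nat \<Rightarrow> real \<Rightarrow> real \<Rightarrow> (nat \<Rightarrow> complex) \<Rightarrow> nat \<Rightarrow> complex"
where
  "omega V Q n \<alpha> \<beta> r i =
     (\<Sum>p = 0..i. \<Sum>t = 0..i - p. E_coeff V Q t (i + 1 - t - p) n \<alpha> \<beta> * multi_sum r t p)"

definition H_coeff :: "(nat \<Rightarrow> complex) \<Rightarrow> nat \<Rightarrow> nat \<Rightarrow> complex" where
  "H_coeff r s m = (-1) ^ s / fact (2 * s + 1) * multi_sum r (2 * s + 1) m"

lemma multi_sum_cong:
  assumes "\<And>k. k \<le> p \<Longrightarrow> r k = r' k"
  shows "multi_sum r t p = multi_sum r' t p"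
  unfolding multi_sum_def
  by (rule sum.cong[OF refl], rule arg_cong[where f = prod_list], rule map_cong[OF refl])
     (auto intro!: assms member_le_sum_list)

lemma omega_cong [fundef_cong]:
  assumes "V = V'" "Q = Q'" "n = n'" "\<alpha> = \<alpha>'" "\<beta> = \<beta>'" "i = i'" "\<And>k. k < i' \<Longrightarrow> r k = r' k"
  shows "omega V Q n \<alpha> \<beta> r i = omega V' Q' n' \<alpha>' \<beta>' r' i'"
proof -
  have "multi_sum r t p = multi_sum r' t p" if "p \<le> i" "t \<le> i - p" for p t
  proof (cases "p = i")
    case True
    then show ?thesis using that by (auto simp: multi_sum_def intro!: sum.cong)
  next
    case False
    then show ?thesis using that assms by (intro multi_sum_cong) auto
  qed
  then show ?thesis
    unfolding omega_def using assms(1-6) by (auto intro!: sum.cong)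
qed

lemma H_coeff_cong [fundef_cong]:
  assumes "s = s'" "m = m'" "\<And>k. k \<le> m' \<Longrightarrow> r k = r' k"
  shows "H_coeff r s m = H_coeff r' s' m'"
  unfolding H_coeff_def using assms multi_sum_cong[of m r r'] by simp

text \<open>For \<open>i = 0\<close> and \<open>i = 1\<close> the sum over \<open>s\<close> is empty.\<close>
function rho ::
  "(real \<Rightarrow> complex) \<Rightarrow> (real \<Rightarrow> complex) \<Rightarrow> nat \<Rightarrow> real \<Rightarrow> real \<Rightarrow> nat \<Rightarrow> complex" where
  "rho V Q n \<alpha> \<beta> i =
     (-1) ^ n * omega V Q n \<alpha> \<beta> (\<lambda>k. rho V Q n \<alpha> \<beta> k) i
     - (\<Sum>s = 1..i div 2. H_coeff (\<lambda>k. rho V Q n \<alpha> \<beta> k) s (i - 2 * s))"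
  by auto
termination
  by (relation "Wellfounded.measure (\<lambda>(V, Q, n, \<alpha>, \<beta>, i). i)") auto

declare rho.simps [simp del]

end

theory Submission
  imports Defs "HOL-Complex_Analysis.Complex_Analysis"
    "HOL-Computational_Algebra.Fundamental_Theorem_Algebra"
begin

text \<open>
  Two descriptions of the eigenvalues meet in this proof: a count, which says that \<open>\<lambda>\<^sub>n\<close> is simple and close to
  \<open>(\<pi>n)\<^sup>2\<close>, and an equation for \<open>\<surd>\<lambda>\<^sub>n\<close>, which has a single solution near \<open>\<pi>n\<close>, namely the sum of the series.
  Every constant depends on \<open>V\<close> and \<open>Q\<close> only through a bound \<open>b\<close> of \<open>|V| + |Q|\<close>, whence the uniformity in
  \<open>\<alpha>\<close> and \<open>\<beta>\<close>.

  The count. In the coordinates given by the cosine coefficients the operator is the diagonal matrix of the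
  numbers \<open>(\<pi>k)\<^sup>2\<close> plus the bounded operator \<open>\<B>\<close> (\<open>H_op_iff_coefficients\<close>). The gaps of the diagonal grow, and the
  sums of inverse distances across the circle of radius \<open>(\<pi>(N + 1/2))\<^sup>2\<close> are of order \<open>N\<^bsup>-1/2\<^esup>\<close>. Hence, for large
  \<open>N\<close>, a quadratic fixed point equation of Riccati type has a solution that deforms the span of the first
  \<open>N + 1\<close> cosines into an invariant subspace (\<open>H_g\<close>). It contains every root vector whose eigenvalue lies in the
  disc (\<open>high_part_zero\<close>), and the restriction has no eigenvalue outside (\<open>low_part_zero\<close>). A finite-dimensional
  complex space is the direct sum of the root spaces of an operator on it, so the disc contains exactly \<open>N + 1\<close>
  eigenvalues, counted with multiplicity (\<open>card_small_eigenvalues\<close>). Comparing two consecutive discs isolates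
  \<open>\<lambda>\<^sub>N\<close> and shows that it is simple (\<open>nth_eigenvalue\<close>). Only suprema and cosine coefficients of continuous
  functions occur in the estimates.

  The equation. An eigenfunction for \<open>z\<^sup>2\<close> satisfies \<open>y = y(0) \<Phi> + z\<^sup>-\<^sup>1 M y\<close>, and iterating this in the condition
  \<open>y'(1) = 0\<close> gives \<open>z sin z = \<Sum>\<^sub>j z\<^sup>-\<^sup>j f\<^sub>j(z)\<close> (\<open>eigenvalue_characteristic_equation\<close>). With \<open>z = \<pi>n + w\<close> and
  \<open>x = 1/(\<pi>n)\<close>, expansion of the right-hand side turns it into
  \<open>(-1)\<^sup>n sin w = \<Sum>\<^sub>t\<^sub>,\<^sub>l E\<^sub>t\<^sub>,\<^sub>l x\<^sup>l w\<^sup>t\<close> with \<open>|E\<^sub>t\<^sub>,\<^sub>l| \<le> (1 + 9 b)\<^sup>l\<close> (\<open>characteristic_function_expansion\<close>, \<open>E_coeff_bound\<close>).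

  The series. The recursion for \<open>\<rho>\<^sub>i\<close> is the comparison of coefficients in this equation for \<open>w = x \<Sum>\<^sub>i \<rho>\<^sub>i x\<^sup>i\<close>. A
  majorant that reproduces itself bounds the partial sums of \<open>\<Sum>|\<rho>\<^sub>i| x\<^sup>i\<close> at a fixed radius, which gives the geometric
  bound on the coefficients (\<open>coefficient_bound\<close>); then the series solves the equation (\<open>root_shift_solves\<close>), and small
  solutions are unique (\<open>small_root_unique\<close>).
\<close>

section \<open>Integration by parts for absolutely continuous functions\<close>

lemma absolutely_integrable_mult_continuous:
  fixes p h :: "real \<Rightarrow> complex"
  assumes p: "p absolutely_integrable_on {a..c}" and h: "continuous_on {a..c} h"
  shows "(\<lambda>s. p s * h s) absolutely_integrable_on {a..c}"
proof -
  have "(\<lambda>s. h s * p s) absolutely_integrable_on {a..c}"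
  proof (rule absolutely_integrable_bounded_measurable_product[OF bilinear_conv_bounded_bilinear[THEN iffD2, OF bounded_bilinear_mult]])
    show "h \<in> borel_measurable (lebesgue_on {a..c})"
      using h by (intro continuous_imp_measurable_on_sets_lebesgue) auto
    show "bounded (h ` {a..c})"
      using h by (intro compact_imp_bounded compact_continuous_image) auto
  qed (use p in auto)
  then show ?thesis by (simp add: mult.commute)
qed

text \<open>Here \<open>P\<close> is only an indefinite Lebesgue integral and may fail to be differentiable on a null set.
  The increments of the difference of the two sides are bounded by the length of the interval times
  the increment of the continuous function \<open>\<integral>|p|\<close>, so that difference has derivative zero everywhere.\<close>

lemma integral_by_parts_absolutely_continuous:
  fixes p P g g' :: "real \<Rightarrow> complex"
  assumes p: "p absolutely_integrable_on {0..1}"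
    and P: "\<And>x. x \<in> {0..1} \<Longrightarrow> P x = P 0 + integral {0..x} p"
    and g: "\<And>x. x \<in> {0..1} \<Longrightarrow> (g has_vector_derivative g' x) (at x within {0..1})"
    and g': "continuous_on {0..1} g'"
    and x: "x \<in> {0..1}"
  shows "integral {0..x} (\<lambda>s. p s * g s) = P x * g x - P 0 * g 0 - integral {0..x} (\<lambda>s. P s * g' s)"
proof -
  have gcont: "continuous_on {0..1} g"
    using g by (metis continuous_on_eq_continuous_within has_vector_derivative_continuous)
  have pint: "p integrable_on {0..1}"
    using p set_lebesgue_integral_eq_integral(1) by blast
  have Pcont: "continuous_on {0..1} P"
  proof (rule continuous_on_eq)
    show "continuous_on {0..1} (\<lambda>x. P 0 + integral {0..x} p)"
      by (intro continuous_intros indefinite_integral_continuous_1 pint)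
  qed (use P in metis)
  note pg = absolutely_integrable_mult_continuous[OF p]
  obtain G where G: "\<And>s. s \<in> {0..1} \<Longrightarrow> norm (g' s) \<le> G"
  proof -
    have "bounded (g' ` {0..1})" using g' by (intro compact_imp_bounded compact_continuous_image) auto
    then show ?thesis using that unfolding bounded_iff by blast
  qed
  have G0: "0 \<le> G" using order_trans[OF norm_ge_zero G[of 0]] by simp
  define N where "N x = integral {0..x} (\<lambda>s. norm (p s))" for x
  have npint: "(\<lambda>s. norm (p s)) integrable_on {0..1}"
    using p absolutely_integrable_on_def by blast
  have Ncont: "continuous_on {0..1} N"
    unfolding N_def by (intro indefinite_integral_continuous_1 npint)
  have sub: "f integrable_on {a..c}" if "f integrable_on {0..1}" "0 \<le> a" "c \<le> 1" for f :: "real \<Rightarrow> 'v::banach" and a c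
    using integrable_on_subinterval[OF that(1)] that by (auto simp: atLeastatMost_subset_iff)
  have diff: "integral {0..c} f - integral {0..a} f = integral {a..c} f"
    if "f integrable_on {0..1}" "0 \<le> a" "a \<le> c" "c \<le> 1" for f :: "real \<Rightarrow> 'v::banach" and a c
    using Henstock_Kurzweil_Integration.integral_combine[of 0 a c f] sub[of f 0 c] that
    by (simp add: algebra_simps)
  have pgi: "(\<lambda>s. p s * h s) integrable_on {0..1}" if "continuous_on {0..1} h" for h
    using pg[OF that] set_lebesgue_integral_eq_integral(1) by blast
  have ftc: "(g' has_integral (g c - g a)) {a..c}" if "0 \<le> a" "a \<le> c" "c \<le> 1" for a c
    using that by (intro fundamental_theorem_of_calculus has_vector_derivative_within_subset[OF g]) auto
  have Pg': "(\<lambda>s. P s * g' s) integrable_on {0..1}"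
    by (intro integrable_continuous_real continuous_intros Pcont g')
  define q where "q x = P x * g x - integral {0..x} (\<lambda>s. p s * g s) - integral {0..x} (\<lambda>s. P s * g' s)" for x
  \<comment> \<open>The increment of \<open>q\<close> is of second order: the boundary term is split between the two integrals.\<close>
  have incr: "norm (q c - q a) \<le> 2 * G * (c - a) * (N c - N a)" if ac: "0 \<le> a" "a \<le> c" "c \<le> 1" for a c
  proof -
    have Pd: "P c' - P a = integral {a..c'} p" if "c' \<in> {a..c}" for c'
      using diff[OF pint, of a c'] P[of a] P[of c'] ac that by auto
    have i1: "(p has_integral (P c - P a)) {a..c}"
      using Pd[of c] sub[OF pint, of a c] ac by (auto simp: has_integral_integral)
    have i2: "((\<lambda>s. p s * g c + P a * g' s - p s * g s - P s * g' s) has_integral (q c - q a)) {a..c}"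
    proof -
      have 1: "((\<lambda>s. p s * g c) has_integral ((P c - P a) * g c)) {a..c}"
        by (rule has_integral_mult_left[OF i1])
      have 2: "((\<lambda>s. P a * g' s) has_integral (P a * (g c - g a))) {a..c}"
        by (rule has_integral_mult_right[OF ftc[OF ac]])
      have 3: "((\<lambda>s. p s * g s) has_integral (integral {0..c} (\<lambda>s. p s * g s) - integral {0..a} (\<lambda>s. p s * g s))) {a..c}"
        using diff[OF pgi[OF gcont] ac] sub[OF pgi[OF gcont], of a c] ac by (auto simp: has_integral_integral)
      have 4: "((\<lambda>s. P s * g' s) has_integral (integral {0..c} (\<lambda>s. P s * g' s) - integral {0..a} (\<lambda>s. P s * g' s))) {a..c}"
        using diff[OF Pg' ac] sub[OF Pg', of a c] ac by (auto simp: has_integral_integral)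
      show ?thesis
        using has_integral_diff[OF has_integral_diff[OF has_integral_add[OF 1 2] 3] 4]
        by (simp add: q_def algebra_simps)
    qed
    have gl: "norm (g c - g s) \<le> G * (c - a)" if "s \<in> {a..c}" for s
    proof -
      have "norm (g c - g s) \<le> G * (c - s)"
        using has_integral_bound_real[OF _ finite.emptyI, of G g' "g c - g s" s c] ftc[of s c] G that ac G0 by auto
      also have "\<dots> \<le> G * (c - a)" using that G0 by (intro mult_left_mono) auto
      finally show ?thesis .
    qed
    have Pl: "norm (P s - P a) \<le> N c - N a" if "s \<in> {a..c}" for s
    proof -
      have "norm (P s - P a) \<le> integral {a..s} (\<lambda>s. norm (p s))"
        unfolding Pd[OF that] using that ac
        by (intro integral_norm_bound_integral sub[OF pint] sub[OF npint]) auto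
      also have "\<dots> \<le> integral {a..c} (\<lambda>s. norm (p s))"
        using that ac by (intro integral_subset_le sub[OF npint]) auto
      also have "\<dots> = N c - N a" unfolding N_def using diff[OF npint ac] by simp
      finally show ?thesis .
    qed
    have "norm (q c - q a) \<le> integral {a..c} (\<lambda>s. norm (p s) * (G * (c - a)) + (N c - N a) * G)"
    proof -
      have "norm (integral {a..c} (\<lambda>s. p s * g c + P a * g' s - p s * g s - P s * g' s)) \<le> integral {a..c} (\<lambda>s. norm (p s) * (G * (c - a)) + (N c - N a) * G)"
      proof (rule integral_norm_bound_integral)
        show "(\<lambda>s. p s * g c + P a * g' s - p s * g s - P s * g' s) integrable_on {a..c}" using i2 by blast
        show "(\<lambda>s. norm (p s) * (G * (c - a)) + (N c - N a) * G) integrable_on {a..c}"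
          using ac by (intro integrable_add integrable_on_mult_left sub[OF npint]) auto
        fix s assume s: "s \<in> {a..c}"
        have "norm (p s * g c + P a * g' s - p s * g s - P s * g' s) = norm (p s * (g c - g s) - (P s - P a) * g' s)"
          by (simp add: algebra_simps)
        also have "\<dots> \<le> norm (p s) * norm (g c - g s) + norm (P s - P a) * norm (g' s)"
          by (metis norm_mult norm_triangle_ineq4)
        also have "\<dots> \<le> norm (p s) * (G * (c - a)) + (N c - N a) * G"
          using gl[OF s] Pl[OF s] order_trans[OF norm_ge_zero Pl[OF s]] G[of s] s ac
          by (intro add_mono mult_left_mono mult_mono) (auto intro: order_trans[OF norm_ge_zero])
        finally show "norm (p s * g c + P a * g' s - p s * g s - P s * g' s) \<le> norm (p s) * (G * (c - a)) + (N c - N a) * G" .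
      qed
      then show ?thesis using i2 by (simp add: integral_unique)
    qed
    also have "\<dots> = (N c - N a) * (G * (c - a)) + (c - a) * ((N c - N a) * G)"
    proof -
      have "((\<lambda>s. norm (p s)) has_integral (N c - N a)) {a..c}"
        unfolding N_def using diff[OF npint ac] sub[OF npint, of a c] ac by (auto simp: has_integral_integral)
      from has_integral_add[OF has_integral_mult_left[OF this, of "G * (c - a)"] has_integral_const_real[of "(N c - N a) * G" a c]]
      have "((\<lambda>s. norm (p s) * (G * (c - a)) + (N c - N a) * G) has_integral (N c - N a) * (G * (c - a)) + (c - a) * ((N c - N a) * G)) {a..c}"
        using ac by simp
      then show ?thesis by (rule integral_unique)
    qed
    also have "\<dots> = 2 * G * (c - a) * (N c - N a)" by (simp add: algebra_simps)
    finally show ?thesis .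
  qed
  have incr': "norm (q c - q a) \<le> 2 * G * \<bar>c - a\<bar> * \<bar>N c - N a\<bar>" if "a \<in> {0..1}" "c \<in> {0..1}" for a c
  proof (cases "a \<le> c")
    case True
    then show ?thesis using incr[of a c] that G0
      by (smt (verit) atLeastAtMost_iff mult_left_mono mult_nonneg_nonneg)
  next
    case False
    have "norm (q a - q c) \<le> 2 * G * \<bar>a - c\<bar> * \<bar>N a - N c\<bar>"
      using incr[of c a] that G0 False
      by (smt (verit) atLeastAtMost_iff mult_left_mono mult_nonneg_nonneg)
    then show ?thesis by (simp add: norm_minus_commute abs_minus_commute)
  qed
  have "(q has_vector_derivative 0) (at a within {0..1})" if a: "a \<in> {0..1}" for a
    unfolding has_vector_derivative_def has_derivative_within_alt
  proof (intro conjI allI impI)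
    show "bounded_linear (\<lambda>x. x *\<^sub>R (0::complex))" by (rule bounded_linear_scaleR_left)
    fix e :: real assume e: "0 < e"
    obtain d where d: "d > 0" "\<And>c. c \<in> {0..1} \<Longrightarrow> dist c a < d \<Longrightarrow> dist (N c) (N a) < e / (2 * G + 1)"
      using Ncont a e G0 unfolding continuous_on_iff by (metis add_nonneg_pos divide_pos_pos mult_nonneg_nonneg zero_le_numeral zero_less_one)
    show "\<exists>d>0. \<forall>y\<in>{0..1}. norm (y - a) < d \<longrightarrow> norm (q y - q a - (y - a) *\<^sub>R 0) \<le> e * norm (y - a)"
    proof (intro exI[of _ d] conjI ballI impI)
      fix c assume c: "c \<in> {0..1}" "norm (c - a) < d"
      have "norm (q c - q a) \<le> 2 * G * \<bar>c - a\<bar> * \<bar>N c - N a\<bar>" using incr' a c by auto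
      also have "\<dots> \<le> 2 * G * \<bar>c - a\<bar> * (e / (2 * G + 1))"
        using d(2)[of c] c G0 by (intro mult_left_mono) (auto simp: dist_norm)
      also have "\<dots> = (2 * G / (2 * G + 1)) * (e * \<bar>c - a\<bar>)" by simp
      also have "\<dots> \<le> 1 * (e * \<bar>c - a\<bar>)" using G0 e by (intro mult_right_mono) (auto simp: divide_simps)
      finally show "norm (q c - q a - (c - a) *\<^sub>R 0) \<le> e * norm (c - a)" by simp
    qed (use d in auto)
  qed
  then obtain k where k: "\<And>a. a \<in> {0..1} \<Longrightarrow> q a = k"
    using has_vector_derivative_zero_constant[of "{0..1::real}" q] by (metis convex_real_interval(5))
  have "q x = q 0" using k x by simp
  moreover have "q 0 = P 0 * g 0" by (simp add: q_def)
  ultimately show ?thesis unfolding q_def by (simp add: algebra_simps)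
qed

section \<open>Cosine series\<close>

definition cosk :: "nat \<Rightarrow> real \<Rightarrow> complex" where
  "cosk k x = of_real (cos (pi * real k * x))"

text \<open>The normalization makes \<open>coef k\<close> recover the \<open>k\<close>-th coefficient of a cosine series.\<close>

definition coef :: "nat \<Rightarrow> (real \<Rightarrow> complex) \<Rightarrow> complex" where
  "coef k f = (if k = 0 then 1 else 2) * integral {0..1} (\<lambda>x. f x * cosk k x)"

lemma continuous_on_cosk [continuous_intros]: "continuous_on S (cosk k)"
  unfolding cosk_def by (intro continuous_intros)

lemma norm_cosk_le: "norm (cosk k x) \<le> 1"
  by (simp add: cosk_def)

text \<open>Multiplication by \<open>cos \<pi>x\<close> shifts the frequency of \<open>cos \<pi>kx\<close> by one in both directions, so
  orthogonality to all these functions extends to their products with powers of \<open>cos \<pi>x\<close>.\<close>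

lemma cos_power_moments_zero:
  fixes f :: "real \<Rightarrow> real"
  assumes f: "continuous_on {0..1} f"
    and 0: "\<And>k. integral {0..1} (\<lambda>x. f x * cos (pi * real k * x)) = 0"
  shows "integral {0..1} (\<lambda>x. f x * (cos (pi * x) ^ n * cos (pi * real k * x))) = 0"
proof (induction n arbitrary: k)
  case 0
  show ?case using assms(2) by simp
next
  case (Suc n)
  have int: "(\<lambda>x. f x * (cos (pi * x) ^ n * cos (pi * real j * x))) integrable_on {0..1}" for j
    by (intro integrable_continuous_real continuous_intros f)
  show ?case
  proof (cases k)
    case 0
    then show ?thesis using Suc.IH[of 1] by (simp add: mult_ac)
  next
    case (Suc m)
    have eq: "cos (pi * x) * cos (pi * real k * x) = (cos (pi * real (k + 1) * x) + cos (pi * real m * x)) / 2" for x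
      by (simp add: cos_times_cos Suc algebra_simps)
    have "integral {0..1} (\<lambda>x. f x * (cos (pi * x) ^ Suc n * cos (pi * real k * x)))
        = integral {0..1} (\<lambda>x. (1/2) * (f x * (cos (pi * x) ^ n * cos (pi * real (k + 1) * x)) + f x * (cos (pi * x) ^ n * cos (pi * real m * x))))"
    proof (rule arg_cong[where f = "integral {0..1}"], rule ext)
      fix x
      have "f x * (cos (pi * x) ^ Suc n * cos (pi * real k * x)) = f x * cos (pi * x) ^ n * (cos (pi * x) * cos (pi * real k * x))"
        by simp
      also have "\<dots> = (1/2) * (f x * (cos (pi * x) ^ n * cos (pi * real (k + 1) * x)) + f x * (cos (pi * x) ^ n * cos (pi * real m * x)))"
        unfolding eq by (simp add: algebra_simps)
      finally show "f x * (cos (pi * x) ^ Suc n * cos (pi * real k * x)) = \<dots>" .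
    qed
    also have "\<dots> = (1/2) * (integral {0..1} (\<lambda>x. f x * (cos (pi * x) ^ n * cos (pi * real (k + 1) * x))) + integral {0..1} (\<lambda>x. f x * (cos (pi * x) ^ n * cos (pi * real m * x))))"
      using int[of "k + 1"] int[of m] by (simp only: integral_mult_right integral_add)
    also have "\<dots> = 0" unfolding Suc.IH by simp
    finally show ?thesis .
  qed
qed

text \<open>In the variable \<open>cos \<pi>x\<close> the function is continuous on \<open>[-1,1]\<close> and hence a uniform limit of
  polynomials. It is orthogonal to all of them, and therefore to itself.\<close>

lemma cosine_system_complete_real:
  fixes f :: "real \<Rightarrow> real"
  assumes f: "continuous_on {0..1} f"
    and 0: "\<And>k. integral {0..1} (\<lambda>x. f x * cos (pi * real k * x)) = 0"
    and x: "x \<in> {0..1}"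
  shows "f x = 0"
proof -
  have poly0: "integral {0..1} (\<lambda>x. f x * p (cos (pi * x))) = 0" if rp: "real_polynomial_function p" for p
  proof -
    obtain a n where p: "p = (\<lambda>x. \<Sum>i\<le>n. a i * x ^ i)"
      using rp unfolding real_polynomial_function_iff_sum by blast
    have "integral {0..1} (\<lambda>x. f x * p (cos (pi * x))) = integral {0..1} (\<lambda>x. \<Sum>i\<le>n. a i * (f x * (cos (pi * x) ^ i * cos (pi * real 0 * x))))"
      unfolding p by (simp add: sum_distrib_left mult_ac)
    also have "\<dots> = (\<Sum>i\<le>n. integral {0..1} (\<lambda>x. a i * (f x * (cos (pi * x) ^ i * cos (pi * real 0 * x)))))"
      by (intro integral_sum finite_atMost integrable_continuous_real continuous_intros f)
    also have "\<dots> = 0"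
      using cos_power_moments_zero[OF f 0] by (intro sum.neutral ballI) (simp only: integral_mult_right mult_zero_right)
    finally show ?thesis .
  qed
  have sq: "continuous_on {0..1} (\<lambda>x. f x * f x)" by (intro continuous_intros f)
  have "bounded (f ` {0..1})" using f by (intro compact_imp_bounded compact_continuous_image) auto
  then obtain K where K: "\<And>x. x \<in> {0..1} \<Longrightarrow> \<bar>f x\<bar> \<le> K" unfolding bounded_iff image_iff real_norm_def by blast
  have "integral {0..1} (\<lambda>x. f x * f x) \<le> 0"
  proof (rule field_le_epsilon)
    fix e :: real assume e: "0 < e"
    have K0: "0 \<le> K" using order_trans[OF abs_ge_zero K[of 0]] by simp
    define d where "d = e / (K + 1)"
    have d: "0 < d" "K * d \<le> e" using e K0 by (auto simp: d_def field_simps)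
    have fc: "continuous_on {-1..1} (\<lambda>t. f (arccos t / pi))"
      by (rule continuous_on_compose2[OF f]) (auto intro!: continuous_intros continuous_on_arccos' arccos_lbound simp: field_simps arccos_ubound)
    obtain p where p: "real_polynomial_function p" "\<And>t. t \<in> {-1..1} \<Longrightarrow> \<bar>f (arccos t / pi) - p t\<bar> < d"
      using Stone_Weierstrass_real_polynomial_function[of "{-1..1}" "\<lambda>t. f (arccos t / pi)" d] fc d
      by (metis compact_Icc)
    have ap: "\<bar>f x - p (cos (pi * x))\<bar> \<le> d" if "x \<in> {0..1}" for x
      using p(2)[of "cos (pi * x)"] that by (auto simp: arccos_cos mult_left_le)
    have pc: "continuous_on {0..1} (\<lambda>x. p (cos (pi * x)))"
    proof (rule continuous_on_compose2[of UNIV p])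
      show "continuous_on UNIV p"
        using p(1) by (simp add: continuous_on_polymonial_function real_polynomial_function_eq)
      show "continuous_on {0..1} (\<lambda>x. cos (pi * x))" by (intro continuous_intros)
    qed simp
    have i1: "(\<lambda>x. f x * f x) integrable_on {0..1}" by (rule integrable_continuous_real[OF sq])
    have i2: "(\<lambda>x. f x * p (cos (pi * x))) integrable_on {0..1}"
      by (rule integrable_continuous_real[OF continuous_on_mult[OF f pc]])
    have "integral {0..1} (\<lambda>x. f x * f x) = integral {0..1} (\<lambda>x. f x * f x - f x * p (cos (pi * x)))"
      using integral_diff[OF i1 i2] poly0[OF p(1)] by simp
    also have "\<dots> \<le> integral {0..1} (\<lambda>x::real. K * d)"
    proof (rule integral_le)
      fix x :: real assume x: "x \<in> {0..1}"
      have "f x * f x - f x * p (cos (pi * x)) = f x * (f x - p (cos (pi * x)))" by (simp add: algebra_simps)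
      also have "\<dots> \<le> \<bar>f x\<bar> * \<bar>f x - p (cos (pi * x))\<bar>" by (metis abs_ge_self abs_mult)
      also have "\<dots> \<le> K * d" using K[OF x] ap[OF x] by (intro mult_mono) auto
      finally show "f x * f x - f x * p (cos (pi * x)) \<le> K * d" .
    qed (use integrable_diff[OF i1 i2] in auto)
    also have "\<dots> \<le> e" using d by simp
    finally show "integral {0..1} (\<lambda>x. f x * f x) \<le> 0 + e" by simp
  qed
  moreover have "0 \<le> integral {0..1} (\<lambda>x. f x * f x)"
    by (intro integral_nonneg integrable_continuous_real sq) auto
  ultimately have "integral {0..1} (\<lambda>x. f x * f x) = 0" by simp
  then have "((\<lambda>x. f x * f x) has_integral 0) {0..1}"
    using integrable_continuous_real[OF sq] by (simp add: has_integral_iff)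
  then have "((\<lambda>x. f x * f x) has_integral 0) (cbox 0 1)" by simp
  from has_integral_0_cbox_imp_0[OF _ _ this] sq x show ?thesis by auto
qed

lemma integral_Re_Im:
  fixes f :: "real \<Rightarrow> complex"
  assumes "f integrable_on S"
  shows "integral S (\<lambda>x. Re (f x)) = Re (integral S f)" "integral S (\<lambda>x. Im (f x)) = Im (integral S f)"
  using integral_linear[OF assms bounded_linear_Re] integral_linear[OF assms bounded_linear_Im]
  by (simp_all add: o_def)

lemma cosine_system_complete:
  assumes f: "continuous_on {0..1} f"
    and 0: "\<And>k. coef k f = 0"
    and x: "x \<in> {0..1}"
  shows "f x = 0"
proof -
  have i0: "integral {0..1} (\<lambda>x. f x * cosk k x) = 0" for k
    using 0[of k] by (simp add: coef_def split: if_splits)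
  have int: "(\<lambda>x. f x * cosk k x) integrable_on {0..1}" for k
    by (intro integrable_continuous_real continuous_intros f)
  have "Re (f x) = 0"
  proof (rule cosine_system_complete_real[OF _ _ x])
    show "continuous_on {0..1} (\<lambda>x. Re (f x))" by (intro continuous_on_Re f)
    show "integral {0..1} (\<lambda>x. Re (f x) * cos (pi * real k * x)) = 0" for k
      using integral_Re_Im(1)[OF int[of k]] unfolding i0 by (simp add: cosk_def)
  qed
  moreover have "Im (f x) = 0"
  proof (rule cosine_system_complete_real[OF _ _ x])
    show "continuous_on {0..1} (\<lambda>x. Im (f x))" by (intro continuous_on_Im f)
    show "integral {0..1} (\<lambda>x. Im (f x) * cos (pi * real k * x)) = 0" for k
      using integral_Re_Im(2)[OF int[of k]] unfolding i0 by (simp add: cosk_def)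
  qed
  ultimately show ?thesis by (simp add: complex_eq_iff)
qed

lemma integral_cos_pi: "integral {0..1} (\<lambda>x. cos (pi * real_of_int m * x)) = (if m = 0 then 1 else 0)"
proof (cases "m = 0")
  case False
  have "((\<lambda>x. cos (pi * real_of_int m * x)) has_integral (sin (pi * real_of_int m * 1) / (pi * real_of_int m) - sin (pi * real_of_int m * 0) / (pi * real_of_int m))) {0..1}"
  proof (rule fundamental_theorem_of_calculus)
    fix x :: real
    show "((\<lambda>x. sin (pi * real_of_int m * x) / (pi * real_of_int m)) has_vector_derivative cos (pi * real_of_int m * x)) (at x within {0..1})"
      unfolding has_real_derivative_iff_has_vector_derivative[symmetric]
      using False by (auto intro!: derivative_eq_intros)
  qed simp
  moreover have "sin (pi * real_of_int m) = 0" using sin_times_pi_eq_0[of "real_of_int m"] by (simp add: mult.commute)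
  ultimately show ?thesis using False by (auto dest: integral_unique)
qed auto

lemma cosk_orthogonal:
  "integral {0..1} (\<lambda>x. cosk j x * cosk k x) = (if j = k then (if k = 0 then 1 else 1/2) else 0)"
proof -
  have i: "(\<lambda>x. cos (pi * real_of_int m * x)) integrable_on {0..1}" for m
    by (intro integrable_continuous_real continuous_intros)
  have "integral {0..1} (\<lambda>x. cosk j x * cosk k x)
      = integral {0..1} (\<lambda>x. complex_of_real ((1/2) * (cos (pi * real_of_int (int j - int k) * x) + cos (pi * real_of_int (int j + int k) * x))))"
  proof (rule arg_cong[where f = "integral {0..1}"], rule ext)
    fix x
    have "cos (pi * real j * x) * cos (pi * real k * x) = (1/2) * (cos (pi * real_of_int (int j - int k) * x) + cos (pi * real_of_int (int j + int k) * x))"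
      by (simp add: cos_times_cos algebra_simps)
    then show "cosk j x * cosk k x = complex_of_real ((1/2) * (cos (pi * real_of_int (int j - int k) * x) + cos (pi * real_of_int (int j + int k) * x)))"
      unfolding cosk_def of_real_mult[symmetric] by (rule arg_cong)
  qed
  also have "\<dots> = complex_of_real (integral {0..1} (\<lambda>x. (1/2) * (cos (pi * real_of_int (int j - int k) * x) + cos (pi * real_of_int (int j + int k) * x))))"
    by (rule integral_linear[OF _ bounded_linear_of_real, unfolded o_def])
       (intro integrable_on_mult_right integrable_add i)
  also have "\<dots> = complex_of_real ((1/2) * ((if int j - int k = 0 then 1 else 0) + (if int j + int k = 0 then 1 else 0)))"
    by (subst integral_mult_right, subst integral_add[OF i i], subst (1 2) integral_cos_pi) (rule refl)
  finally show ?thesis by auto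
qed

lemma norm_coef_le:
  assumes "(\<lambda>x. f x * cosk k x) integrable_on {0..1}" "\<And>x. x \<in> {0..1} \<Longrightarrow> norm (f x) \<le> K"
  shows "norm (coef k f) \<le> 2 * K"
proof -
  have K0: "0 \<le> K" using order_trans[OF norm_ge_zero assms(2)[of 0]] by simp
  have "norm (integral {0..1} (\<lambda>x. f x * cosk k x)) \<le> integral {0..1} (\<lambda>x::real. K)"
  proof (rule integral_norm_bound_integral)
    fix x :: real assume "x \<in> {0..1}"
    then have "norm (f x) * norm (cosk k x) \<le> K * 1"
      using assms(2) norm_cosk_le K0 by (intro mult_mono) auto
    then show "norm (f x * cosk k x) \<le> K" by (simp add: norm_mult)
  qed (use assms in auto)
  then show ?thesis using K0 by (auto simp: coef_def norm_mult)
qed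

lemma coef_add:
  assumes "(\<lambda>x. f x * cosk k x) integrable_on {0..1}" "(\<lambda>x. g x * cosk k x) integrable_on {0..1}"
  shows "coef k (\<lambda>x. f x + g x) = coef k f + coef k g"
  using assms by (simp add: coef_def integral_add distrib_right distrib_left)

lemma cosine_series:
  assumes c: "summable (\<lambda>k. norm (c k))"
  shows "continuous_on S (\<lambda>x. \<Sum>k. c k * cosk k x)"
    and "norm (\<Sum>k. c k * cosk k x) \<le> (\<Sum>k. norm (c k))"
    and "coef k (\<lambda>x. \<Sum>k. c k * cosk k x) = c k"
    and "summable (\<lambda>k. c k * cosk k x)"
proof -
  have nb: "norm (c k * cosk k x) \<le> norm (c k)" for k x
    using norm_cosk_le[of k x] by (simp add: norm_mult mult_left_le)
  have u: "uniform_limit S (\<lambda>n x. \<Sum>k<n. c k * cosk k x) (\<lambda>x. \<Sum>k. c k * cosk k x) sequentially" for S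
    by (rule Weierstrass_m_test[OF _ c]) (rule nb)
  show "continuous_on S (\<lambda>x. \<Sum>k. c k * cosk k x)" for S
    by (rule uniform_limit_theorem[OF _ u]) (auto intro!: always_eventually continuous_intros)
  have sm: "summable (\<lambda>k. norm (c k * cosk k x))" for x
    by (rule summable_comparison_test'[OF c, of 0]) (use nb in auto)
  show "norm (\<Sum>k. c k * cosk k x) \<le> (\<Sum>k. norm (c k))"
    by (rule order_trans[OF summable_norm[OF sm] suminf_le[OF nb sm c]])
  show "summable (\<lambda>k. c k * cosk k x)" by (rule summable_norm_cancel[OF sm])
  have u': "uniform_limit ({0..1}) (\<lambda>n x. (\<Sum>j<n. c j * cosk j x) * cosk k x) (\<lambda>x. (\<Sum>j. c j * cosk j x) * cosk k x) sequentially"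
  proof (rule uniform_lim_mult[OF u])
    show "bounded (cosk k ` {0..1})" using norm_cosk_le by (auto simp: bounded_iff intro!: exI[of _ 1])
    show "bounded ((\<lambda>x. \<Sum>j. c j * cosk j x) ` {0..1})"
      using order_trans[OF summable_norm[OF sm] suminf_le[OF nb sm c]] by (auto simp: bounded_iff)
  qed (rule uniform_limit_const)
  have cc: "continuous_on {0..1} (\<lambda>x. (\<Sum>j<n. c j * cosk j x) * cosk k x)" for n
    by (intro continuous_intros)
  have lim: "(\<lambda>n. integral {0..1} (\<lambda>x. (\<Sum>j<n. c j * cosk j x) * cosk k x)) \<longlonglongrightarrow> integral {0..1} (\<lambda>x. (\<Sum>j. c j * cosk j x) * cosk k x)"
  proof -
    obtain I J where IJ: "\<And>n. ((\<lambda>x. (\<Sum>j<n. c j * cosk j x) * cosk k x) has_integral I n) {0..1}"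
        "((\<lambda>x. (\<Sum>j. c j * cosk j x) * cosk k x) has_integral J) {0..1}" "I \<longlonglongrightarrow> J"
      by (rule uniform_limit_integral[OF u' cc]) auto
    then show ?thesis using integral_unique[OF IJ(1)] integral_unique[OF IJ(2)] by simp
  qed
  have val: "integral {0..1} (\<lambda>x. (\<Sum>j<n. c j * cosk j x) * cosk k x) = c k * (if k = 0 then 1 else 1/2)" if "k < n" for n
  proof -
    have "integral {0..1} (\<lambda>x. (\<Sum>j<n. c j * cosk j x) * cosk k x) = integral {0..1} (\<lambda>x. \<Sum>j<n. c j * (cosk j x * cosk k x))"
      by (simp add: sum_distrib_right mult.assoc)
    also have "\<dots> = (\<Sum>j<n. c j * integral {0..1} (\<lambda>x. cosk j x * cosk k x))"
      by (subst integral_sum) (auto intro!: integrable_continuous_real continuous_intros)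
    also have "\<dots> = (\<Sum>j<n. if j = k then c k * (if k = 0 then 1 else 1/2) else 0)"
      by (intro sum.cong) (auto simp: cosk_orthogonal)
    also have "\<dots> = c k * (if k = 0 then 1 else 1/2)" using that by simp
    finally show ?thesis .
  qed
  have "(\<lambda>n. integral {0..1} (\<lambda>x. (\<Sum>j<n. c j * cosk j x) * cosk k x)) \<longlonglongrightarrow> c k * (if k = 0 then 1 else 1/2)"
    by (intro tendsto_eventually eventually_sequentiallyI[of "Suc k"] val) simp
  then have "integral {0..1} (\<lambda>x. (\<Sum>j. c j * cosk j x) * cosk k x) = c k * (if k = 0 then 1 else 1/2)"
    using LIMSEQ_unique lim by blast
  then show "coef k (\<lambda>x. \<Sum>k. c k * cosk k x) = c k" by (auto simp: coef_def)
qed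

section \<open>The operator in Fourier coordinates\<close>

text \<open>Of the boundary terms of the two integrations by parts the first vanish by the Neumann conditions
  and the second because \<open>sin \<pi>k = 0\<close>.\<close>

lemma coef_second_derivative:
  assumes p: "p absolutely_integrable_on {0..1}"
    and P: "\<And>x. x \<in> {0..1} \<Longrightarrow> P x = P 0 + integral {0..x} p"
    and y: "\<And>x. x \<in> {0..1} \<Longrightarrow> (y has_vector_derivative P x) (at x within {0..1})"
    and 0: "P 0 = 0" "P 1 = 0"
  shows "coef k p = - of_real ((pi * real k)\<^sup>2) * coef k y"
proof -
  have Pcont: "continuous_on {0..1} P"
  proof (rule continuous_on_eq)
    show "continuous_on {0..1} (\<lambda>x. P 0 + integral {0..x} p)"
      using p set_lebesgue_integral_eq_integral(1) by (intro continuous_intros indefinite_integral_continuous_1) blast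
  qed (use P in metis)
  define s where "s x = complex_of_real (sin (pi * real k * x))" for x
  have dc: "(cosk k has_vector_derivative - of_real (pi * real k) * s x) (at x within {0..1})" for x
  proof -
    have "((\<lambda>x. cos (pi * real k * x)) has_real_derivative - (pi * real k) * sin (pi * real k * x)) (at x within {0..1})"
      by (auto intro!: derivative_eq_intros)
    from has_vector_derivative_of_real[OF this, where 'a = complex] show ?thesis by (simp add: cosk_def[abs_def] s_def)
  qed
  have ds: "(s has_vector_derivative of_real (pi * real k) * cosk k x) (at x within {0..1})" for x
  proof -
    have "((\<lambda>x. sin (pi * real k * x)) has_real_derivative (pi * real k) * cos (pi * real k * x)) (at x within {0..1})"
      by (auto intro!: derivative_eq_intros)
    from has_vector_derivative_of_real[OF this, where 'a = complex] show ?thesis by (simp add: cosk_def s_def[abs_def])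
  qed
  have sc: "continuous_on {0..1} s" unfolding s_def by (intro continuous_intros)
  have s1: "s 1 = 0" "s 0 = 0" using sin_npi[of k] by (simp_all add: s_def mult.commute)
  have "integral {0..1} (\<lambda>x. p x * cosk k x) = P 1 * cosk k 1 - P 0 * cosk k 0 - integral {0..1} (\<lambda>x. P x * (- of_real (pi * real k) * s x))"
    by (rule integral_by_parts_absolutely_continuous[OF p P dc]) (auto intro!: continuous_intros sc)
  also have "\<dots> = of_real (pi * real k) * integral {0..1} (\<lambda>x. P x * s x)"
  proof -
    have "integral {0..1} (\<lambda>x. P x * (- of_real (pi * real k) * s x)) = - of_real (pi * real k) * integral {0..1} (\<lambda>x. P x * s x)"
    proof -
      have "integral {0..1} (\<lambda>x. P x * (- of_real (pi * real k) * s x)) = integral {0..1} (\<lambda>x. - of_real (pi * real k) * (P x * s x))"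
        by (simp only: mult.left_commute)
      also have "\<dots> = - of_real (pi * real k) * integral {0..1} (\<lambda>x. P x * s x)" by (rule integral_mult_right)
      finally show ?thesis .
    qed
    then show ?thesis using 0 by simp
  qed
  also have "integral {0..1} (\<lambda>x. P x * s x) = y 1 * s 1 - y 0 * s 0 - integral {0..1} (\<lambda>x. y x * (of_real (pi * real k) * cosk k x))"
  proof (rule integral_by_parts_absolutely_continuous[OF _ _ ds])
    show "P absolutely_integrable_on {0..1}" by (rule absolutely_integrable_continuous_real[OF Pcont])
    show "y x = y 0 + integral {0..x} P" if "x \<in> {0..1}" for x
      using fundamental_theorem_of_calculus[of 0 x y P] that has_vector_derivative_within_subset[OF y, of _ "{0..x}"]
      by (auto dest!: integral_unique)
  qed (auto intro!: continuous_intros)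
  also have "\<dots> = - of_real (pi * real k) * integral {0..1} (\<lambda>x. y x * cosk k x)"
  proof -
    have "integral {0..1} (\<lambda>x. y x * (of_real (pi * real k) * cosk k x)) = integral {0..1} (\<lambda>x. of_real (pi * real k) * (y x * cosk k x))"
      by (simp only: mult.left_commute)
    also have "\<dots> = of_real (pi * real k) * integral {0..1} (\<lambda>x. y x * cosk k x)" by (rule integral_mult_right)
    finally show ?thesis unfolding s1 by simp
  qed
  finally have "integral {0..1} (\<lambda>x. p x * cosk k x) = - of_real ((pi * real k)\<^sup>2) * integral {0..1} (\<lambda>x. y x * cosk k x)"
    by (simp add: power2_eq_square)
  then show ?thesis by (simp add: coef_def)
qed

lemma L_two_imp_absolutely_integrable:
  assumes "f \<in> L_two"
  shows "f absolutely_integrable_on {0..1}"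
proof -
  interpret finite_measure leb01 by (rule finite_measure_lebesgue_on) auto
  have "integrable leb01 f"
  proof (rule Bochner_Integration.integrable_bound)
    show "integrable leb01 (\<lambda>x. 1 + (norm (f x))\<^sup>2)"
      using assms by (auto simp: L_two_def)
    show "f \<in> borel_measurable leb01" using assms by (simp add: L_two_def)
    show "AE x in leb01. norm (f x) \<le> norm (1 + (norm (f x))\<^sup>2)"
    proof (rule AE_I2)
      fix x
      have "2 * norm (f x) \<le> 1 + (norm (f x))\<^sup>2" using sum_squares_bound[of 1 "norm (f x)"] by simp
      then have "norm (f x) \<le> 1 + (norm (f x))\<^sup>2" using norm_ge_zero[of "f x"] by linarith
      then show "norm (f x) \<le> norm (1 + (norm (f x))\<^sup>2)" by simp
    qed
  qed
  then have "f absolutely_integrable_on {0<..<1}"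
    by (simp add: set_integrable_def integrable_restrict_space)
  then show ?thesis
  proof (rule absolutely_integrable_spike_set)
    show "negligible {x \<in> {0<..<1} - {0..1}. f x \<noteq> 0}" by (rule negligible_subset[of "{0, 1}"]) auto
    show "negligible {x \<in> {0..1} - {0<..<1}. f x \<noteq> 0}" by (rule negligible_subset[of "{0, 1}"]) auto
  qed
qed

lemma W22_derivative:
  assumes "W22 y y' y''"
  shows "y'' absolutely_integrable_on {0..1}"
    and "\<And>x. x \<in> {0..1} \<Longrightarrow> y' x = y' 0 + integral {0..x} y''"
    and "\<And>x. x \<in> {0..1} \<Longrightarrow> (y has_vector_derivative y' x) (at x within {0..1})"
proof -
  show a: "y'' absolutely_integrable_on {0..1}"
    using assms L_two_imp_absolutely_integrable unfolding W22_def by blast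
  show "y' x = y' 0 + integral {0..x} y''" if "x \<in> {0..1}" for x
  proof -
    have "(LINT t:{0..x}|lebesgue. y'' t) = integral {0..x} y''"
      by (rule set_lebesgue_integral_eq_integral(2)[OF set_integrable_subset[OF a]]) (use that in auto)
    then show ?thesis using assms that unfolding W22_def by metis
  qed
  show "(y has_vector_derivative y' x) (at x within {0..1})" if "x \<in> {0..1}" for x
    using assms that unfolding W22_def by blast
qed

lemma bounded_measurable_absolutely_integrable:
  fixes f :: "real \<Rightarrow> complex"
  assumes "f \<in> borel_measurable lebesgue" "\<And>x. norm (f x) \<le> K"
  shows "f absolutely_integrable_on {a..b}"
proof (rule measurable_bounded_by_integrable_imp_absolutely_integrable)
  show "f \<in> borel_measurable (lebesgue_on {a..b})" using assms(1) measurable_restrict_space1 by blast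
  show "(\<lambda>x. K) integrable_on {a..b}" by (simp add: integrable_const_ivl)
qed (use assms in auto)

lemma bounded_measurable_mult_integrable:
  fixes f :: "real \<Rightarrow> complex"
  assumes "f \<in> borel_measurable lebesgue" "\<And>x. norm (f x) \<le> K" "continuous_on {a..b} h"
  shows "(\<lambda>x. f x * h x) integrable_on {a..b}"
  using absolutely_integrable_mult_continuous[OF bounded_measurable_absolutely_integrable[OF assms(1,2)] assms(3)]
    set_lebesgue_integral_eq_integral(1) by blast

lemma coef_diff:
  assumes "(\<lambda>x. f x * cosk k x) integrable_on {0..1}" "(\<lambda>x. g x * cosk k x) integrable_on {0..1}"
  shows "coef k (\<lambda>x. f x - g x) = coef k f - coef k g"
  using assms by (simp add: coef_def integral_diff left_diff_distrib right_diff_distrib)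

lemma coef_cmult: "coef k (\<lambda>x. c * f x) = c * coef k f"
  by (simp add: coef_def mult.assoc)

lemma coef_const: "coef k (\<lambda>x. c) = (if k = 0 then c else 0)"
proof -
  have "coef k (\<lambda>x. c * cosk 0 x) = (if k = 0 then c else 0)"
    unfolding coef_cmult using cosk_orthogonal[of 0 k] by (auto simp: coef_def)
  then show ?thesis by (simp add: cosk_def)
qed

lemma coef_cong: "(\<And>x. x \<in> {0..1} \<Longrightarrow> f x = g x) \<Longrightarrow> coef k f = coef k g"
  unfolding coef_def by (auto intro!: integral_cong)

text \<open>Elliptic regularity for the Neumann problem: a continuous function whose cosine
  coefficients behave like those of a solution of \<open>-y'' = f\<close> is such a solution, since the
  solution obtained by integrating twice has the same coefficients up to a constant.\<close>

lemma W22_from_coefficients: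
  assumes f: "f \<in> borel_measurable lebesgue" "\<And>x. norm (f x) \<le> K"
    and g: "continuous_on {0..1} g" "\<And>x. x \<notin> {0..1} \<Longrightarrow> g x = 0"
    and eq: "\<And>k. coef k f = of_real ((pi * real k)\<^sup>2) * coef k g"
  shows "W22 g (\<lambda>x. - integral {0..x} f) (\<lambda>x. - f x)" and "integral {0..1} f = 0"
proof -
  have int0: "integral {0..1} f = 0" using eq[of 0] by (simp add: coef_def cosk_def)
  then show "integral {0..1} f = 0" .
  define P where "P x = - integral {0..x} f" for x
  have mf: "(\<lambda>x. - f x) \<in> borel_measurable lebesgue" using f(1) by simp
  have bf: "norm (- f x) \<le> K" for x using f(2) by simp
  have nf: "(\<lambda>x. - f x) absolutely_integrable_on {0..1}" "f absolutely_integrable_on {0..1}"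
    using bounded_measurable_absolutely_integrable[OF mf bf] bounded_measurable_absolutely_integrable[OF f] by blast+
  have fi: "f integrable_on {0..1}" using nf(2) set_lebesgue_integral_eq_integral(1) by blast
  have Pcont: "continuous_on {0..1} P"
    unfolding P_def by (intro continuous_intros indefinite_integral_continuous_1 fi)
  define h where "h x = integral {0..x} P" for x
  have hd: "(h has_vector_derivative P x) (at x within {0..1})" if "x \<in> {0..1}" for x
    unfolding h_def by (rule integral_has_vector_derivative[OF Pcont that])
  have hcont: "continuous_on {0..1} h"
    using hd by (metis continuous_on_eq_continuous_within has_vector_derivative_continuous)
  have ch: "coef k (\<lambda>x. - f x) = - of_real ((pi * real k)\<^sup>2) * coef k h" for k
    by (rule coef_second_derivative[OF nf(1) _ hd]) (use int0 in \<open>auto simp: P_def\<close>)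
  have cf: "coef k (\<lambda>x. - f x) = - coef k f" for k using coef_cmult[of k "-1" f] by simp
  define c where "c = coef 0 g - coef 0 h"
  have ci: "(\<lambda>x. u x * cosk k x) integrable_on {0..1}" if "continuous_on {0..1} u" for u k
    by (intro integrable_continuous_real continuous_intros that)
  have "coef k (\<lambda>x. g x - h x - c) = 0" for k
  proof -
    have "coef k (\<lambda>x. g x - h x - c) = coef k g - coef k h - (if k = 0 then c else 0)"
      using coef_diff[of "\<lambda>x. g x - h x" k "\<lambda>x. c"] coef_diff[of g k h] coef_const[of k c]
        ci[of g] ci[of h] ci[of "\<lambda>x. g x - h x"] ci[of "\<lambda>x. c"] g(1) hcont
      by (simp add: continuous_on_diff)
    moreover have "coef k g = coef k h" if "k \<noteq> 0"
      using eq[of k] ch[of k] cf[of k] that by simp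
    ultimately show ?thesis by (auto simp: c_def)
  qed
  then have gh: "g x = h x + c" if "x \<in> {0..1}" for x
  proof -
    have "continuous_on {0..1} (\<lambda>x. g x - h x - c)" by (intro continuous_intros g(1) hcont)
    then have "g x - h x - c = 0" using cosine_system_complete that \<open>\<And>k. coef k (\<lambda>x. g x - h x - c) = 0\<close> by blast
    then show ?thesis by (simp add: algebra_simps)
  qed
  have gd: "(g has_vector_derivative P x) (at x within {0..1})" if "x \<in> {0..1}" for x
  proof (rule has_vector_derivative_transform[OF that])
    show "((\<lambda>x. h x + c) has_vector_derivative P x) (at x within {0..1})"
      using has_vector_derivative_add[OF hd[OF that] has_vector_derivative_const[of c]] by simp
  qed (use gh in auto)
  have L2: "(\<lambda>x. - f x) \<in> L_two"
    unfolding L_two_def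
  proof (intro CollectI conjI)
    show m: "(\<lambda>x. - f x) \<in> borel_measurable leb01" using mf measurable_restrict_space1 by blast
    interpret finite_measure leb01 by (rule finite_measure_lebesgue_on) auto
    show "integrable leb01 (\<lambda>x. (norm (- f x))\<^sup>2)"
      by (rule integrable_const_bound[of _ "K\<^sup>2"]) (use m f(2) in \<open>auto intro!: AE_I2 power_mono\<close>)
  qed
  show "W22 g (\<lambda>x. - integral {0..x} f) (\<lambda>x. - f x)"
    unfolding W22_def
  proof (intro conjI allI impI ballI)
    fix x :: real assume x: "x \<in> {0..1}"
    show "(g has_vector_derivative - integral {0..x} f) (at x within {0..1})" using gd[OF x] by (simp add: P_def)
    have "(LINT t:{0..x}|lebesgue. - f t) = integral {0..x} (\<lambda>t. - f t)"
      using bounded_measurable_absolutely_integrable[OF mf bf] by (rule set_lebesgue_integral_eq_integral(2))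
    then show "- integral {0..x} f = - integral {0..0} f + (LINT t:{0..x}|lebesgue. - f t)" by simp
  next
    show "g x = 0" if "x \<notin> {0..1}" for x by (rule g(2)[OF that])
    show "(\<lambda>x. - f x) \<in> L_two" by (rule L2)
  qed
qed

lemma AE_leb01_integral_cong:
  assumes "AE x in leb01. f x = g x" "a \<le> 1"
  shows "integral {0..a} (\<lambda>x. f x * h x) = integral {0..a} (\<lambda>x. g x * h x)"
proof -
  have "AE x in lebesgue. x \<in> {0<..<1::real} \<longrightarrow> f x = g x"
    using assms(1) AE_restrict_space_iff[of "{0<..<1::real}" lebesgue "\<lambda>x. f x = g x"] by simp
  then obtain N where N: "N \<in> null_sets lebesgue" "{x \<in> space (lebesgue :: real measure). \<not> (x \<in> {0<..<1} \<longrightarrow> f x = g x)} \<subseteq> N"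
    unfolding eventually_ae_filter by blast
  show ?thesis
  proof (rule integral_spike[of "N \<union> {0, 1}"])
    show "negligible (N \<union> {0, 1})" using N(1) by (simp add: negligible_iff_null_sets)
    show "g x * h x = f x * h x" if "x \<in> {0..a} - (N \<union> {0, 1})" for x
    proof -
      have "x \<in> {0<..<1}" "x \<notin> N" using that assms(2) by auto
      then have "f x = g x" using N(2) by auto
      then show ?thesis by simp
    qed
  qed
qed

text \<open>All constants of the asymptotics depend on the coefficients only through \<open>b\<close>, and not on the
  shifts \<open>\<alpha>\<close> and \<open>\<beta>\<close>; this is the source of the uniformity. The bound is required at every point, so that
  \<open>B\<close> maps bounded functions to bounded functions without exceptional null sets.\<close>

locale delay_coefficients =
  fixes V Q :: "real \<Rightarrow> complex" and b \<alpha> \<beta> :: real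
  assumes V: "V \<in> borel_measurable lebesgue" and Q: "Q \<in> borel_measurable lebesgue"
    and VQ: "\<And>x. norm (V x) + norm (Q x) \<le> b" and b1: "1 \<le> b"
begin

abbreviation B where "B \<equiv> B_op V Q \<alpha> \<beta>"

lemma B_cong: "(\<And>x. x \<in> {0..1} \<Longrightarrow> u x = w x) \<Longrightarrow> B u = B w"
  by (auto simp: B_op_def restriction_def translation_def continuation_def fun_eq_iff)

lemma B_add: "B (\<lambda>x. u x + w x) x = B u x + B w x"
  by (auto simp: B_op_def restriction_def translation_def continuation_def algebra_simps)

lemma B_cmult: "B (\<lambda>x. c * u x) x = c * B u x"
  by (auto simp: B_op_def restriction_def translation_def continuation_def algebra_simps)

lemma B_diff: "B (\<lambda>x. u x - w x) x = B u x - B w x"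
  by (auto simp: B_op_def restriction_def translation_def continuation_def algebra_simps)

lemma B_sum: "B (\<lambda>x. \<Sum>i\<in>I. u i x) x = (\<Sum>i\<in>I. B (u i) x)"
  by (cases "finite I", induction I rule: finite_induct)
     (auto simp: B_add, auto simp: B_op_def restriction_def translation_def continuation_def)

lemma B_measurable:
  assumes "continuous_on {0..1} u"
  shows "B u \<in> borel_measurable lebesgue"
proof -
  have "(\<lambda>x. indicator {0<..<1} x *\<^sub>R u x) \<in> borel_measurable borel"
    by (rule borel_measurable_continuous_on_indicator) (auto intro: continuous_on_subset[OF assms])
  moreover have "(\<lambda>x. indicator {0<..<1} x *\<^sub>R u x) = continuation u"
    by (auto simp: fun_eq_iff continuation_def)
  ultimately have c: "continuation u \<in> borel_measurable borel" by simp
  have t: "(\<lambda>x. restriction (translation a (continuation u)) x) \<in> borel_measurable lebesgue" for a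
  proof -
    have "(\<lambda>x. continuation u (x + a)) \<in> borel_measurable borel"
      by (rule measurable_compose[OF _ c]) simp
    then have "(\<lambda>x. indicator {0<..<1} x *\<^sub>R continuation u (x + a)) \<in> borel_measurable borel"
      by (intro borel_measurable_scaleR borel_measurable_indicator) auto
    then have "(\<lambda>x. indicator {0<..<1} x *\<^sub>R continuation u (x + a)) \<in> borel_measurable lebesgue"
      by (simp add: measurable_completion)
    moreover have "(\<lambda>x. indicator {0<..<1} x *\<^sub>R continuation u (x + a)) = restriction (translation a (continuation u))"
      by (auto simp: restriction_def translation_def fun_eq_iff)
    ultimately show ?thesis by simp
  qed
  show ?thesis unfolding B_op_def[abs_def]
    by (intro borel_measurable_add borel_measurable_times V Q t)
qed

lemma B_bound:
  assumes "\<And>x. x \<in> {0..1} \<Longrightarrow> norm (u x) \<le> K"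
  shows "norm (B u x) \<le> b * K"
proof -
  have K0: "0 \<le> K" using order_trans[OF norm_ge_zero assms[of 0]] by simp
  have r: "norm (restriction (translation a (continuation u)) x) \<le> K" for a
    using assms K0 by (auto simp: restriction_def translation_def continuation_def)
  have "norm (B u x) \<le> norm (V x) * K + norm (Q x) * K"
    unfolding B_op_def
    by (rule order_trans[OF norm_triangle_ineq]) (auto simp: norm_mult intro!: add_mono mult_left_mono r)
  also have "\<dots> \<le> b * K" using mult_right_mono[OF VQ[of x] K0] by (simp add: algebra_simps)
  finally show ?thesis .
qed

lemma continuous_bounded01:
  assumes "continuous_on {0..1} (u :: real \<Rightarrow> complex)"
  obtains K where "\<And>x. x \<in> {0..1} \<Longrightarrow> norm (u x) \<le> K"
proof -
  have "bounded (u ` {0..1})" using assms by (intro compact_imp_bounded compact_continuous_image) auto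
  then show ?thesis using that unfolding bounded_iff by blast
qed

lemma B_mult_integrable:
  assumes "continuous_on {0..1} u" "continuous_on {a..c} h"
  shows "(\<lambda>x. B u x * h x) integrable_on {a..c}"
proof -
  obtain K where "\<And>x. x \<in> {0..1} \<Longrightarrow> norm (u x) \<le> K" using continuous_bounded01[OF assms(1)] by blast
  then show ?thesis using bounded_measurable_mult_integrable[OF B_measurable[OF assms(1)] B_bound assms(2)] by blast
qed

text \<open>The space that contains the domain of the operator and all its root vectors.\<close>

definition X :: "(real \<Rightarrow> complex) set" where
  "X = {y. continuous_on {0..1} y \<and> (\<forall>x. x \<notin> {0..1} \<longrightarrow> y x = 0)}"

lemma W22_imp_X: "W22 y y' y'' \<Longrightarrow> y \<in> X"
  unfolding W22_def X_def
  by (auto intro!: has_vector_derivative_continuous simp: continuous_on_eq_continuous_within)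

lemma X_integrable: "y \<in> X \<Longrightarrow> (\<lambda>x. y x * cosk k x) integrable_on {0..1}"
  unfolding X_def by (auto intro!: integrable_continuous_real continuous_intros)

text \<open>In cosine coordinates the operator is the diagonal matrix of the numbers \<open>(\<pi>k)\<^sup>2\<close> plus the bounded
  operator \<open>B\<close>. Smoothness and boundary conditions are absorbed into an equation between coefficients.\<close>

theorem H_op_iff_coefficients:
  assumes w: "continuous_on {0..1} w"
  shows "H_op V Q \<alpha> \<beta> y w \<longleftrightarrow>
    y \<in> X \<and> (\<forall>k. coef k w = of_real ((pi * real k)\<^sup>2) * coef k y + coef k (B y))"
proof
  assume "H_op V Q \<alpha> \<beta> y w"
  then obtain y' y'' where y: "W22 y y' y''" "y' 0 = 0" "y' 1 = 0" "AE x in leb01. w x = - y'' x + B y x"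
    unfolding H_op_def by blast
  have X: "y \<in> X" using W22_imp_X[OF y(1)] .
  note d = W22_derivative[OF y(1)]
  have "coef k w = of_real ((pi * real k)\<^sup>2) * coef k y + coef k (B y)" for k
  proof -
    have c1: "coef k y'' = - of_real ((pi * real k)\<^sup>2) * coef k y"
      by (rule coef_second_derivative[OF d y(2,3)])
    have i: "(\<lambda>x. y'' x * cosk k x) integrable_on {0..1}"
      using absolutely_integrable_mult_continuous[OF d(1) continuous_on_cosk] set_lebesgue_integral_eq_integral(1) by blast
    have i2: "(\<lambda>x. B y x * cosk k x) integrable_on {0..1}"
      using X by (intro B_mult_integrable continuous_intros) (auto simp: X_def)
    have "coef k w = coef k (\<lambda>x. B y x - y'' x)"
      unfolding coef_def using AE_leb01_integral_cong[OF y(4), of 1 "cosk k"] by simp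
    also have "\<dots> = coef k (B y) - coef k y''" by (rule coef_diff[OF i2 i])
    finally show ?thesis using c1 by simp
  qed
  then show "y \<in> X \<and> (\<forall>k. coef k w = of_real ((pi * real k)\<^sup>2) * coef k y + coef k (B y))" using X by blast
next
  assume R: "y \<in> X \<and> (\<forall>k. coef k w = of_real ((pi * real k)\<^sup>2) * coef k y + coef k (B y))"
  then have yc: "continuous_on {0..1} y" by (simp add: X_def)
  define f where "f x = indicator {0..1} x *\<^sub>R w x - B y x" for x
  obtain K where K: "\<And>x. x \<in> {0..1} \<Longrightarrow> norm (w x) \<le> K" using continuous_bounded01[OF w] by blast
  have K0: "0 \<le> K" using order_trans[OF norm_ge_zero K[of 0]] by simp
  obtain L where L: "\<And>x. x \<in> {0..1} \<Longrightarrow> norm (y x) \<le> L" using continuous_bounded01[OF yc] by blast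
  have fm: "f \<in> borel_measurable lebesgue"
    unfolding f_def
  proof (intro borel_measurable_diff B_measurable yc)
    have "(\<lambda>x. indicator {0..1} x *\<^sub>R w x) \<in> borel_measurable borel"
      by (rule borel_measurable_continuous_on_indicator) (auto intro: w)
    then show "(\<lambda>x. indicator {0..1} x *\<^sub>R w x) \<in> borel_measurable lebesgue"
      by (simp add: measurable_completion)
  qed
  have fb: "norm (f x) \<le> K + b * L" for x
  proof -
    have "norm (indicator {0..1} x *\<^sub>R w x) \<le> K" using K K0 by (auto simp: indicator_def)
    then show ?thesis unfolding f_def by (intro order_trans[OF norm_triangle_ineq4] add_mono B_bound L)
  qed
  have cf: "coef k f = of_real ((pi * real k)\<^sup>2) * coef k y" for k
  proof -
    have "coef k f = coef k (\<lambda>x. w x - B y x)" by (rule coef_cong) (simp add: f_def)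
    also have "\<dots> = coef k w - coef k (B y)"
      by (intro coef_diff B_mult_integrable integrable_continuous_real continuous_intros w yc)
    finally show ?thesis using R by simp
  qed
  have "\<And>x. x \<notin> {0..1} \<Longrightarrow> y x = 0" using R by (auto simp: X_def)
  note W = W22_from_coefficients[OF fm fb yc this cf]
  show "H_op V Q \<alpha> \<beta> y w"
    unfolding H_op_def
  proof (intro exI conjI)
    show "W22 y (\<lambda>x. - integral {0..x} f) (\<lambda>x. - f x)" using W by blast
    show "- integral {0..1} f = 0" using W by simp
    show "AE x in leb01. w x = - (- f x) + B y x" by (rule AE_I2) (auto simp: f_def)
  qed simp
qed

end

section \<open>Root subspaces of an operator on a finite-dimensional space\<close>

locale finite_dim_operator = vector_space scale
  for scale :: "complex \<Rightarrow> 'v::ab_group_add \<Rightarrow> 'v" +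
  fixes G :: "'v set" and g :: "'v set" and T :: "'v \<Rightarrow> 'v"
  assumes G: "G = span g" and fin: "finite g" and indep: "independent g"
    and T_mem: "\<And>x. x \<in> G \<Longrightarrow> T x \<in> G"
    and T_add: "\<And>x y. x \<in> G \<Longrightarrow> y \<in> G \<Longrightarrow> T (x + y) = T x + T y"
    and T_scale: "\<And>c x. x \<in> G \<Longrightarrow> T (scale c x) = scale c (T x)"
begin

lemma sub: "subspace G" unfolding G by simp

lemma G_add: "x \<in> G \<Longrightarrow> y \<in> G \<Longrightarrow> x + y \<in> G" and G_scale: "x \<in> G \<Longrightarrow> scale c x \<in> G"
  and G_zero: "0 \<in> G" and G_diff: "x \<in> G \<Longrightarrow> y \<in> G \<Longrightarrow> x - y \<in> G"
  and G_sum: "(\<And>i. i \<in> I \<Longrightarrow> f i \<in> G) \<Longrightarrow> sum f I \<in> G"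
  using sub by (auto intro: subspace_add subspace_scale subspace_0 subspace_diff subspace_sum)

lemma T_zero: "T 0 = 0" using T_scale[OF G_zero, of 0] by simp

lemma T_diff: "x \<in> G \<Longrightarrow> y \<in> G \<Longrightarrow> T (x - y) = T x - T y"
  using T_add[of "x - y" y] G_diff by (simp add: algebra_simps)

definition shift :: "complex \<Rightarrow> 'v \<Rightarrow> 'v" where "shift \<mu> x = T x - scale \<mu> x"

lemma shift_mem: "x \<in> G \<Longrightarrow> shift \<mu> x \<in> G"
  unfolding shift_def by (intro G_diff T_mem G_scale)

lemma shift_add: "x \<in> G \<Longrightarrow> y \<in> G \<Longrightarrow> shift \<mu> (x + y) = shift \<mu> x + shift \<mu> y"
  by (simp add: shift_def T_add scale_right_distrib)

lemma shift_scale: "x \<in> G \<Longrightarrow> shift \<mu> (scale c x) = scale c (shift \<mu> x)"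
  by (simp add: shift_def T_scale scale_right_diff_distrib scale_left_commute)

lemma shift_zero: "shift \<mu> 0 = 0" by (simp add: shift_def T_zero)

lemma shift_diff: "x \<in> G \<Longrightarrow> y \<in> G \<Longrightarrow> shift \<mu> (x - y) = shift \<mu> x - shift \<mu> y"
  by (simp add: shift_def T_diff scale_right_diff_distrib)

lemma shift_sum: "(\<And>i. i \<in> I \<Longrightarrow> f i \<in> G) \<Longrightarrow> shift \<mu> (sum f I) = (\<Sum>i\<in>I. shift \<mu> (f i))"
proof (induction I rule: infinite_finite_induct)
  case (insert x F)
  then show ?case using shift_add[of "f x" "sum f F" \<mu>] G_sum[of F f] by simp
qed (auto simp: shift_zero)

lemma shift_commute: "x \<in> G \<Longrightarrow> shift \<mu> (shift \<nu> x) = shift \<nu> (shift \<mu> x)"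
  by (simp add: shift_def T_diff T_scale T_mem G_scale scale_right_diff_distrib scale_left_commute algebra_simps)

primrec root_ker :: "complex \<Rightarrow> nat \<Rightarrow> 'v set" where
  "root_ker \<mu> 0 = {0}"
| "root_ker \<mu> (Suc k) = {x \<in> G. shift \<mu> x \<in> root_ker \<mu> k}"

definition root_space :: "complex \<Rightarrow> 'v set" where "root_space \<mu> = (\<Union>k. root_ker \<mu> k)"

lemma root_ker_subset: "root_ker \<mu> k \<subseteq> G"
  by (cases k) (auto simp: G_zero)

lemma root_ker_Suc_mono: "root_ker \<mu> k \<subseteq> root_ker \<mu> (Suc k)"
  by (induction k) (auto simp: G_zero shift_zero)

lemma root_ker_mono: "i \<le> k \<Longrightarrow> root_ker \<mu> i \<subseteq> root_ker \<mu> k"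
  by (rule lift_Suc_mono_le[of "root_ker \<mu>"]) (use root_ker_Suc_mono in auto)

lemma subspace_root_ker: "subspace (root_ker \<mu> k)"
proof (induction k)
  case (Suc k)
  then show ?case unfolding subspace_def
    by (auto simp: G_add G_scale G_zero shift_zero shift_add shift_scale)
qed (simp add: subspace_def)

lemma subspace_root_space: "subspace (root_space \<mu>)"
  unfolding subspace_def
proof (intro conjI ballI allI)
  show "0 \<in> root_space \<mu>" unfolding root_space_def by (rule UN_I[of 0]) auto
next
  fix x y assume "x \<in> root_space \<mu>" "y \<in> root_space \<mu>"
  then obtain i j where "x \<in> root_ker \<mu> i" "y \<in> root_ker \<mu> j" unfolding root_space_def by auto
  then have "x \<in> root_ker \<mu> (max i j)" "y \<in> root_ker \<mu> (max i j)"
    using root_ker_mono[of i "max i j" \<mu>] root_ker_mono[of j "max i j" \<mu>] by auto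
  then show "x + y \<in> root_space \<mu>" unfolding root_space_def using subspace_add[OF subspace_root_ker] by blast
next
  fix c x assume "x \<in> root_space \<mu>"
  then show "scale c x \<in> root_space \<mu>" unfolding root_space_def using subspace_scale[OF subspace_root_ker] by blast
qed

lemma root_space_subset: "root_space \<mu> \<subseteq> G"
  unfolding root_space_def using root_ker_subset by blast

lemma root_ker_shift: "x \<in> root_ker \<nu> k \<Longrightarrow> shift \<mu> x \<in> root_ker \<nu> k"
proof (induction k arbitrary: x)
  case (Suc k)
  then show ?case using shift_commute[of x \<nu> \<mu>] by (auto simp: shift_mem)
qed (simp add: shift_zero)

lemma root_space_shift: "x \<in> root_space \<nu> \<Longrightarrow> shift \<mu> x \<in> root_space \<nu>"
  unfolding root_space_def using root_ker_shift by blast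

lemma shift_mem_root_space: "x \<in> G \<Longrightarrow> shift \<mu> x \<in> root_space \<mu> \<Longrightarrow> x \<in> root_space \<mu>"
proof -
  assume x: "x \<in> G" "shift \<mu> x \<in> root_space \<mu>"
  then obtain k where "shift \<mu> x \<in> root_ker \<mu> k" unfolding root_space_def by auto
  then have "x \<in> root_ker \<mu> (Suc k)" using x by simp
  then show ?thesis unfolding root_space_def by blast
qed

lemma shift_inj_root_ker:
  assumes "\<mu> \<noteq> \<nu>" "x \<in> root_ker \<nu> k" "shift \<mu> x = 0"
  shows "x = 0"
  using assms(2,3)
proof (induction k arbitrary: x)
  case (Suc k)
  have xG: "x \<in> G" using Suc.prems by simp
  have "shift \<mu> (shift \<nu> x) = 0" using shift_commute[OF xG, of \<mu> \<nu>] Suc.prems(2) shift_zero by simp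
  then have "shift \<nu> x = 0" using Suc by auto
  moreover have "scale (\<mu> - \<nu>) x = shift \<nu> x - shift \<mu> x" by (simp add: shift_def scale_left_diff_distrib)
  ultimately have "scale (\<mu> - \<nu>) x = 0" using Suc.prems(2) by simp
  then show ?case using assms(1) by (auto simp: scale_eq_0_iff)
qed simp

text \<open>On the root space of \<open>\<nu>\<close> the operator \<open>T - \<mu>\<close> is a nonzero scalar plus a nilpotent operator.\<close>

lemma shift_surj_root_ker:
  assumes "\<mu> \<noteq> \<nu>" "x \<in> root_ker \<nu> k"
  shows "\<exists>y\<in>root_ker \<nu> k. shift \<mu> y = x"
  using assms(2)
proof (induction k arbitrary: x)
  case 0
  then show ?case by (auto simp: shift_zero)
next
  case (Suc k)
  then have xG: "x \<in> G" "shift \<nu> x \<in> root_ker \<nu> k" by auto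
  obtain y where y: "y \<in> root_ker \<nu> k" "shift \<mu> y = shift \<nu> x" using Suc.IH[OF xG(2)] by blast
  have yG: "y \<in> G" using y(1) root_ker_subset by blast
  have y': "y \<in> root_ker \<nu> (Suc k)" using y(1) root_ker_Suc_mono by blast
  define z where "z = scale (1 / (\<nu> - \<mu>)) (x - y)"
  have "x - y \<in> root_ker \<nu> (Suc k)" by (rule subspace_diff[OF subspace_root_ker Suc.prems y'])
  then have "z \<in> root_ker \<nu> (Suc k)" unfolding z_def by (rule subspace_scale[OF subspace_root_ker])
  moreover have "shift \<mu> z = x"
  proof -
    have "shift \<mu> (x - y) = shift \<mu> x - shift \<nu> x" using shift_diff[OF xG(1) yG] y by simp
    also have "\<dots> = scale (\<nu> - \<mu>) x" by (simp add: shift_def scale_left_diff_distrib)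
    finally show ?thesis unfolding z_def using shift_scale[OF G_diff[OF xG(1) yG]] assms(1) by simp
  qed
  ultimately show ?case by blast
qed

lemma root_space_trivial:
  assumes "\<And>x. x \<in> G \<Longrightarrow> shift \<mu> x = 0 \<Longrightarrow> x = 0"
  shows "root_space \<mu> = {0}"
proof -
  have "root_ker \<mu> k = {0}" for k
  proof (induction k)
    case (Suc k)
    show ?case using assms G_zero shift_zero by (auto simp: Suc.IH)
  qed simp
  then show ?thesis by (simp add: root_space_def)
qed

lemma root_spaces_direct:
  assumes "finite M" "\<And>\<mu>. \<mu> \<in> M \<Longrightarrow> w \<mu> \<in> root_space \<mu>" "(\<Sum>\<mu>\<in>M. w \<mu>) = 0"
  shows "\<forall>\<mu>\<in>M. w \<mu> = 0"
  using assms
proof (induction M arbitrary: w rule: finite_induct)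
  case (insert \<mu> F)
  have wG: "w \<nu> \<in> G" if "\<nu> \<in> insert \<mu> F" for \<nu> using insert.prems(1)[OF that] root_space_subset by blast
  \<comment> \<open>Applying a power of \<open>T - \<mu>\<close> kills \<open>w \<mu>\<close> and is injective on the other root spaces.\<close>
  have pow: "\<forall>v. (\<forall>\<nu>\<in>insert \<mu> F. v \<nu> \<in> root_space \<nu>) \<longrightarrow> v \<mu> \<in> root_ker \<mu> k \<longrightarrow> (\<Sum>\<nu>\<in>insert \<mu> F. v \<nu>) = 0 \<longrightarrow> (\<forall>\<nu>\<in>F. v \<nu> = 0)" for k
  proof (induction k)
    case 0
    show ?case
    proof (intro allI impI)
      fix v assume v: "\<forall>\<nu>\<in>insert \<mu> F. v \<nu> \<in> root_space \<nu>" "v \<mu> \<in> root_ker \<mu> 0" "(\<Sum>\<nu>\<in>insert \<mu> F. v \<nu>) = 0"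
      then have "(\<Sum>\<nu>\<in>F. v \<nu>) = 0" using insert.hyps by simp
      then show "\<forall>\<nu>\<in>F. v \<nu> = 0" using insert.IH[of v] v by blast
    qed
  next
    case (Suc k)
    show ?case
    proof (intro allI impI ballI)
      fix v \<nu> assume v: "\<forall>\<nu>\<in>insert \<mu> F. v \<nu> \<in> root_space \<nu>" "v \<mu> \<in> root_ker \<mu> (Suc k)" "(\<Sum>\<nu>\<in>insert \<mu> F. v \<nu>) = 0" and \<nu>: "\<nu> \<in> F"
      have vG: "v \<nu> \<in> G" if "\<nu> \<in> insert \<mu> F" for \<nu> using v(1) that root_space_subset by blast
      have "(\<Sum>\<nu>\<in>insert \<mu> F. shift \<mu> (v \<nu>)) = 0"
        using shift_sum[of "insert \<mu> F" v \<mu>, OF vG] v(3) shift_zero by simp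
      moreover have "\<forall>\<nu>\<in>insert \<mu> F. shift \<mu> (v \<nu>) \<in> root_space \<nu>" using v(1) root_space_shift by blast
      moreover have "shift \<mu> (v \<mu>) \<in> root_ker \<mu> k" using v(2) by simp
      ultimately have "\<forall>\<nu>\<in>F. shift \<mu> (v \<nu>) = 0" using Suc.IH[THEN spec, of "\<lambda>\<nu>. shift \<mu> (v \<nu>)"] by blast
      then have "shift \<mu> (v \<nu>) = 0" using \<nu> by blast
      moreover obtain i where "v \<nu> \<in> root_ker \<nu> i" using v(1) \<nu> unfolding root_space_def by blast
      moreover have "\<mu> \<noteq> \<nu>" using \<nu> insert.hyps by blast
      ultimately show "v \<nu> = 0" using shift_inj_root_ker by blast
    qed
  qed
  obtain k where "w \<mu> \<in> root_ker \<mu> k" using insert.prems(1)[of \<mu>] unfolding root_space_def by auto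
  then have F0: "\<forall>\<nu>\<in>F. w \<nu> = 0" using pow[of k] insert.prems by blast
  then have "w \<mu> = 0" using insert.prems(2) insert.hyps by (simp add: sum.neutral)
  then show ?case using F0 by blast
qed simp

definition root_sum :: "'v set" where "root_sum = span (\<Union>\<mu>. root_space \<mu>)"

text \<open>The sum of all root spaces absorbs preimages under every \<open>T - \<mu>\<close>. Applied to the linear factors of
  an annihilating polynomial, one after the other, this shows that the sum is the whole space.\<close>

lemma shift_mem_root_sum:
  assumes y: "y \<in> G" "shift \<mu> y \<in> root_sum"
  shows "y \<in> root_sum"
proof -
  \<comment> \<open>Modulo the image of \<open>T - \<mu>\<close> on the sum, only the component in the root space of \<open>\<mu>\<close> remains.\<close>
  have red: "\<exists>z\<in>root_sum \<inter> G. x - shift \<mu> z \<in> root_space \<mu>" if "x \<in> root_sum" for x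
    using that unfolding root_sum_def
  proof (induction rule: span_induct_alt)
    case base
    show ?case by (rule bexI[of _ 0]) (auto simp: shift_zero subspace_0[OF subspace_root_space] span_zero G_zero)
  next
    case (step c x y)
    obtain \<nu> where \<nu>: "x \<in> root_space \<nu>" using step(1) by blast
    obtain z where z: "z \<in> span (\<Union>\<mu>. root_space \<mu>) \<inter> G" "y - shift \<mu> z \<in> root_space \<mu>" using step(2) by blast
    have xG: "x \<in> G" using \<nu> root_space_subset by blast
    show ?case
    proof (cases "\<nu> = \<mu>")
      case True
      have "scale c x + (y - shift \<mu> z) \<in> root_space \<mu>"
        using \<nu> z(2) True by (intro subspace_add[OF subspace_root_space] subspace_scale[OF subspace_root_space]) auto
      then show ?thesis using z(1) by (intro bexI[of _ z]) (auto simp: algebra_simps)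
    next
      case False
      obtain k where "x \<in> root_ker \<nu> k" using \<nu> unfolding root_space_def by blast
      then obtain u where u: "u \<in> root_ker \<nu> k" "shift \<mu> u = x" using shift_surj_root_ker[of \<mu> \<nu> x k] False by metis
      have uG: "u \<in> G" using u root_ker_subset by blast
      have us: "u \<in> span (\<Union>\<mu>. root_space \<mu>)" using u(1) unfolding root_space_def by (intro span_base) blast
      have "shift \<mu> (scale c u + z) = scale c x + shift \<mu> z"
        using shift_add[of "scale c u" z \<mu>] shift_scale[OF uG] G_scale[OF uG] z(1) u(2) by auto
      then show ?thesis
        using z us uG by (intro bexI[of _ "scale c u + z"]) (auto intro!: span_add span_scale G_add G_scale)
    qed
  qed
  obtain z where z: "z \<in> root_sum \<inter> G" "shift \<mu> y - shift \<mu> z \<in> root_space \<mu>" using red[OF y(2)] by blast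
  have "shift \<mu> (y - z) \<in> root_space \<mu>" using z y(1) shift_diff by auto
  then have "y - z \<in> root_space \<mu>" using z(1) y(1) G_diff shift_mem_root_space by blast
  then have "y - z \<in> root_sum" unfolding root_sum_def by (intro span_base) blast
  then have "(y - z) + z \<in> root_sum" using z(1) unfolding root_sum_def by (intro span_add) auto
  then show ?thesis by simp
qed

definition poly_op :: "complex poly \<Rightarrow> 'v \<Rightarrow> 'v" where
  "poly_op p x = (\<Sum>i\<le>degree p. scale (poly.coeff p i) ((T ^^ i) x))"

lemma poly_op_bound: "degree p \<le> n \<Longrightarrow> poly_op p x = (\<Sum>i\<le>n. scale (poly.coeff p i) ((T ^^ i) x))"
  unfolding poly_op_def by (rule sum.mono_neutral_left) (auto simp: coeff_eq_0)

lemma T_pow_mem: "x \<in> G \<Longrightarrow> (T ^^ i) x \<in> G"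
  by (induction i) (auto intro: T_mem)

lemma T_pow_shift: "x \<in> G \<Longrightarrow> (T ^^ i) (shift \<mu> x) = (T ^^ Suc i) x - scale \<mu> ((T ^^ i) x)"
proof (induction i)
  case (Suc i)
  then show ?case using T_diff[OF T_pow_mem[of x "Suc i"] G_scale[OF T_pow_mem[of x i]]] T_scale[OF T_pow_mem[of x i]]
    by (simp add: shift_def)
qed (simp add: shift_def)

lemma poly_op_linear_factor:
  assumes x: "x \<in> G"
  shows "poly_op ([:-\<mu>, 1:] * q) x = poly_op q (shift \<mu> x)"
proof -
  let ?n = "degree q"
  have eq: "[:-\<mu>, 1:] * q = pCons 0 q - smult \<mu> q" by simp
  have "degree ([:-\<mu>, 1:] * q) \<le> Suc ?n"
    using degree_mult_le[of "[:-\<mu>, 1:]" q] by (simp add: le_trans)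
  then have "poly_op ([:-\<mu>, 1:] * q) x = (\<Sum>i\<le>Suc ?n. scale (poly.coeff ([:-\<mu>, 1:] * q) i) ((T ^^ i) x))"
    by (rule poly_op_bound)
  also have "\<dots> = (\<Sum>i\<le>Suc ?n. scale (poly.coeff (pCons 0 q) i) ((T ^^ i) x)) - (\<Sum>i\<le>Suc ?n. scale (\<mu> * poly.coeff q i) ((T ^^ i) x))"
    unfolding eq by (simp only: coeff_diff coeff_smult scale_left_diff_distrib sum_subtractf)
  also have "(\<Sum>i\<le>Suc ?n. scale (poly.coeff (pCons 0 q) i) ((T ^^ i) x)) = (\<Sum>i\<le>?n. scale (poly.coeff q i) ((T ^^ Suc i) x))"
    by (subst sum.atMost_Suc_shift) simp
  also have "(\<Sum>i\<le>Suc ?n. scale (\<mu> * poly.coeff q i) ((T ^^ i) x)) = (\<Sum>i\<le>?n. scale (poly.coeff q i) (scale \<mu> ((T ^^ i) x)))"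
    by (simp add: coeff_eq_0 mult.commute)
  also have "(\<Sum>i\<le>?n. scale (poly.coeff q i) ((T ^^ Suc i) x)) - \<dots> = (\<Sum>i\<le>?n. scale (poly.coeff q i) ((T ^^ i) (shift \<mu> x)))"
    by (simp only: T_pow_shift[OF x] scale_right_diff_distrib sum_subtractf)
  finally show ?thesis by (simp add: poly_op_def)
qed

lemma poly_op_zero_imp_root_sum:
  assumes "p \<noteq> 0" "x \<in> G" "poly_op p x = 0"
  shows "x \<in> root_sum"
  using assms
proof (induction "degree p" arbitrary: p x)
  case 0
  then obtain c where "p = [:c:]" "c \<noteq> 0" by (metis degree_eq_zeroE pCons_0_0)
  then have "x = 0" using 0 by (simp add: poly_op_def)
  then show ?case unfolding root_sum_def by (simp add: span_zero)
next
  case (Suc n)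
  then have "\<not> constant (poly p)" by (simp add: constant_degree)
  then obtain \<mu> where "poly p \<mu> = 0" using fundamental_theorem_of_algebra by blast
  then obtain q where q: "p = [:-\<mu>, 1:] * q" by (auto simp: poly_eq_0_iff_dvd)
  have "q \<noteq> 0" using q Suc.prems(1) by auto
  then have "degree q = n" using Suc.hyps(2) degree_mult_eq[of "[:-\<mu>, 1:]" q] unfolding q by simp
  moreover have "poly_op q (shift \<mu> x) = 0" using poly_op_linear_factor[OF Suc.prems(2)] Suc.prems(3) q by simp
  ultimately have "shift \<mu> x \<in> root_sum" using Suc.hyps(1) \<open>q \<noteq> 0\<close> shift_mem[OF Suc.prems(2)] by blast
  then show ?case using shift_mem_root_sum Suc.prems(2) by blast
qed

text \<open>The iterates \<open>x, T x, T\<^sup>2 x, \<dots>\<close> are linearly dependent, or else two of them coincide.\<close>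

lemma annihilating_polynomial:
  assumes x: "x \<in> G"
  shows "\<exists>p. p \<noteq> 0 \<and> poly_op p x = 0"
proof (cases "inj_on (\<lambda>i. (T ^^ i) x) {..card g}")
  case True
  let ?f = "\<lambda>i. (T ^^ i) x"
  have "dependent (?f ` {..card g})"
  proof (rule ccontr)
    assume "independent (?f ` {..card g})"
    then have "card (?f ` {..card g}) \<le> card g"
      using independent_span_bound[OF fin, of "?f ` {..card g}"] T_pow_mem[OF x] unfolding G by blast
    then show False using card_image[OF True] by simp
  qed
  then obtain u where u: "\<exists>v\<in>?f ` {..card g}. u v \<noteq> 0" "(\<Sum>v\<in>?f ` {..card g}. scale (u v) v) = 0"
    using dependent_finite[of "?f ` {..card g}"] by auto
  define p where "p = (\<Sum>i\<le>card g. monom (u (?f i)) i)"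
  have c: "poly.coeff p i = (if i \<le> card g then u (?f i) else 0)" for i
    unfolding p_def by (simp add: coeff_sum)
  have "degree p \<le> card g" by (rule degree_le) (simp add: c)
  then have "poly_op p x = (\<Sum>i\<le>card g. scale (u (?f i)) (?f i))"
    by (simp add: poly_op_bound c)
  also have "\<dots> = 0" using u(2) sum.reindex[OF True, of "\<lambda>v. scale (u v) v"] by simp
  finally have "poly_op p x = 0" .
  moreover have "p \<noteq> 0"
  proof
    assume "p = 0"
    then have "u (?f i) = 0" if "i \<le> card g" for i using c[of i] that by simp
    then show False using u(1) by auto
  qed
  ultimately show ?thesis by blast
next
  case False
  then obtain i j where ij: "i < j" "(T ^^ i) x = (T ^^ j) x"
    unfolding inj_on_def by (metis linorder_neqE_nat)
  define p where "p = monom (1::complex) i - monom 1 j"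
  have c: "poly.coeff p k = (if k = i then 1 else 0) - (if k = j then 1 else 0)" for k by (simp add: p_def)
  have "degree p \<le> j" by (rule degree_le) (use ij in \<open>auto simp: c\<close>)
  then have "poly_op p x = (\<Sum>k\<le>j. scale (poly.coeff p k) ((T ^^ k) x))" by (rule poly_op_bound)
  also have "\<dots> = (\<Sum>k\<le>j. (if k = i then (T ^^ i) x else 0)) - (\<Sum>k\<le>j. (if k = j then (T ^^ j) x else 0))"
    unfolding sum_subtractf[symmetric] by (rule sum.cong) (use ij in \<open>auto simp: c\<close>)
  also have "\<dots> = 0" using ij by simp
  finally have "poly_op p x = 0" .
  moreover have "p \<noteq> 0" using c[of i] ij by auto
  ultimately show ?thesis by blast
qed

lemma root_sum_eq: "root_sum = G"
proof
  show "root_sum \<subseteq> G" unfolding root_sum_def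
    by (rule span_minimal[OF _ sub]) (use root_space_subset in blast)
  show "G \<subseteq> root_sum" using annihilating_polynomial poly_op_zero_imp_root_sum by blast
qed

lemma independent_union_bases:
  assumes M: "finite M" and b: "\<And>\<mu>. \<mu> \<in> M \<Longrightarrow> finite (b \<mu>) \<and> independent (b \<mu>) \<and> span (b \<mu>) = root_space \<mu>"
  shows "independent (\<Union>\<mu>\<in>M. b \<mu>)" and "card (\<Union>\<mu>\<in>M. b \<mu>) = (\<Sum>\<mu>\<in>M. card (b \<mu>))"
proof -
  have disj: "b \<mu> \<inter> b \<nu> = {}" if "\<mu> \<in> M" "\<nu> \<in> M" "\<mu> \<noteq> \<nu>" for \<mu> \<nu>
  proof (rule ccontr)
    assume "b \<mu> \<inter> b \<nu> \<noteq> {}"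
    then obtain x where x: "x \<in> b \<mu>" "x \<in> b \<nu>" by blast
    then have xs: "x \<in> root_space \<mu>" "x \<in> root_space \<nu>" using b that span_base by blast+
    have "\<forall>\<kappa>\<in>{\<mu>, \<nu>}. (if \<kappa> = \<mu> then x else - x) = 0"
      by (rule root_spaces_direct) (use that xs subspace_neg[OF subspace_root_space] in auto)
    then have "x = 0" by auto
    then show False using x(1) b[OF that(1)] dependent_zero by blast
  qed
  show "card (\<Union>\<mu>\<in>M. b \<mu>) = (\<Sum>\<mu>\<in>M. card (b \<mu>))"
    by (rule card_UN_disjoint) (use M b disj in auto)
  show "independent (\<Union>\<mu>\<in>M. b \<mu>)"
  proof (rule independent_if_scalars_zero)
    show "finite (\<Union>\<mu>\<in>M. b \<mu>)" using M b by auto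
    fix f x assume f: "(\<Sum>x\<in>(\<Union>\<mu>\<in>M. b \<mu>). scale (f x) x) = 0" and x: "x \<in> (\<Union>\<mu>\<in>M. b \<mu>)"
    have "(\<Sum>x\<in>(\<Union>\<mu>\<in>M. b \<mu>). scale (f x) x) = (\<Sum>\<mu>\<in>M. \<Sum>x\<in>b \<mu>. scale (f x) x)"
      by (rule sum.UNION_disjoint) (use M b disj in auto)
    moreover have "(\<Sum>x\<in>b \<mu>. scale (f x) x) \<in> root_space \<mu>" if "\<mu> \<in> M" for \<mu>
    proof -
      have "(\<Sum>x\<in>b \<mu>. scale (f x) x) \<in> span (b \<mu>)" by (intro span_sum span_scale span_base)
      then show ?thesis using b[OF that] by simp
    qed
    ultimately have "\<forall>\<mu>\<in>M. (\<Sum>x\<in>b \<mu>. scale (f x) x) = 0"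
      using f by (intro root_spaces_direct[OF M]) auto
    moreover obtain \<mu> where \<mu>: "\<mu> \<in> M" "x \<in> b \<mu>" using x by blast
    ultimately have "(\<Sum>x\<in>b \<mu>. scale (f x) x) = 0" by blast
    then show "f x = 0" using b[OF \<mu>(1)] \<mu>(2) dependent_finite[of "b \<mu>"] by auto
  qed
qed

lemma sum_root_multiplicities_le:
  assumes "finite M" "\<And>\<mu>. \<mu> \<in> M \<Longrightarrow> finite (b \<mu>) \<and> independent (b \<mu>) \<and> span (b \<mu>) = root_space \<mu>"
  shows "(\<Sum>\<mu>\<in>M. card (b \<mu>)) \<le> card g"
proof -
  have "(\<Union>\<mu>\<in>M. b \<mu>) \<subseteq> span g"
    using assms(2) root_space_subset span_base unfolding G by blast
  then have "card (\<Union>\<mu>\<in>M. b \<mu>) \<le> card g"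
    using independent_span_bound[OF fin independent_union_bases(1)[OF assms]] by blast
  then show ?thesis using independent_union_bases(2)[OF assms] by simp
qed

theorem sum_root_multiplicities:
  assumes "finite M" "\<And>\<mu>. \<mu> \<in> M \<Longrightarrow> finite (b \<mu>) \<and> independent (b \<mu>) \<and> span (b \<mu>) = root_space \<mu>"
    and other: "\<And>\<mu>. \<mu> \<notin> M \<Longrightarrow> root_space \<mu> = {0}"
  shows "(\<Sum>\<mu>\<in>M. card (b \<mu>)) = card g"
proof -
  let ?U = "\<Union>\<mu>\<in>M. b \<mu>"
  have "span ?U = G"
  proof
    show "span ?U \<subseteq> G"
      by (rule span_minimal[OF _ sub]) (use assms(2) root_space_subset span_base in blast)
    have "root_space \<mu> \<subseteq> span ?U" for \<mu>
    proof (cases "\<mu> \<in> M")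
      case True
      then show ?thesis using assms(2)[OF True] span_mono[of "b \<mu>" ?U] by blast
    qed (simp add: other span_zero)
    then have "root_sum \<subseteq> span ?U" unfolding root_sum_def by (intro span_minimal) auto
    then show "G \<subseteq> span ?U" by (simp add: root_sum_eq)
  qed
  then have "card ?U = card g"
    using dim_eq_card[OF _ independent_union_bases(1)[OF assms(1,2)], of g] dim_eq_card[OF _ indep, of g] G by simp
  then show ?thesis using independent_union_bases(2)[OF assms(1,2)] by simp
qed

end

section \<open>Spectral gaps of the unperturbed operator\<close>

text \<open>The eigenvalues of the operator without delay terms.\<close>

definition ev :: "nat \<Rightarrow> real" where "ev k = (pi * real k)\<^sup>2"

text \<open>The radius of a circle that separates the \<open>N\<close>-th from the next unperturbed eigenvalue.\<close>

definition radius :: "nat \<Rightarrow> real" where "radius N = (pi * (real N + 1/2))\<^sup>2"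

definition gap_const :: real where "gap_const = (\<Sum>i. 1 / (real (Suc i) * sqrt (real (Suc i))))"

text \<open>Since \<open>(j - m)(j + m) \<ge> (j - m)\<^bsup>3/2\<^esup> N\<^bsup>1/2\<^esup>\<close> for \<open>m \<le> N < j\<close>, the sum of the inverse distances
  from a point to the eigenvalues on the other side of the circle is at most \<open>gap N\<close>, which tends to zero.\<close>

definition gap :: "nat \<Rightarrow> real" where "gap N = gap_const / sqrt (real N)"

lemma summable_gap_const: "summable (\<lambda>i. 1 / (real (Suc i) * sqrt (real (Suc i))))"
proof -
  have "summable (\<lambda>n. real n powr (-3/2))" by (simp add: summable_real_powr_iff)
  then have "summable (\<lambda>n. real (Suc n) powr (-3/2))" by (subst summable_Suc_iff)
  moreover have "real (Suc n) powr (-3/2) = 1 / (real (Suc n) * sqrt (real (Suc n)))" for n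
  proof -
    have "real (Suc n) powr (-3/2) = 1 / real (Suc n) powr (1 + 1/2)" by (simp add: powr_minus_divide[symmetric])
    then show ?thesis by (simp only: powr_add powr_one powr_half_sqrt of_nat_0_le_iff)
  qed
  ultimately show ?thesis by simp
qed

lemma gap_nonneg: "0 \<le> gap N"
  unfolding gap_def gap_const_def by (intro divide_nonneg_nonneg suminf_nonneg summable_gap_const) auto

lemma pi_sq_ge: "9 \<le> pi\<^sup>2"
  using power_mono[of 3 pi 2] pi_gt3 by simp

lemma ev_tail:
  assumes "1 \<le> N"
  shows "real (Suc i) * sqrt (real (Suc i)) * sqrt (real N) \<le> ev (i + Suc N) - radius N"
proof -
  have "sqrt (real (Suc i) * real N) \<le> (real (Suc i) + real N) / 2" by (rule arith_geo_mean_sqrt) auto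
  also have "\<dots> \<le> real i + 2 * real N + 3/2" by simp
  finally have 1: "sqrt (real (Suc i)) * sqrt (real N) \<le> real i + 2 * real N + 3/2" by (simp add: real_sqrt_mult)
  have "real (Suc i) \<le> pi\<^sup>2 * (real i + 1/2)"
    using mult_right_mono[OF pi_sq_ge, of "real i + 1/2"] by simp
  then have "real (Suc i) * (sqrt (real (Suc i)) * sqrt (real N)) \<le> pi\<^sup>2 * (real i + 1/2) * (real i + 2 * real N + 3/2)"
    using 1 by (intro mult_mono) auto
  also have "\<dots> = ev (i + Suc N) - radius N"
    by (simp add: ev_def radius_def power2_eq_square algebra_simps)
  finally show ?thesis by (simp add: mult.assoc)
qed

lemma ev_head:
  assumes "1 \<le> N" "i \<le> N"
  shows "real (Suc i) * sqrt (real (Suc i)) * sqrt (real N) \<le> radius N - ev (N - i)"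
proof -
  have "sqrt (real (Suc i) * real N) \<le> real N + 1/2"
  proof (rule real_le_lsqrt)
    have "real i * real N \<le> real N * real N" using assms by (intro mult_right_mono) auto
    then show "real (Suc i) * real N \<le> (real N + 1/2)\<^sup>2" by (simp add: power2_eq_square algebra_simps)
  qed auto
  then have 1: "sqrt (real (Suc i)) * sqrt (real N) \<le> 2 * real N + 1/2 - real i" using assms by (simp add: real_sqrt_mult)
  have "real (Suc i) \<le> pi\<^sup>2 * (real i + 1/2)"
    using mult_right_mono[OF pi_sq_ge, of "real i + 1/2"] by simp
  then have "real (Suc i) * (sqrt (real (Suc i)) * sqrt (real N)) \<le> pi\<^sup>2 * (real i + 1/2) * (2 * real N + 1/2 - real i)"
    using 1 by (intro mult_mono) auto
  also have "\<dots> = radius N - ev (N - i)"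
    using assms by (simp add: ev_def radius_def power2_eq_square algebra_simps of_nat_diff)
  finally show ?thesis by (simp add: mult.assoc)
qed

lemma inverse_gap_le:
  assumes "1 \<le> N" "real (Suc i) * sqrt (real (Suc i)) * sqrt (real N) \<le> d"
  shows "1 / d \<le> 1 / (real (Suc i) * sqrt (real (Suc i))) * (1 / sqrt (real N))" and "0 < d"
proof -
  have p: "0 < real (Suc i) * sqrt (real (Suc i)) * sqrt (real N)" using assms by (simp del: of_nat_Suc)
  then show "0 < d" using assms(2) by linarith
  have "1 / d \<le> 1 / (real (Suc i) * sqrt (real (Suc i)) * sqrt (real N))"
    by (rule divide_left_mono[OF assms(2)]) (use p \<open>0 < d\<close> in auto)
  then show "1 / d \<le> 1 / (real (Suc i) * sqrt (real (Suc i))) * (1 / sqrt (real N))" by simp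
qed

lemma sum_gaps_below:
  assumes "1 \<le> N" "radius N \<le> r"
  shows "(\<Sum>m\<le>N. 1 / (r - ev m)) \<le> gap N" and "\<And>m. m \<le> N \<Longrightarrow> ev m < r"
proof -
  have d: "real (Suc i) * sqrt (real (Suc i)) * sqrt (real N) \<le> r - ev (N - i)" if "i \<le> N" for i
    using ev_head[OF assms(1) that] assms(2) by linarith
  show "ev m < r" if "m \<le> N" for m
    using inverse_gap_le(2)[OF assms(1) d[of "N - m"]] that by simp
  have "(\<Sum>m\<le>N. 1 / (r - ev m)) = (\<Sum>m<Suc N. 1 / (r - ev m))" by (simp add: lessThan_Suc_atMost)
  also have "\<dots> = (\<Sum>i<Suc N. 1 / (r - ev (Suc N - Suc i)))"
    by (rule sum.nat_diff_reindex[symmetric])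
  also have "\<dots> \<le> (\<Sum>i<Suc N. 1 / (real (Suc i) * sqrt (real (Suc i))) * (1 / sqrt (real N)))"
    by (intro sum_mono, simp only: diff_Suc_Suc, intro inverse_gap_le(1)[OF assms(1) d]) auto
  also have "\<dots> = (\<Sum>i<Suc N. 1 / (real (Suc i) * sqrt (real (Suc i)))) * (1 / sqrt (real N))"
    by (rule sum_distrib_right[symmetric])
  also have "\<dots> \<le> gap_const * (1 / sqrt (real N))"
    unfolding gap_const_def by (intro mult_right_mono sum_le_suminf summable_gap_const) auto
  finally show "(\<Sum>m\<le>N. 1 / (r - ev m)) \<le> gap N" by (simp add: gap_def)
qed

lemma sum_gaps_above:
  fixes c :: "nat \<Rightarrow> complex"
  assumes "1 \<le> N" "r \<le> radius N" "0 \<le> C"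
    and c: "\<And>j. N < j \<Longrightarrow> norm (c j) \<le> C / (ev j - r)"
  shows "summable (\<lambda>j. norm (c j))" and "(\<Sum>j. norm (c j)) \<le> (\<Sum>m\<le>N. norm (c m)) + C * gap N"
proof -
  have d: "real (Suc i) * sqrt (real (Suc i)) * sqrt (real N) \<le> ev (i + Suc N) - r" for i
    using ev_tail[OF assms(1)] assms(2) by (smt (verit))
  have le: "norm (c (i + Suc N)) \<le> (C / sqrt (real N)) * (1 / (real (Suc i) * sqrt (real (Suc i))))" for i
  proof -
    have "norm (c (i + Suc N)) \<le> C * (1 / (ev (i + Suc N) - r))" using c[of "i + Suc N"] by simp
    also have "\<dots> \<le> C * (1 / (real (Suc i) * sqrt (real (Suc i))) * (1 / sqrt (real N)))"
      by (intro mult_left_mono inverse_gap_le(1)[OF assms(1) d] assms(3))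
    finally show ?thesis by (simp add: mult_ac)
  qed
  have s: "summable (\<lambda>i. (C / sqrt (real N)) * (1 / (real (Suc i) * sqrt (real (Suc i)))))"
    by (rule summable_mult[OF summable_gap_const])
  have t: "summable (\<lambda>i. norm (c (i + Suc N)))"
    by (rule summable_comparison_test'[OF s, of 0]) (use le in auto)
  then show sm: "summable (\<lambda>j. norm (c j))" using summable_iff_shift[of "\<lambda>j. norm (c j)" "Suc N"] by blast
  have "(\<Sum>j. norm (c j)) = (\<Sum>i. norm (c (i + Suc N))) + (\<Sum>i<Suc N. norm (c i))"
    by (rule suminf_split_initial_segment[OF sm])
  also have "(\<Sum>i. norm (c (i + Suc N))) \<le> (\<Sum>i. (C / sqrt (real N)) * (1 / (real (Suc i) * sqrt (real (Suc i)))))"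
    by (rule suminf_le[OF le t s])
  also have "\<dots> = C * gap N" unfolding gap_def gap_const_def by (subst suminf_mult[OF summable_gap_const]) simp
  finally show "(\<Sum>j. norm (c j)) \<le> (\<Sum>m\<le>N. norm (c m)) + C * gap N" by (simp add: lessThan_Suc_atMost)
qed

lemma ev_less_radius: "k \<le> N \<Longrightarrow> ev k < radius N" and radius_less_ev: "N < j \<Longrightarrow> radius N < ev j"
  unfolding ev_def radius_def by (auto intro!: power_strict_mono)

lemma ev_nonneg: "0 \<le> ev k" by (simp add: ev_def)

section \<open>A contraction principle\<close>

text \<open>Banach's fixed point theorem in the ball of radius \<open>K\<close> of the bounded families with the supremum norm.\<close>

lemma bounded_contraction_fixpoint:
  fixes F :: "('i \<Rightarrow> complex) \<Rightarrow> 'i \<Rightarrow> complex"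
  assumes self: "\<And>d i. (\<And>i. norm (d i) \<le> K) \<Longrightarrow> norm (F d i) \<le> K"
    and contr: "\<And>d d' \<Delta> i. (\<And>i. norm (d i) \<le> K) \<Longrightarrow> (\<And>i. norm (d' i) \<le> K) \<Longrightarrow>
      (\<And>i. norm (d i - d' i) \<le> \<Delta>) \<Longrightarrow> norm (F d i - F d' i) \<le> \<Delta> / 2"
    and K: "0 \<le> K"
  shows "\<exists>d. (\<forall>i. norm (d i) \<le> K) \<and> F d = d"
proof -
  define X where "X n = (F ^^ n) (\<lambda>_. 0)" for n
  have XS: "X (Suc n) = F (X n)" for n by (simp add: X_def)
  have Xb: "norm (X n i) \<le> K" for n i
    by (induction n arbitrary: i) (use self K in \<open>auto simp: XS, simp add: X_def\<close>)
  have step: "norm (X (Suc n) i - X n i) \<le> K * (1/2) ^ n" for n i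
  proof (induction n arbitrary: i)
    case 0
    then show ?case using Xb[of "Suc 0" i] by (simp add: X_def)
  next
    case (Suc n)
    have "norm (F (X (Suc n)) i - F (X n) i) \<le> K * (1/2) ^ n / 2" by (rule contr[OF Xb Xb Suc.IH])
    then show ?case by (simp add: XS)
  qed
  have sg: "summable (\<lambda>n. K * (1/2::real) ^ (n + m))" for m
    by (intro summable_mult) (simp add: power_add summable_mult2)
  have ss: "summable (\<lambda>n. X (Suc (n + m)) i - X (n + m) i)" for m i
    by (rule summable_norm_cancel, rule summable_comparison_test'[OF sg[of m], of 0]) (use step in auto)
  define d where "d i = (\<Sum>n. X (Suc n) i - X n i)" for i
  have conv: "norm (d i - X m i) \<le> 2 * K * (1/2) ^ m" for i m
  proof -
    have "(\<Sum>n<m. X (Suc n) i - X n i) = X m i" using sum_lessThan_telescope[of "\<lambda>n. X n i" m] by (simp add: X_def)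
    then have "d i - X m i = (\<Sum>n. X (Suc (n + m)) i - X (n + m) i)"
      using suminf_split_initial_segment[of "\<lambda>n. X (Suc n) i - X n i" m] ss[of 0 i] unfolding d_def by simp
    also have "norm \<dots> \<le> (\<Sum>n. K * (1/2) ^ (n + m))"
    proof (rule order_trans[OF summable_norm suminf_le])
      show s: "summable (\<lambda>n. norm (X (Suc (n + m)) i - X (n + m) i))"
        by (rule summable_comparison_test'[OF sg[of m], of 0]) (use step in auto)
      then show "summable (\<lambda>n. norm (X (Suc (n + m)) i - X (n + m) i))" .
    qed (use sg step in auto)
    also have "\<dots> = (\<Sum>n. (K * (1/2) ^ m) * (1/2) ^ n)" by (simp add: power_add mult_ac)
    also have "\<dots> = 2 * K * (1/2) ^ m" by (subst suminf_mult) (auto simp: suminf_geometric)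
    finally show ?thesis .
  qed
  have lim0: "(\<lambda>m. C * (1/2::real) ^ m) \<longlonglongrightarrow> 0" for C
    by (rule tendsto_mult_right_zero) (simp add: LIMSEQ_power_zero)
  have lim: "(\<lambda>m. X m i) \<longlonglongrightarrow> d i" for i
  proof (rule LIM_zero_cancel, rule Lim_null_comparison[OF _ lim0[of "2 * K"]])
    show "\<forall>\<^sub>F m in sequentially. norm (X m i - d i) \<le> 2 * K * (1/2) ^ m"
      using conv by (simp add: norm_minus_commute)
  qed
  have db: "norm (d i) \<le> K" for i
    by (rule tendsto_upperbound[OF tendsto_norm[OF lim[of i]]]) (use Xb in auto)
  have "F d i = d i" for i
  proof -
    have "norm (F d i - d i) \<le> 2 * K * (1/2) ^ m" for m
    proof -
      have "norm (F d i - F (X m) i) \<le> 2 * K * (1/2) ^ m / 2" by (rule contr[OF db Xb conv])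
      moreover have "norm (d i - X (Suc m) i) \<le> 2 * K * (1/2) ^ Suc m" by (rule conv)
      moreover have "F d i - d i = (F d i - F (X m) i) - (d i - X (Suc m) i)" by (simp add: XS)
      ultimately show ?thesis using norm_triangle_ineq4[of "F d i - F (X m) i" "d i - X (Suc m) i"] by simp
    qed
    then have "norm (F d i - d i) \<le> 0"
      by (intro tendsto_lowerbound[OF lim0[of "2 * K"]]) auto
    then show ?thesis by simp
  qed
  then show ?thesis using db by blast
qed

section \<open>The invariant subspace near the first eigenfunctions\<close>

definition synth :: "(nat \<Rightarrow> complex) \<Rightarrow> real \<Rightarrow> complex" where
  "synth c x = (if x \<in> {0..1} then \<Sum>k. c k * cosk k x else 0)"

lemma norm_synth_le: "summable (\<lambda>k. norm (c k)) \<Longrightarrow> norm (synth c x) \<le> (\<Sum>k. norm (c k))"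
  using cosine_series(2)[of c x] by (auto simp: synth_def intro!: suminf_nonneg)

lemma coef_synth: "summable (\<lambda>k. norm (c k)) \<Longrightarrow> coef k (synth c) = c k"
  using cosine_series(3)[of c k] coef_cong[of "synth c" "\<lambda>x. \<Sum>k. c k * cosk k x" k] by (simp add: synth_def)

lemma synth_diff:
  assumes "summable (\<lambda>k. norm (c k))" "summable (\<lambda>k. norm (d k))"
  shows "synth c x - synth d x = synth (\<lambda>k. c k - d k) x"
  using suminf_diff[OF cosine_series(4)[OF assms(1), of x] cosine_series(4)[OF assms(2), of x]]
  by (simp add: synth_def algebra_simps)

lemma coef_sum:
  assumes "\<And>i. i \<in> I \<Longrightarrow> (\<lambda>x. f i x * cosk k x) integrable_on {0..1}" "finite I"
  shows "coef k (\<lambda>x. \<Sum>i\<in>I. f i x) = (\<Sum>i\<in>I. coef k (f i))"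
  unfolding coef_def by (simp add: sum_distrib_right integral_sum[OF assms(2,1)] sum_distrib_left)

text \<open>The premise is applied with \<open>M\<close> the maximum of \<open>|v|\<close>.\<close>

lemma contracting_bound_imp_zero:
  fixes v :: "real \<Rightarrow> complex"
  assumes "continuous_on {0..1} v" and q: "q < 1"
    and "\<And>M. (\<And>x. x \<in> {0..1} \<Longrightarrow> norm (v x) \<le> M) \<Longrightarrow> (\<And>x. x \<in> {0..1} \<Longrightarrow> norm (v x) \<le> q * M)"
    and x: "x \<in> {0..1}"
  shows "v x = 0"
proof -
  have "continuous_on {0..1} (\<lambda>x. norm (v x))" using assms(1) by (rule continuous_on_norm)
  then obtain t where t: "t \<in> {0..1}" "\<And>s. s \<in> {0..1} \<Longrightarrow> norm (v s) \<le> norm (v t)"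
    using continuous_attains_sup[of "{0..1::real}" "\<lambda>x. norm (v x)"] by auto
  have "norm (v t) \<le> q * norm (v t)" using assms(3)[of "norm (v t)", OF t(2) t(1)] by blast
  then have "(1 - q) * norm (v t) \<le> 0" by (simp add: algebra_simps)
  then have "norm (v t) \<le> 0" using q by (simp add: mult_le_0_iff)
  then show ?thesis using t(2)[OF x] by simp
qed

context delay_coefficients
begin

lemma synth_X: "summable (\<lambda>k. norm (c k)) \<Longrightarrow> synth c \<in> X"
  unfolding X_def using continuous_on_eq[OF cosine_series(1)[of c "{0..1}"], of "synth c"]
  by (auto simp: synth_def)

lemma X_cont: "y \<in> X \<Longrightarrow> continuous_on {0..1} y" by (simp add: X_def)

lemma X_eqI:
  assumes "y \<in> X" "z \<in> X" "\<And>k. coef k y = coef k z"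
  shows "y = z"
proof
  fix x
  have "coef k (\<lambda>x. y x - z x) = 0" for k
    using coef_diff[OF X_integrable[OF assms(1)] X_integrable[OF assms(2)]] assms(3) by simp
  then have "y x - z x = 0" if "x \<in> {0..1}"
    using cosine_system_complete[of "\<lambda>x. y x - z x"] that X_cont[OF assms(1)] X_cont[OF assms(2)]
    by (auto intro: continuous_on_diff)
  moreover have "y x = z x" if "x \<notin> {0..1}" using assms(1,2) that by (simp add: X_def)
  ultimately show "y x = z x" by auto
qed

lemma contracting_bound_X:
  assumes "v \<in> X" "q < 1"
    and "\<And>x M. (\<And>x. x \<in> {0..1} \<Longrightarrow> norm (v x) \<le> M) \<Longrightarrow> x \<in> {0..1} \<Longrightarrow> norm (v x) \<le> q * M"
  shows "v = (\<lambda>x. 0)"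
proof
  fix x
  show "v x = 0"
  proof (cases "x \<in> {0..1}")
    case True
    show ?thesis by (rule contracting_bound_imp_zero[OF X_cont[OF assms(1)] assms(2) assms(3) True])
  qed (use assms(1) in \<open>simp add: X_def\<close>)
qed

lemma scale_mem_X: "y \<in> X \<Longrightarrow> (\<lambda>x. \<mu> * y x) \<in> X"
  unfolding X_def by (auto intro!: continuous_intros)

lemma add_mem_X: "y \<in> X \<Longrightarrow> z \<in> X \<Longrightarrow> (\<lambda>x. y x + z x) \<in> X"
  unfolding X_def by (auto intro!: continuous_intros)

lemma norm_le_sum_coef:
  assumes "y \<in> X" "summable (\<lambda>k. norm (coef k y))"
  shows "norm (y x) \<le> (\<Sum>k. norm (coef k y))"
proof -
  have "y = synth (\<lambda>k. coef k y)"
    by (rule X_eqI[OF assms(1) synth_X[OF assms(2)]]) (simp add: coef_synth[OF assms(2)])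
  then show ?thesis using norm_synth_le[OF assms(2), of x] by simp
qed

lemma B_integrable: "y \<in> X \<Longrightarrow> (\<lambda>x. B y x * cosk k x) integrable_on {0..1}"
  by (intro B_mult_integrable X_cont continuous_intros)

lemma norm_coef_B_le:
  assumes "y \<in> X" "\<And>x. x \<in> {0..1} \<Longrightarrow> norm (y x) \<le> M"
  shows "norm (coef k (B y)) \<le> 2 * (b * M)"
  by (rule norm_coef_le[OF B_integrable[OF assms(1)]]) (rule B_bound[OF assms(2)])

lemma X_lincomb:
  assumes "\<And>i. i \<in> I \<Longrightarrow> f i \<in> X" "finite I"
  shows "(\<lambda>x. \<Sum>i\<in>I. p i * f i x) \<in> X"
  using assms unfolding X_def by (auto intro!: continuous_intros sum.neutral)

lemma coef_lincomb:
  assumes "\<And>i. i \<in> I \<Longrightarrow> f i \<in> X" "finite I"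
  shows "coef k (\<lambda>x. \<Sum>i\<in>I. p i * f i x) = (\<Sum>i\<in>I. p i * coef k (f i))"
proof -
  have "(\<lambda>x. p i * f i x * cosk k x) integrable_on {0..1}" if "i \<in> I" for i
    using integrable_on_mult_right[OF X_integrable[OF assms(1)[OF that]], of "p i" k] by (simp add: mult.assoc)
  then show ?thesis using assms(2) by (simp add: coef_sum coef_cmult)
qed

lemma coef_B_lincomb:
  assumes "\<And>i. i \<in> I \<Longrightarrow> f i \<in> X" "finite I"
  shows "coef k (B (\<lambda>x. \<Sum>i\<in>I. p i * f i x)) = (\<Sum>i\<in>I. p i * coef k (B (f i)))"
proof -
  have "B (\<lambda>x. \<Sum>i\<in>I. p i * f i x) = (\<lambda>x. \<Sum>i\<in>I. p i * B (f i) x)"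
    by (simp add: fun_eq_iff B_sum B_cmult)
  moreover have "(\<lambda>x. p i * B (f i) x * cosk k x) integrable_on {0..1}" if "i \<in> I" for i
    using integrable_on_mult_right[OF B_integrable[OF assms(1)[OF that]], of "p i" k] by (simp add: mult.assoc)
  ultimately show ?thesis using assms(2) by (simp add: coef_sum coef_cmult)
qed

lemma H_op_iff:
  assumes "w \<in> X"
  shows "H_op V Q \<alpha> \<beta> y w \<longleftrightarrow> y \<in> X \<and> (\<forall>k. coef k w = of_real (ev k) * coef k y + coef k (B y))"
  unfolding H_op_iff_coefficients[OF X_cont[OF assms]] ev_def ..

lemma H_op_X: "H_op V Q \<alpha> \<beta> y w \<Longrightarrow> y \<in> X"
  unfolding H_op_def using W22_imp_X by blast

lemma eigenfunction_coef:
  assumes "H_op V Q \<alpha> \<beta> y (\<lambda>x. \<mu> * y x)"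
  shows "(\<mu> - of_real (ev m)) * coef m y = coef m (B y)"
  using assms unfolding H_op_iff[OF scale_mem_X[OF H_op_X[OF assms]]] by (simp add: coef_cmult algebra_simps)

lemma H_op_unique:
  assumes "H_op V Q \<alpha> \<beta> y w" "H_op V Q \<alpha> \<beta> y w'" "w \<in> X" "w' \<in> X"
  shows "w = w'"
  by (rule X_eqI[OF assms(3,4)]) (use assms in \<open>simp add: H_op_iff\<close>)

lemma H_op_lincomb:
  assumes "\<And>i. i \<in> I \<Longrightarrow> H_op V Q \<alpha> \<beta> (f i) (h i)" "\<And>i. i \<in> I \<Longrightarrow> h i \<in> X" "finite I"
  shows "H_op V Q \<alpha> \<beta> (\<lambda>x. \<Sum>i\<in>I. p i * f i x) (\<lambda>x. \<Sum>i\<in>I. p i * h i x)"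
proof -
  have f: "f i \<in> X" if "i \<in> I" for i using H_op_X[OF assms(1)[OF that]] .
  have "coef k (h i) = of_real (ev k) * coef k (f i) + coef k (B (f i))" if "i \<in> I" for i k
    using assms(1,2)[OF that] H_op_iff by blast
  then show ?thesis
    using f assms(2,3)
    by (subst H_op_iff) (auto intro!: X_lincomb simp: coef_lincomb coef_B_lincomb sum_distrib_left sum.distrib[symmetric] algebra_simps)
qed

end

text \<open>For such \<open>N\<close> the perturbation is small against the gap between \<open>ev N\<close> and \<open>ev (N + 1)\<close>, and the
  span of the first \<open>N + 1\<close> cosines can be deformed into an invariant subspace of the perturbed operator. With
  the constant \<open>32\<close> the map \<open>riccati\<close> below sends the ball of radius \<open>4 b\<close> into itself and halves distances there.\<close>

locale delay_coefficients_gap = delay_coefficients +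
  fixes N :: nat
  assumes N: "1 \<le> N" and small: "32 * b * gap N \<le> 1"
begin

text \<open>The candidate basis vector \<open>g\<^sub>k\<close> is \<open>cos \<pi>kx\<close> plus higher modes. The unknown coefficients are divided by
  the spectral distance; then every bounded family \<open>d\<close> gives an absolutely convergent series, and all
  estimates can be made in the supremum norm.\<close>

definition gcoef :: "(nat \<times> nat \<Rightarrow> complex) \<Rightarrow> nat \<Rightarrow> nat \<Rightarrow> complex" where
  "gcoef d k j = (if j \<le> N then (if j = k then 1 else 0) else d (j, k) / of_real (ev j - ev k))"

lemma b_gap: "b * gap N \<le> 1/32" "gap N \<le> 1/32"
proof -
  show "b * gap N \<le> 1/32" using small by simp
  then show "gap N \<le> 1/32" using mult_right_mono[OF b1 gap_nonneg[of N]] by linarith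
qed

lemma gcoef_tail:
  assumes "\<And>i. norm (d i) \<le> D" "k \<le> N" "N < j"
  shows "norm (gcoef d k j) \<le> D / (ev j - ev k)"
proof -
  have "ev k < ev j" using ev_less_radius[OF assms(2)] radius_less_ev[OF assms(3)] by simp
  then have "norm (complex_of_real (ev j - ev k)) = ev j - ev k" unfolding norm_of_real by simp
  then show ?thesis using assms \<open>ev k < ev j\<close>
    by (simp add: gcoef_def norm_divide divide_right_mono del: of_real_diff)
qed

lemma gcoef_sum:
  assumes d: "\<And>i. norm (d i) \<le> D" and k: "k \<le> N"
  shows "summable (\<lambda>j. norm (gcoef d k j))" "(\<Sum>j. norm (gcoef d k j)) \<le> 1 + D * gap N"
proof -
  have D: "0 \<le> D" using order_trans[OF norm_ge_zero d] .
  note s = sum_gaps_above[OF N less_imp_le[OF ev_less_radius[OF k]] D gcoef_tail[where d = d, OF d k]]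
  show "summable (\<lambda>j. norm (gcoef d k j))" by (rule s(1))
  have "(\<Sum>m\<le>N. norm (gcoef d k m)) = (\<Sum>m\<le>N. if m = k then 1 else 0)"
    by (rule sum.cong) (auto simp: gcoef_def)
  then show "(\<Sum>j. norm (gcoef d k j)) \<le> 1 + D * gap N" using s(2) k by simp
qed

definition gfun :: "(nat \<times> nat \<Rightarrow> complex) \<Rightarrow> nat \<Rightarrow> real \<Rightarrow> complex" where
  "gfun d k = synth (gcoef d k)"

definition bcoef :: "(nat \<times> nat \<Rightarrow> complex) \<Rightarrow> nat \<Rightarrow> nat \<Rightarrow> complex" where
  "bcoef d m k = coef m (B (gfun d k))"

text \<open>Invariance means \<open>H g\<^sub>k = \<Sum>\<^sub>m t\<^sub>m\<^sub>k g\<^sub>m\<close>. Comparing the coefficients of order \<open>m \<le> N\<close> forces \<open>t\<^sub>m\<^sub>k\<close> to be the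
  matrix entry of \<open>bcoef\<close>, increased by \<open>ev k\<close> on the diagonal; those of order \<open>j > N\<close> then say that \<open>d\<close>
  is a fixed point of the following quadratic map.\<close>

definition riccati :: "(nat \<times> nat \<Rightarrow> complex) \<Rightarrow> nat \<times> nat \<Rightarrow> complex" where
  "riccati d = (\<lambda>(j, k). if N < j \<and> k \<le> N
     then - bcoef d j k + (\<Sum>m\<le>N. bcoef d m k * (d (j, m) / of_real (ev j - ev m))) else 0)"

lemma gfun_bound:
  assumes "\<And>i. norm (d i) \<le> 4 * b" "k \<le> N"
  shows "gfun d k \<in> X" "norm (gfun d k x) \<le> 9/8" "coef j (gfun d k) = gcoef d k j"
proof -
  note s = gcoef_sum[where d = d, OF assms]
  show "gfun d k \<in> X" unfolding gfun_def by (rule synth_X[OF s(1)])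
  show "coef j (gfun d k) = gcoef d k j" unfolding gfun_def by (rule coef_synth[OF s(1)])
  have "1 + 4 * b * gap N \<le> 9/8" using b_gap(1) by simp
  then show "norm (gfun d k x) \<le> 9/8"
    unfolding gfun_def using norm_synth_le[OF s(1), of x] s(2) by simp
qed

lemma bcoef_bound:
  assumes "\<And>i. norm (d i) \<le> 4 * b" "k \<le> N"
  shows "norm (bcoef d m k) \<le> 9/4 * b"
  using norm_coef_B_le[OF gfun_bound(1)[where d = d, OF assms] gfun_bound(2)[where d = d, OF assms], of m] by (simp add: bcoef_def)

lemma bcoef_diff:
  assumes d: "\<And>i. norm (d i) \<le> 4 * b" "\<And>i. norm (d' i) \<le> 4 * b" and k: "k \<le> N"
    and \<Delta>: "\<And>i. norm (d i - d' i) \<le> \<Delta>"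
  shows "norm (bcoef d m k - bcoef d' m k) \<le> \<Delta> / 16"
proof -
  have \<Delta>0: "0 \<le> \<Delta>" using order_trans[OF norm_ge_zero \<Delta>] .
  note s = gcoef_sum(1)[where d = d, OF d(1) k] gcoef_sum(1)[where d = d', OF d(2) k]
  define e where "e j = gcoef d k j - gcoef d' k j" for j
  have tail: "norm (e j) \<le> \<Delta> / (ev j - ev k)" if "N < j" for j
  proof -
    have "ev k < ev j" using ev_less_radius[OF k] radius_less_ev[OF that] by simp
    then show ?thesis using that \<Delta>[of "(j, k)"]
      by (simp add: e_def gcoef_def diff_divide_distrib[symmetric] norm_divide divide_right_mono del: of_real_diff)
  qed
  have t: "summable (\<lambda>j. norm (e j))" "(\<Sum>j. norm (e j)) \<le> (\<Sum>m\<le>N. norm (e m)) + \<Delta> * gap N"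
    using sum_gaps_above[OF N less_imp_le[OF ev_less_radius[OF k]] \<Delta>0, of e] tail by blast+
  have "(\<Sum>m\<le>N. norm (e m)) = 0" by (rule sum.neutral) (simp add: e_def gcoef_def)
  then have e: "(\<Sum>j. norm (e j)) \<le> \<Delta> * gap N" using t(2) by simp
  have eq: "(\<lambda>x. gfun d k x - gfun d' k x) = synth e"
    unfolding gfun_def e_def by (rule ext) (rule synth_diff[OF s])
  have gX: "gfun d k \<in> X" "gfun d' k \<in> X" using gfun_bound(1) d k by blast+
  have "bcoef d m k - bcoef d' m k = coef m (\<lambda>x. B (gfun d k) x - B (gfun d' k) x)"
    unfolding bcoef_def by (rule coef_diff[symmetric]) (use gX in \<open>auto intro: B_integrable\<close>)
  also have "(\<lambda>x. B (gfun d k) x - B (gfun d' k) x) = B (synth e)"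
    unfolding eq[symmetric] by (simp add: B_diff fun_eq_iff)
  also have "norm (coef m (B (synth e))) \<le> 2 * (b * (\<Delta> * gap N))"
    by (rule norm_coef_B_le[OF synth_X[OF t(1)]]) (rule order_trans[OF norm_synth_le[OF t(1)] e])
  also have "\<dots> = 2 * \<Delta> * (b * gap N)" by simp
  also have "\<dots> \<le> 2 * \<Delta> * (1/32)" using \<Delta>0 b_gap(1) by (intro mult_left_mono) auto
  finally show ?thesis by simp
qed

lemma ev_gap_sum: "N < j \<Longrightarrow> (\<Sum>m\<le>N. 1 / (ev j - ev m)) \<le> gap N"
  using sum_gaps_below(1)[OF N less_imp_le[OF radius_less_ev]] .

lemma ev_gap_pos: "N < j \<Longrightarrow> m \<le> N \<Longrightarrow> 0 < ev j - ev m"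
  using ev_less_radius[of m N] radius_less_ev[of N j] by simp

lemma norm_gap_sum_le:
  fixes c :: "nat \<Rightarrow> complex"
  assumes "N < j" "\<And>m. m \<le> N \<Longrightarrow> norm (c m) \<le> C"
  shows "norm (\<Sum>m\<le>N. c m / of_real (ev j - ev m)) \<le> C * gap N"
proof -
  have C: "0 \<le> C" using order_trans[OF norm_ge_zero assms(2)[of 0]] by simp
  have "norm (\<Sum>m\<le>N. c m / of_real (ev j - ev m)) \<le> (\<Sum>m\<le>N. C * (1 / (ev j - ev m)))"
  proof (rule order_trans[OF norm_sum sum_mono])
    fix m assume "m \<in> {..N}"
    then show "norm (c m / of_real (ev j - ev m)) \<le> C * (1 / (ev j - ev m))"
      using ev_gap_pos[OF assms(1), of m] assms(2)[of m]
      by (simp add: norm_divide divide_right_mono del: of_real_diff)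
  qed
  also have "\<dots> = C * (\<Sum>m\<le>N. 1 / (ev j - ev m))" by (rule sum_distrib_left[symmetric])
  also have "\<dots> \<le> C * gap N" by (intro mult_left_mono ev_gap_sum assms C)
  finally show ?thesis .
qed

lemma riccati_self:
  assumes d: "\<And>i. norm (d i) \<le> 4 * b"
  shows "norm (riccati d i) \<le> 4 * b"
proof -
  obtain j k where i: "i = (j, k)" by (cases i)
  show ?thesis
  proof (cases "N < j \<and> k \<le> N")
    case True
    have p: "norm (bcoef d m k * d (j, m)) \<le> 9/4 * b * (4 * b)" for m
      unfolding norm_mult using bcoef_bound[where d = d, OF d, of k m] d[of "(j, m)"] True b1 by (intro mult_mono) auto
    have "norm (\<Sum>m\<le>N. bcoef d m k * d (j, m) / of_real (ev j - ev m)) \<le> 9/4 * b * (4 * b) * gap N"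
      by (rule norm_gap_sum_le) (use True p in auto)
    also have "\<dots> = 9 * b * (b * gap N)" by simp
    also have "\<dots> \<le> 9 * b * (1/32)" using b_gap(1) b1 by (intro mult_left_mono) auto
    finally have s: "norm (\<Sum>m\<le>N. bcoef d m k * d (j, m) / of_real (ev j - ev m)) \<le> 9 * b * (1/32)" .
    have "riccati d i = - bcoef d j k + (\<Sum>m\<le>N. bcoef d m k * d (j, m) / of_real (ev j - ev m))"
      using True by (simp add: i riccati_def)
    then have "norm (riccati d i) \<le> 9/4 * b + 9 * b * (1/32)"
      using bcoef_bound[where d = d, OF d, of k j] s True norm_triangle_ineq[of "- bcoef d j k" "\<Sum>m\<le>N. bcoef d m k * d (j, m) / of_real (ev j - ev m)"]
      by simp
    then show ?thesis using b1 by simp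
  qed (use b1 in \<open>auto simp: i riccati_def\<close>)
qed

lemma riccati_contraction:
  assumes d: "\<And>i. norm (d i) \<le> 4 * b" "\<And>i. norm (d' i) \<le> 4 * b" and \<Delta>: "\<And>i. norm (d i - d' i) \<le> \<Delta>"
  shows "norm (riccati d i - riccati d' i) \<le> \<Delta> / 2"
proof -
  have \<Delta>0: "0 \<le> \<Delta>" using order_trans[OF norm_ge_zero \<Delta>] .
  obtain j k where i: "i = (j, k)" by (cases i)
  show ?thesis
  proof (cases "N < j \<and> k \<le> N")
    case True
    then have k: "k \<le> N" by simp
    have p: "norm (bcoef d m k * d (j, m) - bcoef d' m k * d' (j, m)) \<le> 5/2 * b * \<Delta>" for m
    proof -
      have "bcoef d m k * d (j, m) - bcoef d' m k * d' (j, m)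
          = (bcoef d m k - bcoef d' m k) * d (j, m) + bcoef d' m k * (d (j, m) - d' (j, m))" by (simp add: algebra_simps)
      also have "norm \<dots> \<le> \<Delta> / 16 * (4 * b) + 9/4 * b * \<Delta>"
      proof (rule order_trans[OF norm_triangle_ineq add_mono])
        show "norm ((bcoef d m k - bcoef d' m k) * d (j, m)) \<le> \<Delta> / 16 * (4 * b)"
          unfolding norm_mult by (rule mult_mono[OF bcoef_diff[where d = d and d' = d', OF d k \<Delta>] d(1)]) (use \<Delta>0 in auto)
        show "norm (bcoef d' m k * (d (j, m) - d' (j, m))) \<le> 9/4 * b * \<Delta>"
          unfolding norm_mult by (rule mult_mono[OF bcoef_bound[where d = d', OF d(2) k] \<Delta>]) (use b1 in auto)
      qed
      finally show ?thesis by (simp add: mult.commute[of \<Delta> b])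
    qed
    have eq: "riccati d i - riccati d' i = - (bcoef d j k - bcoef d' j k) +
        (\<Sum>m\<le>N. (bcoef d m k * d (j, m) - bcoef d' m k * d' (j, m)) / of_real (ev j - ev m))"
      using True by (simp add: i riccati_def diff_divide_distrib sum_subtractf)
    have "norm (\<Sum>m\<le>N. (bcoef d m k * d (j, m) - bcoef d' m k * d' (j, m)) / of_real (ev j - ev m)) \<le> 5/2 * b * \<Delta> * gap N"
      by (rule norm_gap_sum_le) (use True p in auto)
    also have "\<dots> = 5/2 * \<Delta> * (b * gap N)" by simp
    also have "\<dots> \<le> 5/2 * \<Delta> * (1/32)" using b_gap(1) \<Delta>0 by (intro mult_left_mono) auto
    finally have "norm (riccati d i - riccati d' i) \<le> \<Delta> / 16 + 5/2 * \<Delta> * (1/32)"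
      unfolding eq using bcoef_diff[where d = d and d' = d', OF d k \<Delta>, of j]
      by (intro order_trans[OF norm_triangle_ineq] add_mono) (simp_all add: norm_minus_commute)
    then show ?thesis using \<Delta>0 by simp
  qed (use \<Delta>0 in \<open>auto simp: i riccati_def\<close>)
qed

definition \<delta> :: "nat \<times> nat \<Rightarrow> complex" where
  "\<delta> = (SOME d. (\<forall>i. norm (d i) \<le> 4 * b) \<and> riccati d = d)"

lemma \<delta>: "norm (\<delta> i) \<le> 4 * b" "riccati \<delta> = \<delta>"
proof -
  have "\<exists>d. (\<forall>i. norm (d i) \<le> 4 * b) \<and> riccati d = d"
    by (rule bounded_contraction_fixpoint[OF riccati_self riccati_contraction]) (use b1 in auto)
  then have "(\<forall>i. norm (\<delta> i) \<le> 4 * b) \<and> riccati \<delta> = \<delta>"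
    unfolding \<delta>_def by (rule someI_ex)
  then show "norm (\<delta> i) \<le> 4 * b" "riccati \<delta> = \<delta>" by blast+
qed

abbreviation g where "g k \<equiv> gfun \<delta> k"

lemmas g_X = gfun_bound(1)[of \<delta>, OF \<delta>(1)] and g_bound = gfun_bound(2)[of \<delta>, OF \<delta>(1)]
  and coef_g = gfun_bound(3)[of \<delta>, OF \<delta>(1)]

definition w :: "nat \<Rightarrow> real \<Rightarrow> complex" where
  "w k x = (\<Sum>m\<le>N. ((if m = k then of_real (ev k) else 0) + bcoef \<delta> m k) * g m x)"

lemma w_X: "w k \<in> X"
  unfolding w_def[abs_def] by (rule X_lincomb) (auto intro: g_X)

lemma H_g:
  assumes k: "k \<le> N"
  shows "H_op V Q \<alpha> \<beta> (g k) (w k)"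
proof (subst H_op_iff[OF w_X], intro conjI allI)
  show "g k \<in> X" by (rule g_X[OF k])
  fix j
  have cw: "coef j (w k) = (\<Sum>m\<le>N. ((if m = k then of_real (ev k) else 0) + bcoef \<delta> m k) * gcoef \<delta> m j)"
    unfolding w_def[abs_def] by (subst coef_lincomb) (auto intro!: g_X sum.cong simp: coef_g)
  show "coef j (w k) = of_real (ev j) * coef j (g k) + coef j (B (g k))"
  proof (cases "j \<le> N")
    case True
    have "coef j (w k) = (\<Sum>m\<le>N. if m = j then ((if m = k then of_real (ev k) else 0) + bcoef \<delta> m k) else 0)"
      unfolding cw by (rule sum.cong) (use True in \<open>auto simp: gcoef_def\<close>)
    also have "\<dots> = (if j = k then of_real (ev k) else 0) + bcoef \<delta> j k" using True by simp
    finally show ?thesis using True by (simp add: coef_g[OF k] gcoef_def bcoef_def)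
  next
    case False
    then have j: "N < j" by simp
    have "coef j (w k) = (\<Sum>m\<le>N. (if m = k then of_real (ev k) * gcoef \<delta> m j else 0) + bcoef \<delta> m k * gcoef \<delta> m j)"
      unfolding cw by (rule sum.cong) (auto simp: distrib_right)
    also have "\<dots> = of_real (ev k) * gcoef \<delta> k j + (\<Sum>m\<le>N. bcoef \<delta> m k * (\<delta> (j, m) / of_real (ev j - ev m)))"
      using k j by (simp add: sum.distrib gcoef_def)
    also have "(\<Sum>m\<le>N. bcoef \<delta> m k * (\<delta> (j, m) / of_real (ev j - ev m))) = \<delta> (j, k) + bcoef \<delta> j k"
    proof -
      have "riccati \<delta> (j, k) = - bcoef \<delta> j k + (\<Sum>m\<le>N. bcoef \<delta> m k * (\<delta> (j, m) / of_real (ev j - ev m)))"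
        using j k by (simp add: riccati_def)
      then have "\<delta> (j, k) = - bcoef \<delta> j k + (\<Sum>m\<le>N. bcoef \<delta> m k * (\<delta> (j, m) / of_real (ev j - ev m)))"
        by (simp only: \<delta>(2))
      then show ?thesis by (simp only:) simp
    qed
    also have "\<delta> (j, k) = of_real (ev j - ev k) * gcoef \<delta> k j"
    proof -
      have "complex_of_real (ev j - ev k) \<noteq> 0" using ev_gap_pos[OF j k] by (simp only: of_real_eq_0_iff)
      then show ?thesis using j by (simp add: gcoef_def del: of_real_diff)
    qed
    finally show ?thesis by (simp add: coef_g[OF k] bcoef_def algebra_simps)
  qed
qed

lemma coef_lincomb_g: "coef m (\<lambda>x. \<Sum>k\<le>N. p k * g k x) = (\<Sum>k\<le>N. p k * gcoef \<delta> k m)"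
  by (subst coef_lincomb) (auto intro!: g_X sum.cong simp: coef_g)

lemma coef_low_lincomb:
  assumes "m \<le> N"
  shows "coef m (\<lambda>x. \<Sum>k\<le>N. p k * g k x) = p m"
proof -
  have "(\<Sum>i\<le>N. p i * gcoef \<delta> i m) = (\<Sum>i\<le>N. if i = m then p i else 0)"
    using assms by (intro sum.cong) (auto simp: gcoef_def)
  then show ?thesis unfolding coef_lincomb_g using assms by simp
qed

text \<open>The equations of order \<open>m \<le> N\<close> determine the vector \<open>p\<close> from \<open>B v\<close>; those of higher order then bound the remaining
  coefficients of \<open>v\<close>, divided by large distances, by a small multiple of the supremum of \<open>v\<close>.\<close>

lemma high_part_zero:
  assumes v: "H_op V Q \<alpha> \<beta> v (\<lambda>x. \<mu> * v x + (\<Sum>m\<le>N. p m * g m x))"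
    and low: "\<And>m. m \<le> N \<Longrightarrow> coef m v = 0" and \<mu>: "norm \<mu> \<le> radius N"
  shows "v = (\<lambda>x. 0)"
proof -
  have vX: "v \<in> X" using H_op_X[OF v] .
  have gs: "(\<lambda>x. \<Sum>m\<le>N. p m * g m x) \<in> X" by (rule X_lincomb) (auto intro: g_X)
  have WX: "(\<lambda>x. \<mu> * v x + (\<Sum>m\<le>N. p m * g m x)) \<in> X"
    by (intro add_mem_X scale_mem_X vX gs)
  have cW: "coef j (\<lambda>x. \<mu> * v x + (\<Sum>m\<le>N. p m * g m x)) = \<mu> * coef j v + (\<Sum>m\<le>N. p m * gcoef \<delta> m j)" for j
  proof -
    have "coef j (\<lambda>x. \<mu> * v x + (\<Sum>m\<le>N. p m * g m x)) = coef j (\<lambda>x. \<mu> * v x) + coef j (\<lambda>x. \<Sum>m\<le>N. p m * g m x)"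
      using X_integrable[OF gs, of j] integrable_on_mult_right[OF X_integrable[OF vX], of \<mu> j]
      by (intro coef_add) (auto simp: mult.assoc)
    then show ?thesis by (simp add: coef_cmult coef_lincomb_g)
  qed
  have eq: "\<mu> * coef j v + (\<Sum>m\<le>N. p m * gcoef \<delta> m j) = of_real (ev j) * coef j v + coef j (B v)" for j
    using v cW unfolding H_op_iff[OF WX] by simp
  have p: "p m = coef m (B v)" if "m \<le> N" for m
  proof -
    have "(\<Sum>i\<le>N. p i * gcoef \<delta> i m) = p m" using coef_low_lincomb[OF that] by (simp add: coef_lincomb_g)
    then show ?thesis using eq[of m] low[OF that] that by simp
  qed
  have key: "norm (v x) \<le> 1/2 * M" if M: "\<And>x. x \<in> {0..1} \<Longrightarrow> norm (v x) \<le> M" and "x \<in> {0..1}" for M x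
  proof -
    have M0: "0 \<le> M" using order_trans[OF norm_ge_zero M[of 0]] by simp
    have Bv: "norm (coef j (B v)) \<le> 2 * (b * M)" for j by (rule norm_coef_B_le[OF vX M])
    have tail: "norm (coef j v) \<le> (9/4 * b * M) / (ev j - norm \<mu>)" if j: "N < j" for j
    proof -
      have "norm (\<Sum>m\<le>N. (p m * \<delta> (j, m)) / of_real (ev j - ev m)) \<le> 2 * (b * M) * (4 * b) * gap N"
      proof (rule norm_gap_sum_le[OF j])
        fix m assume "m \<le> N"
        then show "norm (p m * \<delta> (j, m)) \<le> 2 * (b * M) * (4 * b)"
          unfolding norm_mult using \<delta>(1)[of "(j, m)"] Bv[of m] b1 M0 by (intro mult_mono) (auto simp: p)
      qed
      also have "\<dots> = 8 * b * M * (b * gap N)" by simp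
      also have "\<dots> \<le> 8 * b * M * (1/32)" using b_gap(1) b1 M0 by (intro mult_left_mono) auto
      finally have 1: "norm (\<Sum>m\<le>N. p m * gcoef \<delta> m j) \<le> 1/4 * b * M"
        using j by (simp add: gcoef_def mult.commute[of M b])
      have "(of_real (ev j) - \<mu>) * coef j v = (\<Sum>m\<le>N. p m * gcoef \<delta> m j) - coef j (B v)"
        using eq[of j] by (simp add: algebra_simps)
      then have "norm (of_real (ev j) - \<mu>) * norm (coef j v) = norm ((\<Sum>m\<le>N. p m * gcoef \<delta> m j) - coef j (B v))"
        by (metis norm_mult)
      also have "\<dots> \<le> 1/4 * b * M + 2 * (b * M)"
        using norm_triangle_ineq4[of "\<Sum>m\<le>N. p m * gcoef \<delta> m j" "coef j (B v)"] 1 Bv[of j] by linarith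
      finally have "norm (of_real (ev j) - \<mu>) * norm (coef j v) \<le> 9/4 * b * M" by (simp add: mult.commute[of M b])
      moreover have "ev j - norm \<mu> \<le> norm (of_real (ev j) - \<mu>)"
        using norm_triangle_ineq2[of "complex_of_real (ev j)" \<mu>] ev_nonneg[of j] by simp
      moreover have pos: "0 < ev j - norm \<mu>" using radius_less_ev[OF j] \<mu> by simp
      ultimately have "(ev j - norm \<mu>) * norm (coef j v) \<le> 9/4 * b * M"
        using mult_right_mono[of "ev j - norm \<mu>" "norm (of_real (ev j) - \<mu>)" "norm (coef j v)"] by simp
      then show ?thesis using pos by (simp add: field_simps)
    qed
    have "0 \<le> 9/4 * b * M" using b1 M0 by simp
    then have s: "summable (\<lambda>j. norm (coef j v))" "(\<Sum>j. norm (coef j v)) \<le> (\<Sum>m\<le>N. norm (coef m v)) + 9/4 * b * M * gap N"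
      using sum_gaps_above[OF N \<mu>, of "9/4 * b * M" "\<lambda>j. coef j v"] tail by blast+
    have "(\<Sum>m\<le>N. norm (coef m v)) = 0" by (rule sum.neutral) (simp add: low)
    then have "norm (v x) \<le> 9/4 * b * M * gap N"
      using norm_le_sum_coef[OF vX s(1), of x] s(2) by simp
    also have "\<dots> = 9/4 * M * (b * gap N)" by simp
    also have "\<dots> \<le> 9/4 * M * (1/32)" using b_gap(1) M0 by (intro mult_left_mono) auto
    also have "\<dots> \<le> 1/2 * M" using M0 by simp
    finally show ?thesis .
  qed
  show ?thesis by (rule contracting_bound_X[OF vX _ key]) auto
qed

text \<open>The low modes determine a vector of the invariant subspace, and those of an eigenfunction are divided by the large
  distances \<open>|\<mu>| - ev m\<close>.\<close>

lemma low_part_zero: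
  assumes y: "y = (\<lambda>x. \<Sum>m\<le>N. p m * g m x)" "H_op V Q \<alpha> \<beta> y (\<lambda>x. \<mu> * y x)" and \<mu>: "radius N \<le> norm \<mu>"
  shows "y = (\<lambda>x. 0)"
proof -
  have yX: "y \<in> X" using H_op_X[OF y(2)] .
  have p: "coef m y = p m" if "m \<le> N" for m unfolding y(1) by (rule coef_low_lincomb[OF that])
  note eq = eigenfunction_coef[OF y(2)]
  have key: "norm (y x) \<le> 1/2 * M" if M: "\<And>x. x \<in> {0..1} \<Longrightarrow> norm (y x) \<le> M" and "x \<in> {0..1}" for M x
  proof -
    have M0: "0 \<le> M" using order_trans[OF norm_ge_zero M[of 0]] by simp
    have pm: "norm (p m) \<le> 2 * (b * M) * (1 / (norm \<mu> - ev m))" if m: "m \<le> N" for m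
    proof -
      have pos: "0 < norm \<mu> - ev m" using sum_gaps_below(2)[OF N \<mu> m] by simp
      have "norm \<mu> - ev m \<le> norm (\<mu> - of_real (ev m))"
        using norm_triangle_ineq2[of \<mu> "complex_of_real (ev m)"] ev_nonneg[of m] by simp
      then have "(norm \<mu> - ev m) * norm (p m) \<le> norm (\<mu> - of_real (ev m)) * norm (p m)" by (rule mult_right_mono) simp
      also have "\<dots> = norm (coef m (B y))" using eq[of m] p[OF m] by (simp flip: norm_mult)
      also have "\<dots> \<le> 2 * (b * M)" by (rule norm_coef_B_le[OF yX M])
      finally show ?thesis using pos by (simp add: field_simps)
    qed
    have "norm (y x) \<le> (\<Sum>m\<le>N. norm (p m) * (9/8))"
      unfolding y(1)
    proof (rule order_trans[OF norm_sum sum_mono])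
      fix m assume "m \<in> {..N}"
      then show "norm (p m * g m x) \<le> norm (p m) * (9/8)"
        unfolding norm_mult using g_bound[of m x] by (intro mult_left_mono) auto
    qed
    also have "\<dots> \<le> (\<Sum>m\<le>N. 2 * (b * M) * (1 / (norm \<mu> - ev m)) * (9/8))"
      by (intro sum_mono mult_right_mono pm) auto
    also have "\<dots> = 9/4 * (b * M) * (\<Sum>m\<le>N. 1 / (norm \<mu> - ev m))"
    proof -
      have "2 * (b * M) * c * (9/8) = 9/4 * (b * M) * c" for c :: real by simp
      then show ?thesis unfolding sum_distrib_left by (intro sum.cong refl)
    qed
    also have "\<dots> \<le> 9/4 * (b * M) * gap N"
      using sum_gaps_below(1)[OF N \<mu>] b1 M0 by (intro mult_left_mono) auto
    also have "\<dots> = 9/4 * M * (b * gap N)" by simp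
    also have "\<dots> \<le> 9/4 * M * (1/32)" using b_gap(1) M0 by (intro mult_left_mono) auto
    also have "\<dots> \<le> 1/2 * M" using M0 by simp
    finally show ?thesis .
  qed
  show ?thesis by (rule contracting_bound_X[OF yX _ key]) auto
qed

end

section \<open>Counting eigenvalues\<close>

lemma sum_fun_apply: "(\<Sum>i\<in>I. f i) x = (\<Sum>i\<in>I. (f i x :: complex))" for f :: "'i \<Rightarrow> real \<Rightarrow> complex"
  by (induction I rule: infinite_finite_induct) auto

context delay_coefficients_gap
begin

definition G :: "(real \<Rightarrow> complex) set" where "G = cfun.span (g ` {..N})"

definition T :: "(real \<Rightarrow> complex) \<Rightarrow> real \<Rightarrow> complex" where
  "T y = (\<lambda>x. \<Sum>k\<le>N. coef k y * w k x)"

lemma lincomb_mem_G: "(\<lambda>x. \<Sum>k\<le>N. p k * g k x) \<in> G"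
proof -
  have "(\<Sum>k\<le>N. (\<lambda>x. p k * g k x)) \<in> G"
    unfolding G_def by (intro cfun.span_sum cfun.span_scale cfun.span_base) auto
  moreover have "(\<Sum>k\<le>N. (\<lambda>x. p k * g k x)) = (\<lambda>x. \<Sum>k\<le>N. p k * g k x)"
    by (rule ext) (rule sum_fun_apply)
  ultimately show ?thesis by simp
qed

lemma G_expansion: "y \<in> G \<Longrightarrow> y = (\<lambda>x. \<Sum>k\<le>N. coef k y * g k x)"
proof -
  assume y: "y \<in> G"
  have "\<exists>p. y = (\<lambda>x. \<Sum>k\<le>N. p k * g k x)"
    using y unfolding G_def
  proof (induction rule: cfun.span_induct_alt)
    case base
    show ?case by (rule exI[of _ "\<lambda>_. 0"]) (simp add: fun_eq_iff)
  next
    case (step c z y)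
    then obtain p m where p: "y = (\<lambda>x. \<Sum>k\<le>N. p k * g k x)" and m: "m \<le> N" "z = g m" by auto
    have "(\<lambda>x. c * z x) + y = (\<lambda>x. \<Sum>k\<le>N. ((if k = m then c else 0) + p k) * g k x)"
    proof
      fix x
      have "(\<Sum>k\<le>N. ((if k = m then c else 0) + p k) * g k x) = (\<Sum>k\<le>N. (if k = m then c * g m x else 0) + p k * g k x)"
        by (rule sum.cong) (auto simp: distrib_right)
      also have "\<dots> = c * g m x + (\<Sum>k\<le>N. p k * g k x)" using m by (simp add: sum.distrib)
      finally show "((\<lambda>x. c * z x) + y) x = (\<Sum>k\<le>N. ((if k = m then c else 0) + p k) * g k x)" using p m by simp
    qed
    then show ?case by (rule exI[of _ "\<lambda>k. (if k = m then c else 0) + p k"])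
  qed
  then obtain p where p: "y = (\<lambda>x. \<Sum>k\<le>N. p k * g k x)" by blast
  then have "coef k y = p k" if "k \<le> N" for k using coef_low_lincomb[OF that] by simp
  then have "(\<lambda>x. \<Sum>k\<le>N. coef k y * g k x) = (\<lambda>x. \<Sum>k\<le>N. p k * g k x)" by (intro ext sum.cong) auto
  then show ?thesis using p by simp
qed

lemma G_subset_X: "G \<subseteq> X"
proof
  fix y assume "y \<in> G"
  from G_expansion[OF this] show "y \<in> X" using X_lincomb[of "{..N}" g "\<lambda>k. coef k y"] g_X by auto
qed

lemma w_mem_G: "w k \<in> G"
  unfolding w_def[abs_def] by (rule lincomb_mem_G)

lemma T_mem_G: "T y \<in> G"
proof -
  have "T y = (\<Sum>k\<le>N. (\<lambda>x. coef k y * w k x))"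
    unfolding T_def by (rule ext) (rule sum_fun_apply[symmetric])
  then show ?thesis
    unfolding G_def using w_mem_G[unfolded G_def] by (auto intro!: cfun.span_sum cfun.span_scale)
qed

lemma H_T: "y \<in> G \<Longrightarrow> H_op V Q \<alpha> \<beta> y (T y)"
proof -
  assume y: "y \<in> G"
  have "H_op V Q \<alpha> \<beta> (\<lambda>x. \<Sum>k\<le>N. coef k y * g k x) (\<lambda>x. \<Sum>k\<le>N. coef k y * w k x)"
    by (rule H_op_lincomb) (auto intro: H_g w_X)
  then show ?thesis using G_expansion[OF y] by (simp add: T_def)
qed

lemma inj_g: "inj_on g {..N}"
proof (rule inj_onI)
  fix i k assume "i \<in> {..N}" "k \<in> {..N}" "g i = g k"
  then have "coef k (g i) = coef k (g k)" "i \<le> N" "k \<le> N" by auto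
  then show "i = k" by (auto simp: coef_g gcoef_def split: if_splits)
qed

lemma indep_g: "cfun.independent (g ` {..N})"
proof (rule cfun.independent_if_scalars_zero)
  fix f y assume f: "(\<Sum>y\<in>g ` {..N}. (\<lambda>x. f y * y x)) = 0" and y: "y \<in> g ` {..N}"
  have "(\<lambda>x. \<Sum>k\<le>N. f (g k) * g k x) = (\<Sum>k\<le>N. (\<lambda>x. f (g k) * g k x))"
    by (rule ext) (rule sum_fun_apply[symmetric])
  also have "\<dots> = 0" using f sum.reindex[OF inj_g, of "\<lambda>y. (\<lambda>x. f y * y x)"] by simp
  finally have z: "(\<lambda>x. \<Sum>k\<le>N. f (g k) * g k x) = (\<lambda>x. 0)" by (simp add: zero_fun_def)
  obtain m where m: "m \<le> N" "y = g m" using y by auto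
  have "f (g m) = coef m (\<lambda>x. 0)" using coef_low_lincomb[OF m(1), of "\<lambda>k. f (g k)"] z by simp
  then show "f y = 0" using m by (simp add: coef_def)
qed simp

sublocale op: finite_dim_operator "\<lambda>(c::complex) (y::real \<Rightarrow> complex) x. c * y x" G "g ` {..N}" T
proof unfold_locales
  show "G = cfun.span (g ` {..N})" by (rule G_def)
  show "cfun.independent (g ` {..N})" by (rule indep_g)
  fix c x y
  show "T x \<in> G" by (rule T_mem_G)
  assume "x \<in> G"
  then have xX: "x \<in> X" using G_subset_X by blast
  show "T (\<lambda>t. c * x t) = (\<lambda>t. c * T x t)" by (simp add: T_def coef_cmult sum_distrib_left mult_ac)
  assume "y \<in> G"
  then have yX: "y \<in> X" using G_subset_X by blast
  have "coef k (x + y) = coef k x + coef k y" for k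
    using coef_add[OF X_integrable[OF xX] X_integrable[OF yX]] by (simp add: plus_fun_def)
  then show "T (x + y) = T x + T y" by (simp add: T_def fun_eq_iff distrib_right sum.distrib)
qed simp

text \<open>Subtracting from \<open>y\<close> the element of the invariant subspace with the same low modes leaves a vector to which
  \<open>high_part_zero\<close> applies.\<close>

lemma preimage_mem_G:
  assumes y: "H_op V Q \<alpha> \<beta> y (\<lambda>x. \<mu> * y x + u x)" and u: "u \<in> G" and \<mu>: "norm \<mu> \<le> radius N"
  shows "y \<in> G"
proof -
  have yX: "y \<in> X" by (rule H_op_X[OF y])
  define z where "z = (\<lambda>x. \<Sum>k\<le>N. coef k y * g k x)"
  have zG: "z \<in> G" unfolding z_def by (rule lincomb_mem_G)
  have zX: "z \<in> X" using zG G_subset_X by blast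
  have uX: "u \<in> X" using u G_subset_X by blast
  have TX: "T z \<in> X" using T_mem_G G_subset_X by blast
  define v where "v = (\<lambda>x. y x - z x)"
  have yW: "(\<lambda>x. \<mu> * y x + u x) \<in> X" by (intro add_mem_X scale_mem_X yX uX)
  have "H_op V Q \<alpha> \<beta> (\<lambda>x. \<Sum>i\<in>{0,1::nat}. (if i = 0 then 1 else -1) * (if i = 0 then y else z) x)
      (\<lambda>x. \<Sum>i\<in>{0,1::nat}. (if i = 0 then 1 else -1) * (if i = 0 then (\<lambda>x. \<mu> * y x + u x) else T z) x)"
    by (rule H_op_lincomb) (use y H_T[OF zG] yW TX in auto)
  then have Hv: "H_op V Q \<alpha> \<beta> v (\<lambda>x. \<mu> * y x + u x - T z x)" by (simp add: v_def)
  define q where "q = (\<lambda>x. \<mu> * z x + u x - T z x)"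
  have "(\<lambda>x. \<mu> * z x) + u - T z \<in> G"
    using op.G_add[OF op.G_scale[OF zG, of \<mu>] u] op.G_diff T_mem_G by blast
  moreover have "(\<lambda>x. \<mu> * z x) + u - T z = q" by (simp add: q_def fun_eq_iff)
  ultimately have qG: "q \<in> G" by simp
  have q: "q x = (\<Sum>m\<le>N. coef m q * g m x)" for x using fun_cong[OF G_expansion[OF qG], of x] .
  have "(\<lambda>x. \<mu> * y x + u x - T z x) = (\<lambda>x. \<mu> * v x + (\<Sum>m\<le>N. coef m q * g m x))"
    by (rule ext) (simp add: q[symmetric], simp add: v_def q_def algebra_simps)
  then have Hv': "H_op V Q \<alpha> \<beta> v (\<lambda>x. \<mu> * v x + (\<Sum>m\<le>N. coef m q * g m x))" using Hv by simp
  have low: "coef m v = 0" if "m \<le> N" for m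
    using coef_diff[OF X_integrable[OF yX] X_integrable[OF zX]] coef_low_lincomb[OF that, of "\<lambda>k. coef k y"]
    by (simp add: v_def z_def)
  have "v = (\<lambda>x. 0)" by (rule high_part_zero[OF Hv' low \<mu>])
  then have "y = z" by (simp add: v_def fun_eq_iff)
  then show ?thesis using zG by simp
qed

text \<open>In the disc the root subspaces of the unbounded operator are those of its restriction to the invariant
  subspace, where linear algebra applies.\<close>

lemma ker_pow_eq_root_ker:
  assumes \<mu>: "norm \<mu> \<le> radius N"
  shows "ker_pow V Q \<alpha> \<beta> \<mu> k = op.root_ker \<mu> k"
proof (induction k)
  case 0
  show ?case by (simp add: zero_fun_def)
next
  case (Suc k)
  have shift: "(\<lambda>x. \<mu> * y x + op.shift \<mu> y x) = T y" for y by (simp add: op.shift_def fun_eq_iff)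
  show ?case
  proof (intro equalityI subsetI)
    fix y assume "y \<in> ker_pow V Q \<alpha> \<beta> \<mu> (Suc k)"
    then obtain u where u: "u \<in> op.root_ker \<mu> k" "H_op V Q \<alpha> \<beta> y (\<lambda>x. \<mu> * y x + u x)" using Suc by auto
    have uG: "u \<in> G" using u(1) op.root_ker_subset by blast
    have yG: "y \<in> G" by (rule preimage_mem_G[OF u(2) uG \<mu>])
    have "(\<lambda>x. \<mu> * y x + u x) = T y"
      by (rule H_op_unique[OF u(2) H_T[OF yG]]) (use yG uG T_mem_G G_subset_X in \<open>auto intro!: add_mem_X scale_mem_X\<close>)
    then have "T y x = \<mu> * y x + u x" for x by (simp add: fun_eq_iff)
    then have "op.shift \<mu> y = u" by (simp add: op.shift_def fun_eq_iff)
    then show "y \<in> op.root_ker \<mu> (Suc k)" using yG u(1) by simp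
  next
    fix y assume "y \<in> op.root_ker \<mu> (Suc k)"
    then have y: "y \<in> G" "op.shift \<mu> y \<in> op.root_ker \<mu> k" by auto
    have "H_op V Q \<alpha> \<beta> y (\<lambda>x. \<mu> * y x + op.shift \<mu> y x)" unfolding shift by (rule H_T[OF y(1)])
    then show "y \<in> ker_pow V Q \<alpha> \<beta> \<mu> (Suc k)" using y(2) Suc by auto
  qed
qed

lemma root_subspace_eq: "norm \<mu> \<le> radius N \<Longrightarrow> root_subspace V Q \<alpha> \<beta> \<mu> = op.root_space \<mu>"
  by (simp add: root_subspace_def op.root_space_def ker_pow_eq_root_ker)

lemma root_space_trivial:
  assumes "\<not> (is_eigenvalue V Q \<alpha> \<beta> \<mu> \<and> norm \<mu> \<le> radius N)"
  shows "op.root_space \<mu> = {0}"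
proof (rule op.root_space_trivial)
  fix y assume y: "y \<in> G" "op.shift \<mu> y = 0"
  then have "T y = (\<lambda>x. \<mu> * y x)" by (auto simp: op.shift_def fun_eq_iff)
  then have H: "H_op V Q \<alpha> \<beta> y (\<lambda>x. \<mu> * y x)" using H_T[OF y(1)] by simp
  show "y = 0"
  proof (rule ccontr)
    assume "y \<noteq> 0"
    then have y0: "y \<noteq> (\<lambda>x. 0)" by (simp add: zero_fun_def)
    then have "is_eigenvalue V Q \<alpha> \<beta> \<mu>" using H by (auto simp: is_eigenvalue_def)
    then have "radius N \<le> norm \<mu>" using assms by simp
    then show False using low_part_zero[OF G_expansion[OF y(1)] H] y0 by blast
  qed
qed

lemma eigenvalue_root_space:
  assumes "is_eigenvalue V Q \<alpha> \<beta> \<mu>" "norm \<mu> \<le> radius N"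
  shows "op.root_space \<mu> \<noteq> {0}"
proof -
  obtain y where y: "y \<noteq> (\<lambda>x. 0)" "H_op V Q \<alpha> \<beta> y (\<lambda>x. \<mu> * y x)" using assms(1) by (auto simp: is_eigenvalue_def)
  have "y \<in> ker_pow V Q \<alpha> \<beta> \<mu> (Suc 0)" using y(2) by simp
  then have "y \<in> op.root_space \<mu>" unfolding op.root_space_def ker_pow_eq_root_ker[OF assms(2)] by blast
  then show ?thesis using y(1) by (auto simp: zero_fun_def)
qed

text \<open>The invariant subspace has dimension \<open>N + 1\<close> and is the direct sum of the root spaces of the restriction.
  All these belong to eigenvalues in the disc, and conversely.\<close>

theorem card_small_eigenvalues:
  assumes lam: "enumerates_eigenvalues V Q \<alpha> \<beta> lam"
  shows "finite {n. norm (lam n) \<le> radius N}" and "card {n. norm (lam n) \<le> radius N} = Suc N"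
proof -
  define \<Lambda> where "\<Lambda> = {\<mu>. is_eigenvalue V Q \<alpha> \<beta> \<mu> \<and> norm \<mu> \<le> radius N}"
  define mult where "mult \<mu> = card {n. lam n = \<mu>}" for \<mu>
  have ex: "\<exists>B. finite B \<and> card B = mult \<mu> \<and> cfun.independent B \<and> cfun.span B = op.root_space \<mu>" if "\<mu> \<in> \<Lambda>" for \<mu>
  proof -
    have "has_multiplicity V Q \<alpha> \<beta> \<mu> (mult \<mu>)"
      using lam that unfolding enumerates_eigenvalues_def \<Lambda>_def mult_def by blast
    then show ?thesis using that root_subspace_eq[of \<mu>] unfolding has_multiplicity_def \<Lambda>_def by simp
  qed
  define bas where "bas \<mu> = (SOME B. finite B \<and> card B = mult \<mu> \<and> cfun.independent B \<and> cfun.span B = op.root_space \<mu>)" for \<mu>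
  have bas: "finite (bas \<mu>) \<and> card (bas \<mu>) = mult \<mu> \<and> cfun.independent (bas \<mu>) \<and> cfun.span (bas \<mu>) = op.root_space \<mu>" if "\<mu> \<in> \<Lambda>" for \<mu>
    unfolding bas_def by (rule someI_ex[OF ex[OF that]])
  have cg: "card (g ` {..N}) = Suc N" using card_image[OF inj_g] by simp
  have pos: "1 \<le> mult \<mu>" if "\<mu> \<in> \<Lambda>" for \<mu>
  proof (rule ccontr)
    assume "\<not> 1 \<le> mult \<mu>"
    then have "card (bas \<mu>) = 0" using bas[OF that] by linarith
    then have "bas \<mu> = {}" using bas[OF that] card_0_eq by blast
    then have "op.root_space \<mu> = {0}" using bas[OF that] cfun.span_empty by metis
    then show False using eigenvalue_root_space that by (auto simp: \<Lambda>_def)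
  qed
  have fin: "finite \<Lambda>"
  proof (rule ccontr)
    assume "infinite \<Lambda>"
    then obtain M where M: "M \<subseteq> \<Lambda>" "finite M" "card M = N + 2" using infinite_arbitrarily_large by blast
    have "card M \<le> (\<Sum>\<mu>\<in>M. card (bas \<mu>))"
      using sum_mono[of M "\<lambda>_. 1" "\<lambda>\<mu>. card (bas \<mu>)"] pos bas M(1) by (simp add: subset_iff)
    also have "\<dots> \<le> Suc N"
      using op.sum_root_multiplicities_le[OF M(2), of bas] bas M(1) cg by auto
    finally show False using M(3) by simp
  qed
  have "(\<Sum>\<mu>\<in>\<Lambda>. card (bas \<mu>)) = Suc N"
    using op.sum_root_multiplicities[OF fin, of bas] bas root_space_trivial cg by (auto simp: \<Lambda>_def)
  then have s: "(\<Sum>\<mu>\<in>\<Lambda>. mult \<mu>) = Suc N" using bas by simp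
  have eq: "{n. norm (lam n) \<le> radius N} = (\<Union>\<mu>\<in>\<Lambda>. {n. lam n = \<mu>})"
    using lam by (auto simp: \<Lambda>_def enumerates_eigenvalues_def)
  have fl: "finite {n. lam n = \<mu>}" if "\<mu> \<in> \<Lambda>" for \<mu>
    using lam that by (auto simp: \<Lambda>_def enumerates_eigenvalues_def)
  show "finite {n. norm (lam n) \<le> radius N}" unfolding eq using fin fl by blast
  have "card (\<Union>\<mu>\<in>\<Lambda>. {n. lam n = \<mu>}) = (\<Sum>\<mu>\<in>\<Lambda>. card {n. lam n = \<mu>})"
    by (rule card_UN_disjoint) (use fin fl in auto)
  then show "card {n. norm (lam n) \<le> radius N} = Suc N" unfolding eq using s by (simp add: mult_def)
qed

lemma small_eigenvalues_eq:
  assumes lam: "enumerates_eigenvalues V Q \<alpha> \<beta> lam"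
  shows "{n. norm (lam n) \<le> radius N} = {..N}"
proof -
  let ?A = "{n. norm (lam n) \<le> radius N}"
  note A = card_small_eigenvalues[OF lam]
  have "mono (\<lambda>n. norm (lam n))" using lam by (simp add: enumerates_eigenvalues_def)
  then have down: "i \<in> ?A" if "i \<le> j" "j \<in> ?A" for i j
    using that monoD[of "\<lambda>n. norm (lam n)" i j] by auto
  have "?A \<noteq> {}" using A(2) by (metis card.empty nat.distinct(1))
  then have "Max ?A \<in> ?A" using Max_in[OF A(1)] by blast
  then have sub: "{..Max ?A} \<subseteq> ?A" using down by blast
  have "?A \<subseteq> {..Max ?A}" using Max_ge[OF A(1)] by blast
  then have eq: "?A = {..Max ?A}" using sub by (rule equalityI)
  then have "card ?A = Suc (Max ?A)" by (metis card_atMost)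
  then have "Max ?A = N" using A(2) by simp
  then show ?thesis using eq by simp
qed

end

context delay_coefficients
begin

text \<open>At distance more than \<open>4 b\<close> from \<open>ev (N + 1)\<close> the resolvent would make every coefficient of the eigenfunction
  so small that their sum stays below the supremum of the eigenfunction.\<close>

lemma eigenvalue_near_ev:
  assumes \<mu>: "is_eigenvalue V Q \<alpha> \<beta> \<mu>" "radius N \<le> norm \<mu>" "norm \<mu> \<le> radius (Suc N)"
    and N: "1 \<le> N" and small: "32 * b * gap N \<le> 1" "32 * b * gap (Suc N) \<le> 1"
  shows "norm (\<mu> - of_real (ev (Suc N))) \<le> 4 * b"
proof (rule ccontr)
  assume far: "\<not> norm (\<mu> - of_real (ev (Suc N))) \<le> 4 * b"
  obtain y where y: "y \<noteq> (\<lambda>x. 0)" "H_op V Q \<alpha> \<beta> y (\<lambda>x. \<mu> * y x)" using \<mu>(1) by (auto simp: is_eigenvalue_def)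
  have yX: "y \<in> X" using H_op_X[OF y(2)] .
  note eq = eigenfunction_coef[OF y(2)]
  have key: "norm (y x) \<le> 3/4 * M" if M: "\<And>x. x \<in> {0..1} \<Longrightarrow> norm (y x) \<le> M" and "x \<in> {0..1}" for M x
  proof -
    have M0: "0 \<le> M" using order_trans[OF norm_ge_zero M[of 0]] by simp
    have bound: "norm (coef m y) \<le> 2 * (b * M) * (1 / d)" if "0 < d" "d \<le> norm (\<mu> - of_real (ev m))" for m d
    proof -
      have "d * norm (coef m y) \<le> norm (\<mu> - of_real (ev m)) * norm (coef m y)" using that by (intro mult_right_mono) auto
      also have "\<dots> = norm (coef m (B y))" using eq[of m] by (metis norm_mult)
      also have "\<dots> \<le> 2 * (b * M)" by (rule norm_coef_B_le[OF yX M])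
      finally show ?thesis using that by (simp add: field_simps)
    qed
    have low: "norm (coef m y) \<le> 2 * (b * M) * (1 / (norm \<mu> - ev m))" if "m \<le> N" for m
      using sum_gaps_below(2)[OF N \<mu>(2) that] norm_triangle_ineq2[of \<mu> "complex_of_real (ev m)"] ev_nonneg[of m]
      by (intro bound) simp_all
    have mid: "norm (coef (Suc N) y) \<le> 1/2 * M"
      using bound[of "4 * b" "Suc N"] far b1 by simp
    have high: "norm (coef j y) \<le> 2 * (b * M) / (ev j - norm \<mu>)" if "Suc N < j" for j
    proof -
      have "norm (coef j y) \<le> 2 * (b * M) * (1 / (ev j - norm \<mu>))"
        using radius_less_ev[OF that] \<mu>(3) norm_triangle_ineq2[of "complex_of_real (ev j)" \<mu>] ev_nonneg[of j]
        by (intro bound) (simp_all add: norm_minus_commute)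
      then show ?thesis by simp
    qed
    have "0 \<le> 2 * (b * M)" using M0 b1 by simp
    then have s: "summable (\<lambda>j. norm (coef j y))"
        "(\<Sum>j. norm (coef j y)) \<le> (\<Sum>m\<le>Suc N. norm (coef m y)) + 2 * (b * M) * gap (Suc N)"
      using sum_gaps_above[of "Suc N" "norm \<mu>" "2 * (b * M)" "\<lambda>j. coef j y"] \<mu>(3) high by auto
    have "(\<Sum>m\<le>N. norm (coef m y)) \<le> (\<Sum>m\<le>N. 2 * (b * M) * (1 / (norm \<mu> - ev m)))"
      by (intro sum_mono low) auto
    also have "\<dots> = 2 * (b * M) * (\<Sum>m\<le>N. 1 / (norm \<mu> - ev m))" by (rule sum_distrib_left[symmetric])
    also have "\<dots> \<le> 2 * (b * M) * gap N" using sum_gaps_below(1)[OF N \<mu>(2)] b1 M0 by (intro mult_left_mono) auto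
    finally have "(\<Sum>j. norm (coef j y)) \<le> 2 * (b * M) * gap N + 1/2 * M + 2 * (b * M) * gap (Suc N)"
      using s(2) mid by simp
    also have "\<dots> = 2 * M * (b * gap N) + 1/2 * M + 2 * M * (b * gap (Suc N))" by simp
    also have "\<dots> \<le> 2 * M * (1/32) + 1/2 * M + 2 * M * (1/32)"
      using small M0 by (intro add_mono mult_left_mono) auto
    also have "\<dots> \<le> 3/4 * M" using M0 by simp
    finally show ?thesis using norm_le_sum_coef[OF yX s(1), of x] by simp
  qed
  have "y = (\<lambda>x. 0)" by (rule contracting_bound_X[OF yX _ key]) auto
  then show False using y(1) by simp
qed

text \<open>Two consecutive discs contain \<open>N + 1\<close> and \<open>N + 2\<close> eigenvalues, hence exactly one lies in the annulus between
  the circles, and its multiplicity is one.\<close>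

theorem nth_eigenvalue:
  assumes lam: "enumerates_eigenvalues V Q \<alpha> \<beta> lam"
    and N: "1 \<le> N" and small: "32 * b * gap N \<le> 1" "32 * b * gap (Suc N) \<le> 1"
  shows "simple_eigenvalue V Q \<alpha> \<beta> (lam (Suc N))"
    and "norm (lam (Suc N) - of_real (ev (Suc N))) \<le> 4 * b"
proof -
  interpret L: delay_coefficients_gap V Q b \<alpha> \<beta> N by unfold_locales (use N small in auto)
  interpret U: delay_coefficients_gap V Q b \<alpha> \<beta> "Suc N" by unfold_locales (use N small in auto)
  note L = L.small_eigenvalues_eq[OF lam] and U = U.small_eigenvalues_eq[OF lam]
  have l: "norm (lam n) \<le> radius N \<longleftrightarrow> n \<le> N" and u: "norm (lam n) \<le> radius (Suc N) \<longleftrightarrow> n \<le> Suc N" for n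
    using L U by (auto simp: set_eq_iff)
  have ev: "is_eigenvalue V Q \<alpha> \<beta> (lam (Suc N))" using lam by (simp add: enumerates_eigenvalues_def)
  have "{n. lam n = lam (Suc N)} = {Suc N}"
  proof -
    have "n = Suc N" if "lam n = lam (Suc N)" for n
      using l[of n] u[of n] l[of "Suc N"] u[of "Suc N"] that by simp
    then show ?thesis by auto
  qed
  then have "has_multiplicity V Q \<alpha> \<beta> (lam (Suc N)) 1"
    using lam ev unfolding enumerates_eigenvalues_def by (metis card_1_singleton_iff One_nat_def)
  then show "simple_eigenvalue V Q \<alpha> \<beta> (lam (Suc N))" using ev by (simp add: simple_eigenvalue_def)
  show "norm (lam (Suc N) - of_real (ev (Suc N))) \<le> 4 * b"
    by (rule eigenvalue_near_ev[OF ev _ _ N small]) (use l[of "Suc N"] u[of "Suc N"] in auto)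
qed

end

section \<open>Powers of a power series\<close>

lemma finite_multi_indices: "finite {\<zeta>::nat list. length \<zeta> = t \<and> sum_list \<zeta> = p}"
proof (rule finite_subset)
  show "{\<zeta>::nat list. length \<zeta> = t \<and> sum_list \<zeta> = p} \<subseteq> {\<zeta>. set \<zeta> \<subseteq> {..p} \<and> length \<zeta> = t}"
    using member_le_sum_list by fastforce
qed (simp add: finite_lists_length_eq)

lemma multi_sum_0: "multi_sum r 0 p = (if p = 0 then 1 else 0)"
proof -
  have "{\<zeta>::nat list. length \<zeta> = 0 \<and> sum_list \<zeta> = p} = (if p = 0 then {[]} else {})" by auto
  then show ?thesis by (simp add: multi_sum_def)
qed

lemma multi_sum_Suc: "multi_sum r (Suc t) p = (\<Sum>k\<le>p. r k * multi_sum r t (p - k))"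
proof -
  have eq: "{\<zeta>::nat list. length \<zeta> = Suc t \<and> sum_list \<zeta> = p} = (\<Union>k\<in>{..p}. (#) k ` {\<zeta>. length \<zeta> = t \<and> sum_list \<zeta> = p - k})"
  proof (intro equalityI subsetI)
    fix \<zeta> :: "nat list" assume "\<zeta> \<in> {\<zeta>. length \<zeta> = Suc t \<and> sum_list \<zeta> = p}"
    then obtain k \<eta> where "\<zeta> = k # \<eta>" "length \<eta> = t" "k + sum_list \<eta> = p" by (auto simp: length_Suc_conv)
    then show "\<zeta> \<in> (\<Union>k\<in>{..p}. (#) k ` {\<zeta>. length \<zeta> = t \<and> sum_list \<zeta> = p - k})" by (intro UN_I[of k]) auto
  qed auto
  have "multi_sum r (Suc t) p = (\<Sum>k\<le>p. \<Sum>\<zeta>\<in>(#) k ` {\<zeta>. length \<zeta> = t \<and> sum_list \<zeta> = p - k}. prod_list (map r \<zeta>))"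
    unfolding multi_sum_def eq by (rule sum.UNION_disjoint) (auto simp: finite_multi_indices)
  also have "\<dots> = (\<Sum>k\<le>p. r k * multi_sum r t (p - k))"
    unfolding multi_sum_def by (intro sum.cong refl) (simp add: sum.reindex sum_distrib_left)
  finally show ?thesis .
qed

text \<open>\<open>multi_sum r t\<close> is the coefficient sequence of the \<open>t\<close>-th power of the power series with coefficients \<open>r\<close>.\<close>

lemma multi_sum_abs_power:
  assumes x: "0 \<le> x" and s: "summable (\<lambda>k. norm (r k) * x ^ k)" and R: "(\<Sum>k. norm (r k) * x ^ k) \<le> R"
  shows "summable (\<lambda>p. norm (multi_sum r t p) * x ^ p)" "(\<Sum>p. norm (multi_sum r t p) * x ^ p) \<le> R ^ t"
proof -
  have "summable (\<lambda>p. norm (multi_sum r t p) * x ^ p) \<and> (\<Sum>p. norm (multi_sum r t p) * x ^ p) \<le> R ^ t"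
  proof (induction t)
    case 0
    have "(\<lambda>p. norm (multi_sum r 0 p) * x ^ p) sums (norm (multi_sum r 0 0) * x ^ 0)"
      using sums_finite[of "{0}" "\<lambda>p. norm (multi_sum r 0 p) * x ^ p"] by (simp add: multi_sum_0)
    then show ?case by (simp add: sums_iff multi_sum_0)
  next
    case (Suc t)
    let ?a = "\<lambda>k. norm (r k) * x ^ k" and ?b = "\<lambda>p. norm (multi_sum r t p) * x ^ p"
    have n: "summable (\<lambda>k. norm (?a k))" "summable (\<lambda>k. norm (?b k))"
      using s Suc x by (simp_all add: abs_mult)
    have cp: "(\<lambda>p. \<Sum>k\<le>p. ?a k * ?b (p - k)) sums ((\<Sum>k. ?a k) * (\<Sum>k. ?b k))"
      by (rule Cauchy_product_sums[OF n])
    have le: "norm (multi_sum r (Suc t) p) * x ^ p \<le> (\<Sum>k\<le>p. ?a k * ?b (p - k))" for p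
    proof -
      have "norm (multi_sum r (Suc t) p) * x ^ p \<le> (\<Sum>k\<le>p. norm (r k * multi_sum r t (p - k))) * x ^ p"
        unfolding multi_sum_Suc using x by (intro mult_right_mono norm_sum) auto
      also have "\<dots> = (\<Sum>k\<le>p. ?a k * ?b (p - k))"
        unfolding sum_distrib_right
        by (rule sum.cong) (auto simp: norm_mult power_add[symmetric] mult_ac)
      finally show ?thesis .
    qed
    have sm: "summable (\<lambda>p. norm (multi_sum r (Suc t) p) * x ^ p)"
      by (rule summable_comparison_test'[OF sums_summable[OF cp], of 0]) (use le x in \<open>auto simp: abs_mult\<close>)
    have b0: "0 \<le> (\<Sum>k. ?b k)" by (rule suminf_nonneg) (use Suc x in auto)
    have a0: "0 \<le> (\<Sum>k. ?a k)" by (rule suminf_nonneg) (use s x in auto)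
    have "(\<Sum>p. norm (multi_sum r (Suc t) p) * x ^ p) \<le> (\<Sum>k. ?a k) * (\<Sum>k. ?b k)"
      using suminf_le[OF le sm sums_summable[OF cp]] sums_unique[OF cp] by simp
    also have "\<dots> \<le> R * R ^ t" using R Suc a0 b0 by (intro mult_mono) auto
    finally show ?case using sm by simp
  qed
  then show "summable (\<lambda>p. norm (multi_sum r t p) * x ^ p)" "(\<Sum>p. norm (multi_sum r t p) * x ^ p) \<le> R ^ t" by auto
qed

lemma multi_sum_power_sums:
  assumes x: "0 \<le> x" and s: "summable (\<lambda>k. norm (r k) * x ^ k)"
  shows "(\<lambda>p. multi_sum r t p * of_real x ^ p) sums (\<Sum>k. r k * of_real x ^ k) ^ t"
proof (induction t)
  case 0
  show ?case using sums_finite[of "{0}" "\<lambda>p. multi_sum r 0 p * of_real x ^ p"] by (simp add: multi_sum_0)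
next
  case (Suc t)
  have n: "summable (\<lambda>k. norm (r k * of_real x ^ k))"
    using s x by (simp add: norm_mult norm_power)
  have n': "summable (\<lambda>p. norm (multi_sum r t p * of_real x ^ p))"
    using multi_sum_abs_power(1)[OF x s order_refl, of t] x by (simp add: norm_mult norm_power)
  have "(\<lambda>p. \<Sum>k\<le>p. r k * of_real x ^ k * (multi_sum r t (p - k) * of_real x ^ (p - k))) sums
     ((\<Sum>k. r k * of_real x ^ k) * (\<Sum>k. multi_sum r t k * of_real x ^ k))"
    by (rule Cauchy_product_sums[OF n n'])
  moreover have "(\<Sum>k\<le>p. r k * of_real x ^ k * (multi_sum r t (p - k) * of_real x ^ (p - k))) = multi_sum r (Suc t) p * of_real x ^ p" for p
    unfolding multi_sum_Suc sum_distrib_right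
    by (rule sum.cong) (auto simp: power_add[symmetric] mult_ac)
  ultimately show ?case using Suc sums_unique[OF Suc] by simp
qed

section \<open>Rearranging multiple series\<close>

lemma has_sum_pair_nonneg:
  fixes f :: "'a \<times> 'b \<Rightarrow> real"
  assumes "\<And>x. ((\<lambda>y. f (x, y)) has_sum g x) UNIV" "(g has_sum S) UNIV" "\<And>z. 0 \<le> f z"
  shows "(f has_sum S) UNIV"
proof -
  have "f summable_on (SIGMA x:UNIV. UNIV)"
    by (rule summable_on_SigmaI[OF assms(1)]) (use assms(2,3) has_sum_imp_summable in auto)
  then have "(f has_sum S) (SIGMA x:UNIV. UNIV)" by (rule has_sum_SigmaI[OF assms(1,2)])
  then show ?thesis by simp
qed

lemma has_sum_pairD:
  fixes f :: "'a \<times> 'b \<Rightarrow> 'c :: {topological_comm_monoid_add, t3_space}"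
  assumes "(f has_sum S) UNIV" "\<And>x. ((\<lambda>y. f (x, y)) has_sum g x) UNIV"
  shows "(g has_sum S) UNIV"
  using has_sum_SigmaD[where f = f and A = UNIV and B = "\<lambda>_. UNIV"] assms by simp

text \<open>The term with indices \<open>t, l, p\<close> carries the power \<open>i = t + l + p\<close> of the variable; likewise
  \<open>i = 2 s + m\<close> in the next lemma.\<close>

lemma regroup_triple:
  fixes f :: "nat \<times> nat \<times> nat \<Rightarrow> 'c :: {topological_comm_monoid_add, t3_space}"
  assumes "(f has_sum S) UNIV"
  shows "(\<lambda>i. \<Sum>p=0..i. \<Sum>t=0..i - p. f (t, i - t - p, p)) sums S"
proof -
  let ?A = "SIGMA i:UNIV. SIGMA p:{0..i::nat}. {0..i - p}"
  have "((\<lambda>(i, p, t). f (t, i - t - p, p)) has_sum S) ?A = (f has_sum S) UNIV"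
    by (rule has_sum_reindex_bij_witness[of _ "\<lambda>(t, l, p). (t + l + p, p, t)" "\<lambda>(i, p, t). (t, i - t - p, p)"]) auto
  then have h: "((\<lambda>(i, p, t). f (t, i - t - p, p)) has_sum S) ?A" using assms by simp
  have "((\<lambda>i. \<Sum>p=0..i. \<Sum>t=0..i - p. f (t, i - t - p, p)) has_sum S) UNIV"
  proof (rule has_sum_SigmaD[OF h])
    fix i :: nat
    show "((\<lambda>y. case (i, y) of (i, p, t) \<Rightarrow> f (t, i - t - p, p)) has_sum (\<Sum>p=0..i. \<Sum>t=0..i - p. f (t, i - t - p, p))) (SIGMA p:{0..i}. {0..i - p})"
      by (rule has_sum_finiteI) (auto simp: sum.Sigma)
  qed
  then show ?thesis by (rule has_sum_imp_sums)
qed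

lemma regroup_pair:
  fixes f :: "nat \<times> nat \<Rightarrow> 'c :: {topological_comm_monoid_add, t3_space}"
  assumes "(f has_sum S) UNIV"
  shows "(\<lambda>i. \<Sum>s=0..i div 2. f (s, i - 2 * s)) sums S"
proof -
  let ?A = "SIGMA i:UNIV. {0..i div 2 :: nat}"
  have "((\<lambda>(i, s). f (s, i - 2 * s)) has_sum S) ?A = (f has_sum S) UNIV"
    by (rule has_sum_reindex_bij_witness[of _ "\<lambda>(s, m). (2 * s + m, s)" "\<lambda>(i, s). (s, i - 2 * s)"]) auto
  then have h: "((\<lambda>(i, s). f (s, i - 2 * s)) has_sum S) ?A" using assms by simp
  have "((\<lambda>i. \<Sum>s=0..i div 2. f (s, i - 2 * s)) has_sum S) UNIV"
  proof (rule has_sum_SigmaD[OF h])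
    fix i :: nat
    show "((\<lambda>y. case (i, y) of (i, s) \<Rightarrow> f (s, i - 2 * s)) has_sum (\<Sum>s=0..i div 2. f (s, i - 2 * s))) {0..i div 2}"
      by (rule has_sum_finiteI) auto
  qed
  then show ?thesis by (rule has_sum_imp_sums)
qed

lemma has_sum_nonneg_sums: "(\<And>n. 0 \<le> f n) \<Longrightarrow> summable f \<Longrightarrow> (f has_sum suminf f) (UNIV :: nat set)" for f :: "nat \<Rightarrow> real"
  by (rule norm_summable_imp_has_sum) (auto intro: summable_sums)

lemma triple_majorant:
  assumes x: "0 \<le> x" and s: "summable (\<lambda>k. norm (r k) * x ^ k)" "(\<Sum>k. norm (r k) * x ^ k) \<le> R"
    and C: "0 \<le> C" "C * x < 1" and R: "x * R < 1"
  shows "\<exists>S. ((\<lambda>(t, l, p). C * (C * x) ^ l * (x ^ t * (norm (multi_sum r t p) * x ^ p))) has_sum S) UNIV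
      \<and> S \<le> C / (1 - C * x) * (1 / (1 - x * R))"
proof -
  define m where "m t = (\<Sum>p. norm (multi_sum r t p) * x ^ p)" for t
  note ms = multi_sum_abs_power[OF x s]
  have m0: "0 \<le> m t" for t unfolding m_def by (rule suminf_nonneg[OF ms(1)]) (use x in auto)
  have R0: "0 \<le> R" by (rule order_trans[OF suminf_nonneg[OF s(1)] s(2)]) (use x in auto)
  have in_p: "((\<lambda>p. norm (multi_sum r t p) * x ^ p) has_sum m t) UNIV" for t
    unfolding m_def by (rule has_sum_nonneg_sums[OF _ ms(1)]) (use x in auto)
  have in_l: "((\<lambda>l. C * (C * x) ^ l) has_sum C / (1 - C * x)) UNIV"
  proof -
    have "(\<lambda>l. (C * x) ^ l) sums (1 / (1 - C * x))" by (rule geometric_sums) (use C x in auto)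
    then have "(\<lambda>l. C * (C * x) ^ l) sums (C * (1 / (1 - C * x)))" by (rule sums_mult)
    then show ?thesis by (intro norm_summable_imp_has_sum) (use C x in \<open>auto dest: sums_summable simp: abs_mult\<close>)
  qed
  have t_le: "x ^ t * m t \<le> (x * R) ^ t" for t
    using mult_left_mono[OF ms(2)[of t] zero_le_power[OF x, of t]] by (simp add: m_def power_mult_distrib)
  have geo: "summable (\<lambda>t. (x * R) ^ t)" by (rule summable_geometric) (use R R0 x in auto)
  have in_t: "((\<lambda>t. C / (1 - C * x) * (x ^ t * m t)) has_sum (C / (1 - C * x) * (\<Sum>t. x ^ t * m t))) UNIV"
  proof (intro has_sum_cmult_right has_sum_nonneg_sums)
    show "summable (\<lambda>t. x ^ t * m t)"
      by (rule summable_comparison_test'[OF geo, of 0]) (use t_le x m0 in auto)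
  qed (use x m0 in auto)
  have sle: "(\<Sum>t. x ^ t * m t) \<le> 1 / (1 - x * R)"
  proof -
    have "(\<Sum>t. x ^ t * m t) \<le> (\<Sum>t. (x * R) ^ t)"
      by (rule suminf_le[OF t_le _ geo]) (rule summable_comparison_test'[OF geo, of 0], use t_le x m0 in auto)
    also have "\<dots> = 1 / (1 - x * R)" by (rule suminf_geometric) (use R R0 x in auto)
    finally show ?thesis .
  qed
  have lp: "((\<lambda>(l, p). C * (C * x) ^ l * (x ^ t * (norm (multi_sum r t p) * x ^ p))) has_sum (C / (1 - C * x) * (x ^ t * m t))) UNIV" for t
  proof (rule has_sum_pair_nonneg)
    show "((\<lambda>p. case (l, p) of (l, p) \<Rightarrow> C * (C * x) ^ l * (x ^ t * (norm (multi_sum r t p) * x ^ p))) has_sum (C * (C * x) ^ l * (x ^ t * m t))) UNIV" for l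
      unfolding prod.case by (intro has_sum_cmult_right in_p)
    show "((\<lambda>l. C * (C * x) ^ l * (x ^ t * m t)) has_sum (C / (1 - C * x) * (x ^ t * m t))) UNIV"
      by (rule has_sum_cmult_left[OF in_l])
  qed (use C x in auto)
  have "((\<lambda>(t, l, p). C * (C * x) ^ l * (x ^ t * (norm (multi_sum r t p) * x ^ p))) has_sum (C / (1 - C * x) * (\<Sum>t. x ^ t * m t))) UNIV"
    by (rule has_sum_pair_nonneg[where g = "\<lambda>t. C / (1 - C * x) * (x ^ t * m t)"]) (use lp in_t C x in auto)
  moreover have "C / (1 - C * x) * (\<Sum>t. x ^ t * m t) \<le> C / (1 - C * x) * (1 / (1 - x * R))"
    using C by (intro mult_left_mono sle) auto
  ultimately show ?thesis by blast
qed

text \<open>The terms of the sine series beyond the linear one contribute little, since \<open>x R\<close> is small.\<close>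

lemma pair_majorant:
  assumes x: "0 \<le> x" and s: "summable (\<lambda>k. norm (r k) * x ^ k)" "(\<Sum>k. norm (r k) * x ^ k) \<le> R"
    and R: "x * R \<le> 1/2"
  shows "\<exists>S. ((\<lambda>(s, m). if s = 0 then 0 else norm (H_coeff r s m) * x ^ (2 * s + m)) has_sum S) UNIV \<and> S \<le> R / 18"
proof -
  define q where "q = (x * R)\<^sup>2"
  note ms = multi_sum_abs_power[OF x s]
  have R0: "0 \<le> R" by (rule order_trans[OF suminf_nonneg[OF s(1)] s(2)]) (use x in auto)
  have q: "0 \<le> q" "q \<le> 1/4" unfolding q_def using power_mono[of "x * R" "1/2" 2] R R0 x by (auto simp: power2_eq_square)
  define h where "h k = (if k = 0 then 0 else \<Sum>m. norm (H_coeff r k m) * x ^ (2 * k + m))" for k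
  have trm: "norm (H_coeff r k m) * x ^ (2 * k + m) = x ^ (2 * k) / fact (2 * k + 1) * (norm (multi_sum r (2 * k + 1) m) * x ^ m)" for k m
    unfolding H_coeff_def norm_mult norm_divide norm_power norm_fact by (simp add: power_add del: fact_Suc)
  have sm: "summable (\<lambda>m. norm (H_coeff r k m) * x ^ (2 * k + m))" for k
    unfolding trm by (rule summable_mult[OF ms(1)])
  have h0: "0 \<le> h k" for k unfolding h_def using sm x by (auto intro!: suminf_nonneg)
  have h_le: "h k \<le> (if k = 0 then 0 else R / 6 * q ^ k)" for k
  proof (cases "k = 0")
    case False
    have "(6::real) \<le> fact (2 * k + 1)"
      using fact_mono[of 3 "2 * k + 1", where 'a = real] False by (simp add: fact_numeral)
    have "h k = x ^ (2 * k) / fact (2 * k + 1) * (\<Sum>m. norm (multi_sum r (2 * k + 1) m) * x ^ m)"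
      unfolding h_def trm using False suminf_mult[OF ms(1)[of "2 * k + 1"], of "x ^ (2 * k) / fact (2 * k + 1)"]
      by (simp only: if_False)
    also have "\<dots> \<le> x ^ (2 * k) / 6 * R ^ (2 * k + 1)"
      using \<open>6 \<le> fact (2 * k + 1)\<close> x ms[of "2 * k + 1"]
      by (intro mult_mono frac_le suminf_nonneg) auto
    also have "\<dots> = R / 6 * q ^ k" by (simp add: q_def power_mult power_mult_distrib)
    finally show ?thesis using False by simp
  qed (simp add: h_def)
  have geo: "(\<lambda>k. R / 6 * (q * q ^ k)) sums (R / 6 * (q * (1 / (1 - q))))"
    by (intro sums_mult geometric_sums) (use q in auto)
  have geo': "(\<lambda>k. if k = 0 then 0 else R / 6 * q ^ k) sums (R / 6 * (q * (1 / (1 - q))))"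
    using geo sums_Suc_iff[of "\<lambda>k. if k = 0 then 0 else R / 6 * q ^ k" "R / 6 * (q * (1 / (1 - q)))"] by simp
  have sh: "summable h"
    by (rule summable_comparison_test'[OF sums_summable[OF geo'], of 0]) (use h_le h0 in auto)
  have "((\<lambda>(s, m). if s = 0 then 0 else norm (H_coeff r s m) * x ^ (2 * s + m)) has_sum suminf h) UNIV"
  proof (rule has_sum_pair_nonneg)
    show "(h has_sum suminf h) UNIV" by (rule has_sum_nonneg_sums[OF h0 sh])
    show "((\<lambda>m. case (k, m) of (s, m) \<Rightarrow> if s = 0 then 0 else norm (H_coeff r s m) * x ^ (2 * s + m)) has_sum h k) UNIV" for k
      unfolding h_def prod.case using x by (auto intro!: has_sum_nonneg_sums[OF _ sm] has_sum_0)
  qed (use x in auto)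
  moreover have "suminf h \<le> R / 18"
  proof -
    have "suminf h \<le> R / 6 * (q * (1 / (1 - q)))"
      using suminf_le[OF h_le sh sums_summable[OF geo']] sums_unique[OF geo'] by simp
    also have "q * (1 / (1 - q)) \<le> 1/3" using q by (simp add: field_simps)
    then have "R / 6 * (q * (1 / (1 - q))) \<le> R / 6 * (1/3)" using R0 by (intro mult_left_mono) auto
    finally show ?thesis by simp
  qed
  ultimately show ?thesis by blast
qed

section \<open>The recursion for the coefficients\<close>

text \<open>The recursion of the coefficients \<open>\<rho>\<^sub>i\<close>, with all that matters about the numbers \<open>E\<^sub>t\<^sub>,\<^sub>l\<close> expressed by one
  geometric bound.\<close>

locale coefficient_recursion =
  fixes E :: "nat \<Rightarrow> nat \<Rightarrow> complex" and r :: "nat \<Rightarrow> complex" and \<sigma> :: complex and C :: real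
  assumes E: "\<And>t l. norm (E t (Suc l)) \<le> C ^ Suc l" and C: "1 \<le> C" and \<sigma>: "norm \<sigma> = 1"
    and rec: "\<And>i. r i = \<sigma> * (\<Sum>p=0..i. \<Sum>t=0..i - p. E t (i + 1 - t - p) * multi_sum r t p)
        - (\<Sum>s=1..i div 2. H_coeff r s (i - 2 * s))"
begin

text \<open>With this radius \<open>C x0 = 1/8\<close>, and \<open>x0 R = 1/2\<close> for \<open>R = 4 C\<close>; the two majorants then add up to less than \<open>R\<close>.\<close>

definition x0 :: real where "x0 = 1 / (8 * C)"

text \<open>The recursion expresses \<open>r\<^sub>i\<close> by earlier coefficients with majorants that are convergent power series in
  \<open>x\<close> and the partial sum. At a fixed small radius the bound on one partial sum therefore reproduces itself
  for the next one.\<close>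

lemma partial_sums_bound: "(\<Sum>k<n. norm (r k) * x0 ^ k) \<le> 4 * C"
proof (induction n)
  case (Suc n)
  have x0: "0 \<le> x0" "C * x0 = 1/8" using C by (auto simp: x0_def)
  \<comment> \<open>Truncation makes the series finite without changing the right-hand sides of the recursion up to \<open>n\<close>.\<close>
  define a where "a k = (if k < n then r k else 0)" for k
  have sa: "(\<lambda>k. norm (a k) * x0 ^ k) sums (\<Sum>k<n. norm (r k) * x0 ^ k)"
    using sums_If_finite_set[of "{..<n}" "\<lambda>k. norm (r k) * x0 ^ k"]
    by (rule sums_cong[THEN iffD1, rotated]) (auto simp: a_def)
  define R where "R = 4 * C"
  have s: "summable (\<lambda>k. norm (a k) * x0 ^ k)" "(\<Sum>k. norm (a k) * x0 ^ k) \<le> R"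
    using sa Suc.IH sums_unique[OF sa] by (auto simp: sums_iff R_def)
  have xR: "x0 * R = 1/2" using x0(2) by (simp add: R_def mult.commute)
  obtain S1 where S1: "((\<lambda>(t, l, p). C * (C * x0) ^ l * (x0 ^ t * (norm (multi_sum a t p) * x0 ^ p))) has_sum S1) UNIV"
      "S1 \<le> C / (1 - C * x0) * (1 / (1 - x0 * R))"
    using triple_majorant[OF x0(1) s, of C] C x0 xR by auto
  obtain S2 where S2: "((\<lambda>(s, m). if s = 0 then 0 else norm (H_coeff a s m) * x0 ^ (2 * s + m)) has_sum S2) UNIV" "S2 \<le> R / 18"
    using pair_majorant[OF x0(1) s] xR by auto
  let ?A = "\<lambda>i. \<Sum>p=0..i. \<Sum>t=0..i - p. C * (C * x0) ^ (i - t - p) * (x0 ^ t * (norm (multi_sum a t p) * x0 ^ p))"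
  let ?H = "\<lambda>i. \<Sum>s=0..i div 2. if s = 0 then 0 else norm (H_coeff a s (i - 2 * s)) * x0 ^ (2 * s + (i - 2 * s))"
  have A: "?A sums S1" using regroup_triple[OF S1(1)] by simp
  have H: "?H sums S2" using regroup_pair[OF S2(1)] by simp
  have le: "norm (r i) * x0 ^ i \<le> ?A i + ?H i" if i: "i \<le> n" for i
  proof -
    have m1: "multi_sum r t p = multi_sum a t p" if "p \<le> i" "t \<le> i - p" for p t
    proof (cases "t = 0")
      case False
      then show ?thesis using that i by (intro multi_sum_cong) (auto simp: a_def)
    qed (simp add: multi_sum_0)
    have m2: "H_coeff r s (i - 2 * s) = H_coeff a s (i - 2 * s)" if "s \<in> {1..i div 2}" for s
      using that i by (intro H_coeff_cong) (auto simp: a_def)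
    have "norm (r i) \<le> norm (\<sigma> * (\<Sum>p=0..i. \<Sum>t=0..i - p. E t (i + 1 - t - p) * multi_sum r t p))
        + norm (\<Sum>s=1..i div 2. H_coeff r s (i - 2 * s))"
      by (subst rec) (rule norm_triangle_ineq4)
    also have "\<dots> \<le> (\<Sum>p=0..i. \<Sum>t=0..i - p. norm (E t (i + 1 - t - p) * multi_sum r t p))
        + (\<Sum>s=1..i div 2. norm (H_coeff r s (i - 2 * s)))"
      unfolding norm_mult[of \<sigma>] \<sigma> mult_1
      by (intro add_mono norm_sum order_trans[OF norm_sum sum_mono[OF norm_sum]])
    finally have "norm (r i) * x0 ^ i \<le> (\<Sum>p=0..i. \<Sum>t=0..i - p. norm (E t (i + 1 - t - p) * multi_sum r t p)) * x0 ^ i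
        + (\<Sum>s=1..i div 2. norm (H_coeff r s (i - 2 * s))) * x0 ^ i"
      using x0 by (simp add: mult_right_mono flip: distrib_right)
    also have "(\<Sum>p=0..i. \<Sum>t=0..i - p. norm (E t (i + 1 - t - p) * multi_sum r t p)) * x0 ^ i \<le> ?A i"
      unfolding sum_distrib_right
    proof (intro sum_mono)
      fix p t assume pt: "p \<in> {0..i}" "t \<in> {0..i - p}"
      then have e: "i + 1 - t - p = Suc (i - t - p)" by auto
      have xi: "x0 ^ i = x0 ^ (i - t - p) * x0 ^ t * x0 ^ p" using pt by (simp flip: power_add)
      have "norm (E t (i + 1 - t - p) * multi_sum r t p) * x0 ^ i \<le> (C ^ Suc (i - t - p) * norm (multi_sum a t p)) * x0 ^ i"
        unfolding norm_mult e using m1[of p t] pt x0 E[of t "i - t - p"]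
        by (simp only: atLeastAtMost_iff) (intro mult_right_mono zero_le_power norm_ge_zero)
      also have "\<dots> = C * (C * x0) ^ (i - t - p) * (x0 ^ t * (norm (multi_sum a t p) * x0 ^ p))"
        unfolding xi by (simp add: power_mult_distrib)
      finally show "norm (E t (i + 1 - t - p) * multi_sum r t p) * x0 ^ i \<le> \<dots>" .
    qed
    also have "(\<Sum>s=1..i div 2. norm (H_coeff r s (i - 2 * s))) * x0 ^ i = ?H i"
    proof -
      have "?H i = (\<Sum>s=1..i div 2. if s = 0 then 0 else norm (H_coeff a s (i - 2 * s)) * x0 ^ (2 * s + (i - 2 * s)))"
        by (rule sum.mono_neutral_right) auto
      also have "\<dots> = (\<Sum>s=1..i div 2. norm (H_coeff r s (i - 2 * s)) * x0 ^ i)"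
        by (rule sum.cong) (auto simp: m2)
      finally show ?thesis by (simp add: sum_distrib_right)
    qed
    finally show ?thesis by simp
  qed
  have "(\<Sum>k<Suc n. norm (r k) * x0 ^ k) \<le> (\<Sum>k<Suc n. ?A k + ?H k)" by (intro sum_mono le) auto
  also have "\<dots> = (\<Sum>k<Suc n. ?A k) + (\<Sum>k<Suc n. ?H k)" by (rule sum.distrib)
  also have "(\<Sum>k<Suc n. ?A k) \<le> S1"
    unfolding sums_unique[OF A]
  proof (rule sum_le_suminf[OF sums_summable[OF A]])
    show "0 \<le> ?A k" for k using C x0(1) by (intro sum_nonneg mult_nonneg_nonneg zero_le_power) auto
  qed simp
  also have "(\<Sum>k<Suc n. ?H k) \<le> S2"
    unfolding sums_unique[OF H]
  proof (rule sum_le_suminf[OF sums_summable[OF H]])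
    show "0 \<le> ?H k" for k using x0(1) by (auto intro!: sum_nonneg)
  qed simp
  also have "S1 + S2 \<le> C / (1 - C * x0) * (1 / (1 - x0 * R)) + R / 18" using S1(2) S2(2) by simp
  also have "\<dots> \<le> 4 * C" unfolding xR x0(2) using C by (simp add: R_def)
  finally show ?case by simp
qed (use C in simp)

theorem coefficient_bound: "norm (r i) \<le> 4 * C * (8 * C) ^ i"
proof -
  have p: "0 < x0" using C by (simp add: x0_def)
  have "norm (r i) * x0 ^ i \<le> (\<Sum>k<Suc i. norm (r k) * x0 ^ k)"
    using p by (auto intro!: sum_nonneg)
  also have "\<dots> \<le> 4 * C" by (rule partial_sums_bound)
  finally have "norm (r i) \<le> 4 * C / x0 ^ i" using p by (simp add: field_simps)
  then show ?thesis by (simp add: x0_def power_divide)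
qed

text \<open>At half the radius of the geometric bound the series is dominated by the powers of \<open>1/2\<close>.\<close>

lemma summable_at:
  assumes x: "0 < x" "16 * C * x \<le> 1"
  shows "summable (\<lambda>k. norm (r k) * x ^ k)" "(\<Sum>k. norm (r k) * x ^ k) \<le> 8 * C"
proof -
  have q: "0 \<le> 8 * C * x" "8 * C * x \<le> 1/2" using x C by auto
  have le: "norm (r k) * x ^ k \<le> 4 * C * (1/2) ^ k" for k
  proof -
    have "norm (r k) * x ^ k \<le> 4 * C * (8 * C) ^ k * x ^ k" using coefficient_bound x by (intro mult_right_mono) auto
    also have "\<dots> = 4 * C * (8 * C * x) ^ k" by (simp add: power_mult_distrib)
    also have "\<dots> \<le> 4 * C * (1/2) ^ k" using C q by (intro mult_left_mono power_mono) auto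
    finally show ?thesis .
  qed
  have g: "(\<lambda>k. 4 * C * (1/2::real) ^ k) sums (4 * C * (1 / (1 - 1/2)))"
    by (intro sums_mult geometric_sums) simp
  show s: "summable (\<lambda>k. norm (r k) * x ^ k)"
    by (rule summable_comparison_test'[OF sums_summable[OF g], of 0]) (use le x in auto)
  show "(\<Sum>k. norm (r k) * x ^ k) \<le> 8 * C"
    using suminf_le[OF le s sums_summable[OF g]] sums_unique[OF g] by simp
qed

definition root_shift :: "real \<Rightarrow> complex" where "root_shift x = of_real x * (\<Sum>k. r k * of_real x ^ k)"

lemma norm_root_shift_le:
  assumes x: "0 < x" "16 * C * x \<le> 1"
  shows "norm (root_shift x) \<le> 1/2"
proof -
  have n: "norm (r k * of_real x ^ k) = norm (r k) * x ^ k" for k using x by (simp add: norm_mult norm_power)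
  have "norm (\<Sum>k. r k * of_real x ^ k) \<le> (\<Sum>k. norm (r k * of_real x ^ k))"
    by (rule summable_norm) (simp only: n summable_at(1)[OF x])
  then have "norm (\<Sum>k. r k * of_real x ^ k) \<le> 8 * C" using summable_at(2)[OF x] unfolding n by simp
  then have "norm (root_shift x) \<le> x * (8 * C)"
    unfolding root_shift_def norm_mult using x by simp
  then show ?thesis using x(2) by (simp add: algebra_simps)
qed

text \<open>The recursion is the comparison of the coefficients of \<open>x\<^sup>i\<^sup>+\<^sup>1\<close> on both sides of the equation for \<open>sin w\<close>
  after the substitution \<open>w = x \<Sum>r\<^sub>i x\<^sup>i\<close>. Absolute convergence permits the regrouping.\<close>

theorem root_shift_solves:
  assumes x: "0 < x" "16 * C * x \<le> 1"
  shows "\<exists>S. ((\<lambda>(t, l). E t (Suc l) * of_real x ^ l * root_shift x ^ t) has_sum S) UNIV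
     \<and> sin (root_shift x) = \<sigma> * of_real x * S"
proof -
  define \<rho> where "\<rho> = (\<Sum>k. r k * of_real x ^ k)"
  have w: "root_shift x = of_real x * \<rho>" by (simp add: root_shift_def \<rho>_def)
  note s = summable_at[OF x]
  have x': "0 \<le> x" using x by simp
  have "0 < C * x" using x C by simp
  then have xR: "x * (8 * C) \<le> 1/2" "C * x < 1" using x(2) by (simp_all add: algebra_simps)
  have ms: "((\<lambda>p. multi_sum r t p * of_real x ^ p) has_sum \<rho> ^ t) UNIV" for t
    unfolding \<rho>_def
    by (rule norm_summable_imp_has_sum[OF _ multi_sum_power_sums[OF x' s(1)]])
       (use multi_sum_abs_power(1)[OF x' s, of t] x' in \<open>simp add: norm_mult norm_power\<close>)
  define A where "A = (\<lambda>(t, l, p). E t (Suc l) * of_real x ^ l * of_real x ^ t * (multi_sum r t p * of_real x ^ p))"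
  have "A summable_on UNIV"
  proof (rule abs_summable_summable, rule summable_on_comparison_test)
    obtain S where "((\<lambda>(t, l, p). C * (C * x) ^ l * (x ^ t * (norm (multi_sum r t p) * x ^ p))) has_sum S) UNIV"
      using triple_majorant[OF x' s, of C] C xR by auto
    then show "(\<lambda>(t, l, p). C * (C * x) ^ l * (x ^ t * (norm (multi_sum r t p) * x ^ p))) summable_on UNIV"
      by (rule has_sum_imp_summable)
    fix z :: "nat \<times> nat \<times> nat"
    obtain t l p where z: "z = (t, l, p)" by (cases z)
    have "norm (A z) = norm (E t (Suc l)) * x ^ l * x ^ t * (norm (multi_sum r t p) * x ^ p)"
      unfolding A_def z using x' by (simp add: norm_mult norm_power)
    also have "\<dots> \<le> C ^ Suc l * x ^ l * x ^ t * (norm (multi_sum r t p) * x ^ p)"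
      using E x' by (intro mult_right_mono) auto
    finally show "norm (A z) \<le> (case z of (t, l, p) \<Rightarrow> C * (C * x) ^ l * (x ^ t * (norm (multi_sum r t p) * x ^ p)))"
      by (simp add: z power_mult_distrib)
  qed auto
  then obtain S where S: "(A has_sum S) UNIV" by (auto simp: summable_on_def)
  have S1: "((\<lambda>(t, l). E t (Suc l) * of_real x ^ l * root_shift x ^ t) has_sum S) UNIV"
  proof -
    have "((\<lambda>(tl, p). A (fst tl, snd tl, p)) has_sum S) UNIV = (A has_sum S) UNIV"
      by (rule has_sum_reindex_bij_witness[of _ "\<lambda>(t, l, p). ((t, l), p)" "\<lambda>(tl, p). (fst tl, snd tl, p)"]) auto
    then have h: "((\<lambda>(tl, p). A (fst tl, snd tl, p)) has_sum S) UNIV" using S by simp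
    have "((\<lambda>tl. E (fst tl) (Suc (snd tl)) * of_real x ^ snd tl * root_shift x ^ fst tl) has_sum S) UNIV"
    proof (rule has_sum_pairD[OF h])
      fix tl :: "nat \<times> nat"
      show "((\<lambda>p. case (tl, p) of (tl, p) \<Rightarrow> A (fst tl, snd tl, p)) has_sum (E (fst tl) (Suc (snd tl)) * of_real x ^ snd tl * root_shift x ^ fst tl)) UNIV"
        unfolding prod.case A_def
        using has_sum_cmult_right[OF ms[of "fst tl"], of "E (fst tl) (Suc (snd tl)) * of_real x ^ snd tl * of_real x ^ fst tl"]
        by (simp add: w power_mult_distrib mult_ac)
    qed
    then show ?thesis by (simp add: case_prod_unfold)
  qed
  define om where "om i = (\<Sum>p=0..i. \<Sum>t=0..i - p. E t (i + 1 - t - p) * multi_sum r t p)" for i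
  have omS: "(\<lambda>i. om i * of_real x ^ i) sums S"
  proof -
    have "(\<Sum>p=0..i. \<Sum>t=0..i - p. A (t, i - t - p, p)) = om i * of_real x ^ i" for i
      unfolding om_def sum_distrib_right
    proof (intro sum.cong refl)
      fix p t assume "p \<in> {0..i}" "t \<in> {0..i - p}"
      then have e: "i + 1 - t - p = Suc (i - t - p)" and "i - t - p + t + p = i" by auto
      then have "complex_of_real x ^ i = of_real x ^ (i - t - p) * of_real x ^ t * of_real x ^ p" by (simp flip: power_add)
      then show "A (t, i - t - p, p) = E t (i + 1 - t - p) * multi_sum r t p * of_real x ^ i"
        unfolding A_def e by simp
    qed
    then show ?thesis using regroup_triple[OF S] by simp
  qed
  define Bf where "Bf = (\<lambda>(k, m). H_coeff r k m * of_real x ^ (2 * k + m))"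
  have H0: "H_coeff r 0 m = r m" for m
  proof -
    have "multi_sum r (Suc 0) m = (\<Sum>k\<le>m. if k = m then r k else 0)"
      unfolding multi_sum_Suc by (rule sum.cong) (auto simp: multi_sum_0)
    then show ?thesis by (simp add: H_coeff_def)
  qed
  have "Bf summable_on UNIV"
  proof (rule abs_summable_summable)
    obtain S2 where S2: "((\<lambda>(k, m). if k = 0 then 0 else norm (H_coeff r k m) * x ^ (2 * k + m)) has_sum S2) UNIV"
      using pair_majorant[OF x' s] xR by auto
    have "((\<lambda>(k::nat, m). if k = 0 then norm (r m) * x ^ m else 0) has_sum (\<Sum>k. norm (r k) * x ^ k)) UNIV"
    proof (rule has_sum_pair_nonneg)
      show "((\<lambda>m. case (k, m) of (k, m) \<Rightarrow> if k = 0 then norm (r m) * x ^ m else 0) has_sum (if k = 0 then (\<Sum>k. norm (r k) * x ^ k) else 0)) UNIV" for k :: nat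
        using x' by (auto intro!: has_sum_nonneg_sums[OF _ s(1)] has_sum_0)
      show "((\<lambda>k::nat. if k = 0 then (\<Sum>k. norm (r k) * x ^ k) else 0) has_sum (\<Sum>k. norm (r k) * x ^ k)) UNIV"
        by (rule has_sum_finite_neutralI[of "{0}"]) auto
    qed (use x' in auto)
    from has_sum_imp_summable[OF has_sum_add[OF S2 this]]
    have sm: "(\<lambda>z. (case z of (k, m) \<Rightarrow> if k = 0 then 0 else norm (H_coeff r k m) * x ^ (2 * k + m)) + (case z of (k, m) \<Rightarrow> if k = 0 then norm (r m) * x ^ m else 0)) summable_on UNIV" .
    have "(\<lambda>z. norm (Bf z)) summable_on UNIV"
    proof (rule summable_on_cong[THEN iffD1, OF _ sm])
      fix z :: "nat \<times> nat"
      show "(case z of (k, m) \<Rightarrow> if k = 0 then 0 else norm (H_coeff r k m) * x ^ (2 * k + m)) + (case z of (k, m) \<Rightarrow> if k = 0 then norm (r m) * x ^ m else 0) = norm (Bf z)"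
        using x' by (cases z) (auto simp: Bf_def norm_mult norm_power H0)
    qed
    then show "(\<lambda>z. norm (Bf z)) summable_on UNIV" .
  qed
  then obtain S' where S': "(Bf has_sum S') UNIV" by (auto simp: summable_on_def)
  have "(\<lambda>i. \<sigma> * (om i * of_real x ^ i)) sums S'"
  proof -
    have "(\<Sum>k=0..i div 2. Bf (k, i - 2 * k)) = \<sigma> * (om i * of_real x ^ i)" for i
    proof -
      have "(\<Sum>k=0..i div 2. Bf (k, i - 2 * k)) = (\<Sum>k=0..i div 2. H_coeff r k (i - 2 * k)) * of_real x ^ i"
        unfolding sum_distrib_right by (rule sum.cong) (auto simp: Bf_def)
      also have "(\<Sum>k=0..i div 2. H_coeff r k (i - 2 * k)) = r i + (\<Sum>k=1..i div 2. H_coeff r k (i - 2 * k))"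
        by (simp add: sum.atLeast_Suc_atMost H0)
      also have "\<dots> = \<sigma> * om i" using rec[of i] by (simp add: om_def)
      finally show ?thesis by simp
    qed
    then show ?thesis using regroup_pair[OF S'] by simp
  qed
  then have SS: "S' = \<sigma> * S" using sums_mult[OF omS, of \<sigma>] sums_unique2 by blast
  have "((\<lambda>k. (-1) ^ k / fact (2 * k + 1) * of_real x ^ (2 * k) * \<rho> ^ (2 * k + 1)) has_sum S') UNIV"
  proof (rule has_sum_pairD[OF S'])
    fix k
    show "((\<lambda>m. Bf (k, m)) has_sum ((-1) ^ k / fact (2 * k + 1) * of_real x ^ (2 * k) * \<rho> ^ (2 * k + 1))) UNIV"
      unfolding Bf_def prod.case H_coeff_def
      using has_sum_cmult_right[OF ms[of "2 * k + 1"], of "(-1) ^ k / fact (2 * k + 1) * of_real x ^ (2 * k)"]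
      by (simp add: power_add mult_ac del: fact_Suc)
  qed
  then have "(\<lambda>k. of_real x * ((-1) ^ k / fact (2 * k + 1) * of_real x ^ (2 * k) * \<rho> ^ (2 * k + 1))) sums (of_real x * S')"
    by (intro sums_mult has_sum_imp_sums)
  moreover have "of_real x * ((-1) ^ k / fact (2 * k + 1) * of_real x ^ (2 * k) * \<rho> ^ (2 * k + 1)) = sin_coeff (2 * k + 1) *\<^sub>R root_shift x ^ (2 * k + 1)" for k
    by (simp add: w sin_coeff_def scaleR_conv_of_real power_mult_distrib del: fact_Suc)
  ultimately have "(\<lambda>k. sin_coeff (2 * k + 1) *\<^sub>R root_shift x ^ (2 * k + 1)) sums (of_real x * S')" by simp
  then have "(\<lambda>n. sin_coeff n *\<^sub>R root_shift x ^ n) sums (of_real x * S')"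
  proof (subst (asm) sums_mono_reindex[of "\<lambda>k. 2 * k + 1"])
    show "strict_mono (\<lambda>k::nat. 2 * k + 1)" by (rule strict_monoI) simp
    fix n :: nat assume "n \<notin> range (\<lambda>k. 2 * k + 1)"
    then have "even n" by (metis oddE rangeI)
    then show "sin_coeff n *\<^sub>R root_shift x ^ n = 0" by (simp add: sin_coeff_def)
  qed
  then have "sin (root_shift x) = of_real x * S'" using sin_converges sums_unique2 by blast
  then show ?thesis using S1 SS by (intro exI[of _ S]) (simp add: mult_ac)
qed

end

section \<open>Holomorphic dependence on the spectral parameter\<close>

text \<open>The integrand may be merely measurable in the variable of integration. The difference quotients
  converge under the integral by dominated convergence, with a bound from Cauchy's estimate.\<close>

lemma holomorphic_integral:
  fixes G :: "complex \<Rightarrow> real \<Rightarrow> complex"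
  assumes int: "\<And>z. G z integrable_on {a..c}"
    and hol: "\<And>t. t \<in> {a..c} \<Longrightarrow> (\<lambda>z. G z t) holomorphic_on UNIV"
    and bd: "\<And>R. \<exists>K. \<forall>z\<in>ball 0 R. \<forall>t\<in>{a..c}. norm (G z t) \<le> K"
  shows "(\<lambda>z. integral {a..c} (G z)) holomorphic_on UNIV"
proof -
  have "\<exists>D. ((\<lambda>z. integral {a..c} (G z)) has_field_derivative D) (at z)" for z
  proof -
    obtain K where K: "\<And>u t. u \<in> ball 0 (norm z + 3) \<Longrightarrow> t \<in> {a..c} \<Longrightarrow> norm (G u t) \<le> K"
      using bd[of "norm z + 3"] by blast
    have der: "((\<lambda>u. G u t) has_field_derivative deriv (\<lambda>u. G u t) u) (at u)" if "t \<in> {a..c}" for t u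
      using holomorphic_derivI[OF hol[OF that] open_UNIV] by simp
    have dK: "norm (deriv (\<lambda>u. G u t) u) \<le> K" if t: "t \<in> {a..c}" and u: "u \<in> ball z 1" for t u
    proof -
      have "norm ((deriv ^^ 1) (\<lambda>u. G u t) u) \<le> fact 1 * K / 1 ^ 1"
      proof (rule Cauchy_inequality)
        show "(\<lambda>u. G u t) holomorphic_on ball u 1" by (rule holomorphic_on_subset[OF hol[OF t]]) auto
        show "continuous_on (cball u 1) (\<lambda>u. G u t)"
          by (rule holomorphic_on_imp_continuous_on, rule holomorphic_on_subset[OF hol[OF t]]) auto
        show "norm (G v t) \<le> K" if "norm (u - v) = 1" for v
        proof (rule K[OF _ t])
          have "norm v \<le> norm z + norm (u - z) + norm (v - u)"
            using norm_triangle_ineq[of z "u - z"] norm_triangle_ineq[of u "v - u"] by simp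
          then show "v \<in> ball 0 (norm z + 3)" using u that by (simp add: dist_norm norm_minus_commute)
        qed
      qed simp
      then show ?thesis by simp
    qed
    have quot: "norm ((G u t - G z t) / (u - z)) \<le> K" if t: "t \<in> {a..c}" and u: "u \<in> ball z 1" "u \<noteq> z" for t u
    proof -
      have "norm (G u t - G z t) \<le> K * norm (u - z)"
        by (rule field_differentiable_bound[of "ball z 1" "\<lambda>u. G u t" "deriv (\<lambda>u. G u t)"])
           (use der[OF t] dK[OF t] u in \<open>auto intro: has_field_derivative_at_within\<close>)
      then show ?thesis using u by (simp add: norm_divide divide_simps)
    qed
    define D where "D = integral {a..c} (\<lambda>t. deriv (\<lambda>u. G u t) z)"
    have "((\<lambda>u. (integral {a..c} (G u) - integral {a..c} (G z)) / (u - z)) \<longlongrightarrow> D) (at z)"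
      unfolding tendsto_at_iff_sequentially
    proof (intro allI impI)
      fix X :: "nat \<Rightarrow> complex" assume X: "\<forall>i. X i \<in> UNIV - {z}" "X \<longlonglongrightarrow> z"
      obtain k0 where k0: "\<And>k. k0 \<le> k \<Longrightarrow> X k \<in> ball z 1"
        using LIMSEQ_D[OF X(2), of 1] by (auto simp: dist_norm norm_minus_commute)
      have X': "X (k + k0) \<in> ball z 1" "X (k + k0) \<noteq> z" for k using k0[of "k + k0"] X(1) by auto
      define f where "f k t = (G (X (k + k0)) t - G z t) / (X (k + k0) - z)" for k t
      have fi: "f k integrable_on {a..c}" for k
        unfolding f_def divide_inverse by (intro integrable_on_mult_left integrable_diff int)
      have "(\<lambda>k. integral {a..c} (f k)) \<longlonglongrightarrow> D"
        unfolding D_def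
      proof (rule dominated_convergence(2)[where h = "\<lambda>_. K"])
        show "f k integrable_on {a..c}" for k by (rule fi)
        show "(\<lambda>_. K) integrable_on {a..c}" by (rule integrable_const_ivl)
        show "norm (f k t) \<le> K" if "t \<in> {a..c}" for k t unfolding f_def by (rule quot[OF that X'])
        show "(\<lambda>k. f k t) \<longlonglongrightarrow> deriv (\<lambda>u. G u t) z" if t: "t \<in> {a..c}" for t
        proof -
          have "((\<lambda>u. (G u t - G z t) / (u - z)) \<longlongrightarrow> deriv (\<lambda>u. G u t) z) (at z)"
            using der[OF t, of z] by (simp add: has_field_derivative_iff)
          then have "((\<lambda>u. (G u t - G z t) / (u - z)) \<circ> X) \<longlonglongrightarrow> deriv (\<lambda>u. G u t) z"
            using X unfolding tendsto_at_iff_sequentially by blast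
          from LIMSEQ_ignore_initial_segment[OF this, of k0] show ?thesis by (simp add: f_def o_def)
        qed
      qed
      moreover have "integral {a..c} (f k) = (integral {a..c} (G (X (k + k0))) - integral {a..c} (G z)) / (X (k + k0) - z)" for k
        unfolding f_def divide_inverse by (simp add: integral_diff[OF int int])
      ultimately have "(\<lambda>k. ((\<lambda>u. (integral {a..c} (G u) - integral {a..c} (G z)) / (u - z)) \<circ> X) (k + k0)) \<longlonglongrightarrow> D"
        by (simp add: o_def)
      then show "((\<lambda>u. (integral {a..c} (G u) - integral {a..c} (G z)) / (u - z)) \<circ> X) \<longlonglongrightarrow> D"
        by (rule LIMSEQ_offset)
    qed
    then show ?thesis by (auto simp: has_field_derivative_iff)
  qed
  then show ?thesis
    by (auto simp: holomorphic_on_def field_differentiable_def intro: has_field_derivative_at_within)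
qed

lemma norm_trig_le:
  fixes z :: complex
  assumes "0 \<le> s" "s \<le> 1" "\<bar>Im z\<bar> \<le> 1"
  shows "norm (sin (z * of_real s)) \<le> 3" "norm (cos (z * of_real s)) \<le> 3"
proof -
  have e: "exp \<bar>Im z\<bar> \<le> 3" using exp_le assms(3) order_trans[of "exp \<bar>Im z\<bar>" "exp 1" 3] by simp
  show "norm (sin (z * of_real s)) \<le> 3" "norm (cos (z * of_real s)) \<le> 3"
    using cmod_sin_le_exp[OF assms(1,2), of z] cmod_cos_le_exp[OF assms(1,2), of z] e
    by (simp_all add: scaleR_conv_of_real mult.commute)
qed

lemma norm_trig_le_exp:
  fixes z :: complex
  assumes "0 \<le> s" "s \<le> 1"
  shows "norm (sin (z * of_real s)) \<le> exp (norm z)" "norm (cos (z * of_real s)) \<le> exp (norm z)"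
  using cmod_sin_le_exp[OF assms, of z] cmod_cos_le_exp[OF assms, of z] abs_Im_le_cmod[of z]
    order_trans[of _ "exp \<bar>Im z\<bar>" "exp (norm z)"]
  by (simp_all add: scaleR_conv_of_real mult.commute)

context delay_coefficients
begin

lemma B_set_integral:
  assumes "continuous_on {0..1} u" "continuous_on {0..x} h"
  shows "(LINT t:{0..x}|lebesgue. B u t * h t) = integral {0..x} (\<lambda>t. B u t * h t)"
proof -
  obtain K where K: "\<And>x. x \<in> {0..1} \<Longrightarrow> norm (u x) \<le> K" using continuous_bounded01[OF assms(1)] by blast
  have "(\<lambda>t. B u t * h t) absolutely_integrable_on {0..x}"
    by (rule absolutely_integrable_mult_continuous[OF bounded_measurable_absolutely_integrable[OF B_measurable[OF assms(1)] B_bound[where u = u, OF K]] assms(2)])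
  then show ?thesis by (rule set_lebesgue_integral_eq_integral(2))
qed

abbreviation M where "M z \<equiv> M_op V Q z \<alpha> \<beta>"
abbreviation L where "L z \<equiv> L_op V Q z \<alpha> \<beta>"

lemma M_eq: "continuous_on {0..1} u \<Longrightarrow> M z u x = integral {0..x} (\<lambda>t. B u t * sin (z * of_real (x - t)))"
  unfolding M_op_def by (rule B_set_integral) (auto intro!: continuous_intros)

lemma L_eq: "continuous_on {0..1} u \<Longrightarrow> L z u x = integral {0..x} (\<lambda>t. B u t * cos (z * of_real (x - t)))"
  unfolding L_op_def by (rule B_set_integral) (auto intro!: continuous_intros)

lemma B_trig_integrable:
  assumes "continuous_on {0..1} u"
  shows "(\<lambda>t. B u t * sin (z * of_real (x - t))) integrable_on {a..c}"
    "(\<lambda>t. B u t * cos (z * of_real (x - t))) integrable_on {a..c}"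
  by (intro B_mult_integrable assms continuous_intros)+

lemma M_continuous:
  assumes u: "continuous_on {0..1} u"
  shows "continuous_on {0..1} (M z u)"
proof -
  have i: "(\<lambda>t. B u t * cos (z * of_real t)) integrable_on {a..c}" "(\<lambda>t. B u t * sin (z * of_real t)) integrable_on {a..c}" for a c
    by (intro B_mult_integrable u continuous_intros)+
  have "continuous_on {0..1} (\<lambda>x. sin (z * of_real x) * integral {0..x} (\<lambda>t. B u t * cos (z * of_real t))
      - cos (z * of_real x) * integral {0..x} (\<lambda>t. B u t * sin (z * of_real t)))"
    by (intro continuous_intros indefinite_integral_continuous_1 i)
  moreover have "M z u x = sin (z * of_real x) * integral {0..x} (\<lambda>t. B u t * cos (z * of_real t))
      - cos (z * of_real x) * integral {0..x} (\<lambda>t. B u t * sin (z * of_real t))" for x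
  proof -
    have "M z u x = integral {0..x} (\<lambda>t. sin (z * of_real x) * (B u t * cos (z * of_real t)) - cos (z * of_real x) * (B u t * sin (z * of_real t)))"
      unfolding M_eq[OF u] by (simp add: right_diff_distrib sin_diff algebra_simps)
    also have "\<dots> = integral {0..x} (\<lambda>t. sin (z * of_real x) * (B u t * cos (z * of_real t))) - integral {0..x} (\<lambda>t. cos (z * of_real x) * (B u t * sin (z * of_real t)))"
      by (intro integral_diff integrable_on_mult_right i)
    finally show ?thesis by (simp only: integral_mult_right)
  qed
  ultimately show ?thesis by simp
qed

lemma integral_bound01:
  fixes h :: "real \<Rightarrow> complex"
  assumes "h integrable_on {0..x}" "\<And>t. t \<in> {0..x} \<Longrightarrow> norm (h t) \<le> K" "x \<in> {0..1}"
  shows "norm (integral {0..x} h) \<le> K"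
proof -
  have K0: "0 \<le> K" using order_trans[OF norm_ge_zero assms(2)[of 0]] assms(3) by simp
  have "norm (integral {0..x} h) \<le> integral {0..x} (\<lambda>t. K)"
    by (rule integral_norm_bound_integral) (use assms in auto)
  also have "\<dots> = x * K" using assms(3) by simp
  also have "\<dots> \<le> 1 * K" using assms(3) K0 by (intro mult_right_mono) auto
  finally show ?thesis by simp
qed

lemma trig_ops_bound:
  assumes u: "continuous_on {0..1} u" "\<And>t. t \<in> {0..1} \<Longrightarrow> norm (u t) \<le> K" and x: "x \<in> {0..1}"
    and S: "\<And>s. 0 \<le> s \<Longrightarrow> s \<le> 1 \<Longrightarrow> norm (sin (z * of_real s)) \<le> S \<and> norm (cos (z * of_real s)) \<le> S"
  shows "norm (M z u x) \<le> b * K * S" "norm (L z u x) \<le> b * K * S"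
proof -
  have K0: "0 \<le> K" using order_trans[OF norm_ge_zero u(2)[of 0]] by simp
  have p: "norm (B u t * sin (z * of_real (x - t))) \<le> b * K * S" "norm (B u t * cos (z * of_real (x - t))) \<le> b * K * S"
    if "t \<in> {0..x}" for t
    unfolding norm_mult using B_bound[where u = u and x = t, OF u(2)] S[of "x - t"] that x K0 b1
    by (auto intro!: mult_mono simp del: of_real_diff)
  show "norm (M z u x) \<le> b * K * S" unfolding M_eq[OF u(1)]
    by (rule integral_bound01[OF B_trig_integrable(1)[OF u(1)] p(1) x])
  show "norm (L z u x) \<le> b * K * S" unfolding L_eq[OF u(1)]
    by (rule integral_bound01[OF B_trig_integrable(2)[OF u(1)] p(2) x])
qed

definition U :: "nat \<Rightarrow> complex \<Rightarrow> real \<Rightarrow> complex" where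
  "U j z = (M z ^^ j) (\<lambda>x. cos (z * of_real x))"

lemma U_0: "U 0 z = (\<lambda>x. cos (z * of_real x))" and U_Suc: "U (Suc j) z = M z (U j z)"
  by (simp_all add: U_def)

lemma U_continuous: "continuous_on {0..1} (U j z)"
  by (induction j) (auto simp: U_0 U_Suc intro!: continuous_intros M_continuous)

lemma f_coeff_eq: "f_coeff V Q j z \<alpha> \<beta> = L z (U j z) 1"
  by (simp add: f_coeff_def U_def)

lemma U_bound:
  assumes "\<And>s. 0 \<le> s \<Longrightarrow> s \<le> 1 \<Longrightarrow> norm (sin (z * of_real s)) \<le> S \<and> norm (cos (z * of_real s)) \<le> S" "x \<in> {0..1}"
  shows "norm (U j z x) \<le> S * (b * S) ^ j"
  using assms(2)
proof (induction j arbitrary: x)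
  case 0
  then show ?case using assms(1)[of x] by (simp add: U_0)
next
  case (Suc j)
  have "norm (U (Suc j) z x) \<le> b * (S * (b * S) ^ j) * S"
    unfolding U_Suc by (rule trig_ops_bound(1)[OF U_continuous Suc.IH Suc.prems assms(1)])
  then show ?case by (simp add: mult_ac)
qed

text \<open>In the strip the sines and cosines are at most \<open>e < 3\<close>, and each application of \<open>B\<close> contributes a factor \<open>b\<close>.
  One unit of room around \<open>\<pi>n\<close> is what the Cauchy estimates below need.\<close>

lemma f_coeff_bound:
  assumes "\<bar>Im z\<bar> \<le> 1"
  shows "norm (f_coeff V Q j z \<alpha> \<beta>) \<le> (9 * b) ^ Suc j"
proof -
  have S: "norm (sin (z * of_real s)) \<le> 3 \<and> norm (cos (z * of_real s)) \<le> 3" if "0 \<le> s" "s \<le> 1" for s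
    using norm_trig_le[OF that assms] by blast
  have "norm (f_coeff V Q j z \<alpha> \<beta>) \<le> b * (3 * (b * 3) ^ j) * 3"
    unfolding f_coeff_eq by (rule trig_ops_bound(2)[OF U_continuous U_bound[OF S]]) (use S in auto)
  also have "\<dots> = 9 * b * (3 * b) ^ j" by (simp add: mult_ac)
  also have "\<dots> \<le> 9 * b * (9 * b) ^ j" using b1 by (intro mult_left_mono power_mono) auto
  finally show ?thesis by simp
qed

lemma B_holomorphic:
  assumes "\<And>s. s \<in> {0..1} \<Longrightarrow> (\<lambda>z. h z s) holomorphic_on UNIV"
  shows "(\<lambda>z. B (h z) t) holomorphic_on UNIV"
proof -
  have "(\<lambda>z. restriction (translation a (continuation (h z))) t) holomorphic_on UNIV" for a
    using assms[of "t + a"]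
    by (cases "t \<in> {0<..<1}"; cases "t + a \<in> {0<..<1}") (auto simp: restriction_def translation_def continuation_def)
  then show ?thesis unfolding B_op_def by (intro holomorphic_intros)
qed

lemma U_locally_bounded: "\<exists>K. \<forall>z\<in>ball 0 R. \<forall>x\<in>{0..1}. norm (U j z x) \<le> K"
proof (intro exI ballI)
  fix z :: complex and x :: real assume z: "z \<in> ball 0 R" and x: "x \<in> {0..1}"
  have "norm (sin (z * of_real s)) \<le> exp R \<and> norm (cos (z * of_real s)) \<le> exp R" if "0 \<le> s" "s \<le> 1" for s
    using norm_trig_le_exp[OF that, of z] z order_trans[of _ "exp (norm z)" "exp R"] by simp
  from U_bound[OF this x] show "norm (U j z x) \<le> exp R * (b * exp R) ^ j" by simp
qed

lemma trig_integral_holomorphic: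
  assumes hc: "\<And>z. continuous_on {0..1} (h z)"
    and hh: "\<And>s. s \<in> {0..1} \<Longrightarrow> (\<lambda>z. h z s) holomorphic_on UNIV"
    and hb: "\<And>R. \<exists>K. \<forall>z\<in>ball 0 R. \<forall>x\<in>{0..1}. norm (h z x) \<le> K" and x: "x \<in> {0..1}"
  shows "(\<lambda>z. M z (h z) x) holomorphic_on UNIV" "(\<lambda>z. L z (h z) x) holomorphic_on UNIV"
proof -
  have bd: "\<exists>K. \<forall>z\<in>ball 0 R. \<forall>t\<in>{0..x}. norm (B (h z) t * sin (z * of_real (x - t))) \<le> K \<and> norm (B (h z) t * cos (z * of_real (x - t))) \<le> K" for R
  proof -
    obtain K where K: "\<And>z s. z \<in> ball 0 R \<Longrightarrow> s \<in> {0..1} \<Longrightarrow> norm (h z s) \<le> K" using hb[of R] by blast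
    show ?thesis
    proof (intro exI ballI)
      fix z t assume z: "z \<in> ball (0::complex) R" and t: "t \<in> {0..x}"
      have K0: "0 \<le> K" using order_trans[OF norm_ge_zero K[OF z, of 0]] by simp
      have e: "norm (sin (z * of_real (x - t))) \<le> exp R \<and> norm (cos (z * of_real (x - t))) \<le> exp R"
        using norm_trig_le_exp[of "x - t" z] t x z order_trans[of _ "exp (norm z)" "exp R"] by (simp del: of_real_diff)
      have "norm (B (h z) t) \<le> b * K" by (rule B_bound[OF K[OF z]])
      then show "norm (B (h z) t * sin (z * of_real (x - t))) \<le> (b * K) * exp R \<and> norm (B (h z) t * cos (z * of_real (x - t))) \<le> (b * K) * exp R"
        unfolding norm_mult using e K0 b1 by (auto intro!: mult_mono simp del: of_real_diff)
    qed
  qed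
  show "(\<lambda>z. M z (h z) x) holomorphic_on UNIV"
    unfolding M_eq[OF hc]
  proof (rule holomorphic_integral[OF B_trig_integrable(1)[OF hc]])
    show "(\<lambda>z. B (h z) t * sin (z * of_real (x - t))) holomorphic_on UNIV" for t
      by (intro holomorphic_intros B_holomorphic hh)
  qed (use bd in blast)
  show "(\<lambda>z. L z (h z) x) holomorphic_on UNIV"
    unfolding L_eq[OF hc]
  proof (rule holomorphic_integral[OF B_trig_integrable(2)[OF hc]])
    show "(\<lambda>z. B (h z) t * cos (z * of_real (x - t))) holomorphic_on UNIV" for t
      by (intro holomorphic_intros B_holomorphic hh)
  qed (use bd in blast)
qed

lemma U_holomorphic: "x \<in> {0..1} \<Longrightarrow> (\<lambda>z. U j z x) holomorphic_on UNIV"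
proof (induction j arbitrary: x)
  case 0
  then show ?case unfolding U_0 by (intro holomorphic_intros)
next
  case (Suc j)
  show ?case unfolding U_Suc
    by (rule trig_integral_holomorphic(1)[OF U_continuous Suc.IH U_locally_bounded Suc.prems])
qed

lemma f_coeff_holomorphic: "(\<lambda>z. f_coeff V Q j z \<alpha> \<beta>) holomorphic_on UNIV"
  unfolding f_coeff_eq by (rule trig_integral_holomorphic(2)[OF U_continuous U_holomorphic U_locally_bounded]) auto

definition taylor :: "nat \<Rightarrow> nat \<Rightarrow> nat \<Rightarrow> complex" where
  "taylor n j m = (deriv ^^ m) (\<lambda>z. f_coeff V Q j z \<alpha> \<beta>) (of_real (pi * real n)) / fact m"

lemma taylor_bound: "norm (taylor n j m) \<le> (9 * b) ^ Suc j"
proof -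
  have "norm ((deriv ^^ m) (\<lambda>z. f_coeff V Q j z \<alpha> \<beta>) (of_real (pi * real n))) \<le> fact m * (9 * b) ^ Suc j / 1 ^ m"
  proof (rule Cauchy_inequality)
    show "(\<lambda>z. f_coeff V Q j z \<alpha> \<beta>) holomorphic_on ball (of_real (pi * real n)) 1"
      by (rule holomorphic_on_subset[OF f_coeff_holomorphic]) auto
    show "continuous_on (cball (of_real (pi * real n)) 1) (\<lambda>z. f_coeff V Q j z \<alpha> \<beta>)"
      by (rule holomorphic_on_imp_continuous_on, rule holomorphic_on_subset[OF f_coeff_holomorphic]) auto
    show "norm (f_coeff V Q j z \<alpha> \<beta>) \<le> (9 * b) ^ Suc j" if "norm (of_real (pi * real n) - z) = 1" for z
    proof (rule f_coeff_bound)
      show "\<bar>Im z\<bar> \<le> 1" using abs_Im_le_cmod[of "of_real (pi * real n) - z"] that by simp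
    qed
  qed simp
  then show ?thesis by (simp add: taylor_def norm_divide divide_simps mult_ac)
qed

lemma taylor_sums:
  assumes "norm w < 1"
  shows "(\<lambda>m. taylor n j m * w ^ m) sums f_coeff V Q j (of_real (pi * real n) + w) \<alpha> \<beta>"
proof -
  have "((\<lambda>m. (deriv ^^ m) (\<lambda>z. f_coeff V Q j z \<alpha> \<beta>) (of_real (pi * real n)) / (fact m)
      * ((of_real (pi * real n) + w) - of_real (pi * real n)) ^ m) sums f_coeff V Q j (of_real (pi * real n) + w) \<alpha> \<beta>)"
    by (rule holomorphic_power_series[of _ _ 1]) (use assms in \<open>auto intro: holomorphic_on_subset[OF f_coeff_holomorphic] simp: dist_norm\<close>)
  then show ?thesis by (simp add: taylor_def)
qed

end

section \<open>The characteristic equation\<close>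

text \<open>The binomial series for negative integer exponents. Multiplying by the geometric series raises
  the exponent by one, because the diagonal sums of Pascal's triangle are again binomial coefficients.\<close>

lemma negative_binomial_sums:
  fixes y :: "'a :: {real_normed_field, banach}"
  assumes "norm y < 1"
  shows "(\<lambda>k. of_nat ((j + k) choose k) * y ^ k) sums (1 / (1 - y)) ^ Suc j"
    and "summable (\<lambda>k. norm (of_nat ((j + k) choose k) * y ^ k))"
proof -
  have abs: "summable (\<lambda>k. norm (of_nat ((j + k) choose k) * y ^ k))"
    if y: "norm y < 1" and sums: "\<And>y::'a. norm y < 1 \<Longrightarrow> (\<lambda>k. of_nat ((j + k) choose k) * y ^ k) sums (1 / (1 - y)) ^ Suc j" for y :: 'a and j
  proof -
    obtain q where q: "norm y < q" "q < 1" using dense[OF y] by blast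
    then have "0 \<le> q" using norm_ge_zero[of y] by linarith
    then have n: "norm (of_real q :: 'a) = q" by simp
    show ?thesis
      by (rule powser_insidea[OF sums_summable[OF sums[of "of_real q"]]]) (use q n in simp_all)
  qed
  have sums: "(\<lambda>k. of_nat ((j + k) choose k) * y ^ k) sums (1 / (1 - y)) ^ Suc j" if "norm y < 1" for y :: 'a and j
    using that
  proof (induction j arbitrary: y)
    case 0
    then show ?case using geometric_sums[of y] by simp
  next
    case (Suc j)
    have s: "summable (\<lambda>k. norm (of_nat ((j + k) choose k) * y ^ k))" by (rule abs[OF Suc.prems Suc.IH])
    have s': "summable (\<lambda>k. norm (y ^ k))" using Suc.prems by (simp add: norm_power)
    have "(\<lambda>k. \<Sum>i\<le>k. of_nat ((j + i) choose i) * y ^ i * y ^ (k - i)) sums ((\<Sum>k. of_nat ((j + k) choose k) * y ^ k) * (\<Sum>k. y ^ k))"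
      by (rule Cauchy_product_sums[OF s s'])
    moreover have "(\<Sum>i\<le>k. of_nat ((j + i) choose i) * y ^ i * y ^ (k - i)) = of_nat ((Suc j + k) choose k) * y ^ k" for k
    proof -
      have "(\<Sum>i\<le>k. of_nat ((j + i) choose i) * y ^ i * y ^ (k - i)) = (\<Sum>i\<le>k. of_nat ((j + i) choose i) * y ^ k)"
        by (rule sum.cong) (auto simp: power_add[symmetric] mult.assoc)
      also have "\<dots> = of_nat (\<Sum>i\<le>k. (j + i) choose i) * y ^ k" by (simp add: sum_distrib_right)
      also have "(\<Sum>i\<le>k. (j + i) choose i) = (Suc j + k) choose k" using sum_choose_lower[of j k] by simp
      finally show ?thesis .
    qed
    ultimately show ?case
      using sums_unique[OF Suc.IH[OF Suc.prems]] suminf_geometric[OF Suc.prems] by (simp add: mult.commute)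
  qed
  show "(\<lambda>k. of_nat ((j + k) choose k) * y ^ k) sums (1 / (1 - y)) ^ Suc j" by (rule sums[OF assms])
  show "summable (\<lambda>k. norm (of_nat ((j + k) choose k) * y ^ k))" by (rule abs[OF assms sums])
qed

context delay_coefficients
begin

lemma E_coeff_Suc:
  "E_coeff V Q t (Suc l) n \<alpha> \<beta> = (\<Sum>j = l - t..l. (-1) ^ (l - j) * of_nat (l choose j) * taylor n j (t + j - l))"
  unfolding E_coeff_def taylor_def
proof (rule sum.cong)
  fix j assume "j \<in> {l - t..l}"
  then have j: "j \<le> l" by simp
  show "(- 1) ^ (Suc l - j - 1) * fact (Suc l - 1) * (deriv ^^ (t + j + 1 - Suc l)) (\<lambda>z. f_coeff V Q j z \<alpha> \<beta>) (of_real (pi * real n)) /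
      (fact (Suc l - j - 1) * fact j * fact (t + j + 1 - Suc l)) =
    (- 1) ^ (l - j) * of_nat (l choose j) * ((deriv ^^ (t + j - l)) (\<lambda>z. f_coeff V Q j z \<alpha> \<beta>) (of_real (pi * real n)) / fact (t + j - l))"
  proof -
    have e: "Suc l - j - 1 = l - j" "Suc l - 1 = l" "t + j + 1 - Suc l = t + j - l" by auto
    show ?thesis unfolding e binomial_fact[OF j] by (simp add: field_simps)
  qed
qed simp

text \<open>The absolute values of the alternating binomial sum add up to a full binomial expansion of
  \<open>(1 + 9 b)\<^sup>l\<close>; the bound is uniform in \<open>t\<close> because that of the Taylor coefficients is uniform in their order.\<close>

lemma E_coeff_bound: "norm (E_coeff V Q t (Suc l) n \<alpha> \<beta>) \<le> (1 + 9 * b) ^ Suc l"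
proof -
  have "norm (E_coeff V Q t (Suc l) n \<alpha> \<beta>) \<le> (\<Sum>j = l - t..l. of_nat (l choose j) * (9 * b) ^ Suc j)"
    unfolding E_coeff_Suc
  proof (rule order_trans[OF norm_sum sum_mono])
    fix j
    have "norm ((-1) ^ (l - j) * of_nat (l choose j) * taylor n j (t + j - l)) = of_nat (l choose j) * norm (taylor n j (t + j - l))"
      by (simp add: norm_mult norm_power)
    then show "norm ((-1) ^ (l - j) * of_nat (l choose j) * taylor n j (t + j - l)) \<le> of_nat (l choose j) * (9 * b) ^ Suc j"
      using mult_left_mono[OF taylor_bound[of n j "t + j - l"], of "of_nat (l choose j)"] by (simp del: power_Suc)
  qed
  also have "\<dots> \<le> (\<Sum>j\<le>l. of_nat (l choose j) * (9 * b) ^ Suc j)"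
    using b1 by (intro sum_mono2) auto
  also have "\<dots> = 9 * b * (\<Sum>j\<le>l. of_nat (l choose j) * (9 * b) ^ j * 1 ^ (l - j))"
    unfolding sum_distrib_left by (rule sum.cong) auto
  also have "\<dots> = 9 * b * (9 * b + 1) ^ l" by (simp only: binomial_ring)
  also have "\<dots> \<le> (1 + 9 * b) ^ Suc l" using b1 by (auto simp: add.commute intro!: mult_right_mono)
  finally show ?thesis .
qed

text \<open>Expanding \<open>f\<^sub>j\<close> and \<open>z\<^sup>-\<^sup>j\<^sup>-\<^sup>1\<close> around \<open>\<pi> n\<close> and collecting the powers of \<open>1 / (\<pi> n)\<close>
  and of the displacement gives the coefficients \<open>E\<close>.\<close>

theorem characteristic_function_expansion:
  assumes n: "1 \<le> n" and x: "x = 1 / (pi * real n)" and w: "norm w \<le> 1/2" and small: "36 * b * x \<le> 1"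
  shows "\<exists>S. ((\<lambda>(t, l). E_coeff V Q t (Suc l) n \<alpha> \<beta> * of_real x ^ l * w ^ t) has_sum S) UNIV
    \<and> (\<lambda>j. f_coeff V Q j (of_real (pi * real n) + w) \<alpha> \<beta> / (of_real (pi * real n) + w) ^ Suc j) sums (of_real x * S)"
proof -
  have x0: "0 < x" using n by (simp add: x)
  have "x \<le> b * x" using b1 x0 by simp
  then have x1: "36 * x \<le> 1" using small by linarith
  define y where "y = x * norm w"
  have y: "0 \<le> y" "y \<le> 1/72" using x1 x0 w mult_mono[of x "1/36" "norm w" "1/2"] by (auto simp: y_def)
  \<comment> \<open>The index \<open>k\<close> comes from the power of \<open>1 + x w\<close> and \<open>m\<close> from the Taylor series of \<open>f\<^sub>j\<close>.\<close>
  define T where "T = (\<lambda>(j, k, m). (-1) ^ k * of_nat ((j + k) choose k) * taylor n j m * of_real x ^ (j + 1 + k) * w ^ (k + m))"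
  define Maj where "Maj = (\<lambda>(j, k, m). (9 * b * x) ^ Suc j * (of_nat ((j + k) choose k) * y ^ k * norm w ^ m))"
  have TM: "norm (T s) \<le> Maj s" for s
  proof -
    obtain j k m where s: "s = (j, k, m)" by (cases s)
    have "norm (T s) = norm (taylor n j m) * (of_nat ((j + k) choose k) * x ^ (j + 1 + k) * norm w ^ (k + m))"
      using x0 by (simp add: s T_def norm_mult norm_power)
    also have "\<dots> \<le> (9 * b) ^ Suc j * (of_nat ((j + k) choose k) * x ^ (j + 1 + k) * norm w ^ (k + m))"
      using x0 by (intro mult_right_mono taylor_bound) auto
    also have "\<dots> = Maj s" by (simp add: s Maj_def y_def power_mult_distrib power_add mult_ac)
    finally show ?thesis .
  qed
  define q where "q = 9 * b * x * (1 / (1 - y))"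
  have q: "0 \<le> q" "q < 1"
  proof -
    have "1 / (1 - y) \<le> 2" using y by (simp add: field_simps)
    moreover have "9 * b * x \<le> 1/4" using small by simp
    moreover have "0 \<le> 9 * b * x" using b1 x0 by simp
    ultimately have "q \<le> 1/4 * 2" unfolding q_def using y by (intro mult_mono) auto
    then show "q < 1" by simp
    show "0 \<le> q" unfolding q_def using b1 x0 y by simp
  qed
  have in_m: "((\<lambda>m. norm w ^ m) has_sum 1 / (1 - norm w)) UNIV"
    using w by (intro norm_summable_imp_has_sum geometric_sums) auto
  have in_k: "((\<lambda>k. of_nat ((j + k) choose k) * y ^ k) has_sum (1 / (1 - y)) ^ Suc j) UNIV" for j
    by (rule norm_summable_imp_has_sum[OF negative_binomial_sums(2,1)]) (use y in auto)
  have in_j: "((\<lambda>j. q ^ Suc j * (1 / (1 - norm w))) has_sum (q * (1 / (1 - q))) * (1 / (1 - norm w))) UNIV"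
  proof (rule has_sum_cmult_left)
    have "((\<lambda>j. q ^ j) has_sum 1 / (1 - q)) UNIV"
      using q by (intro norm_summable_imp_has_sum geometric_sums) auto
    from has_sum_cmult_right[OF this, of q] show "((\<lambda>j. q ^ Suc j) has_sum q * (1 / (1 - q))) UNIV" by simp
  qed
  have km: "((\<lambda>(k, m). of_nat ((j + k) choose k) * y ^ k * norm w ^ m) has_sum (1 / (1 - y)) ^ Suc j * (1 / (1 - norm w))) UNIV" for j
  proof (rule has_sum_pair_nonneg)
    show "((\<lambda>m. case (k, m) of (k, m) \<Rightarrow> of_nat ((j + k) choose k) * y ^ k * norm w ^ m) has_sum of_nat ((j + k) choose k) * y ^ k * (1 / (1 - norm w))) UNIV" for k
      unfolding prod.case by (rule has_sum_cmult_right[OF in_m])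
    show "((\<lambda>k. of_nat ((j + k) choose k) * y ^ k * (1 / (1 - norm w))) has_sum (1 / (1 - y)) ^ Suc j * (1 / (1 - norm w))) UNIV"
      by (rule has_sum_cmult_left[OF in_k])
  qed (use y in auto)
  have MajD: "((\<lambda>km. Maj (j, km)) has_sum q ^ Suc j * (1 / (1 - norm w))) UNIV" for j
    using has_sum_cmult_right[OF km[of j], of "(9 * b * x) ^ Suc j"]
    unfolding q_def power_mult_distrib Maj_def by (simp add: case_prod_unfold mult.assoc)
  have Maj0: "0 \<le> Maj s" for s by (rule order_trans[OF norm_ge_zero TM])
  have "(Maj has_sum (q * (1 / (1 - q))) * (1 / (1 - norm w))) UNIV"
    by (rule has_sum_pair_nonneg[OF MajD in_j Maj0])
  then have "(\<lambda>s. norm (T s)) summable_on UNIV"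
    by (rule summable_on_comparison_test[OF has_sum_imp_summable]) (use TM in auto)
  then have "T summable_on UNIV" by (rule abs_summable_summable)
  then obtain ST where ST: "(T has_sum ST) UNIV" by (auto simp: summable_on_def)
  define z where "z = of_real (pi * real n) + w"
  have zx: "of_real x * z = 1 + of_real x * w"
    using n by (simp add: z_def x distrib_left)
  have xw: "norm (- (of_real x * w)) < 1" using y x0 by (simp add: norm_mult y_def)
  then have nz: "1 + of_real x * w \<noteq> 0" by (metis add_eq_0_iff norm_minus_cancel norm_one order_less_irrefl)
  have z0: "z \<noteq> 0" using zx nz by auto
  have xz: "of_real x * (1 / (1 - - (of_real x * w))) = 1 / z"
    using zx nz z0 by (simp add: field_simps)
  have C1: "((\<lambda>j. f_coeff V Q j z \<alpha> \<beta> / z ^ Suc j) has_sum ST) UNIV"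
  proof (rule has_sum_pairD[OF ST])
    fix j
    have sm: "((\<lambda>m. taylor n j m * w ^ m) has_sum f_coeff V Q j z \<alpha> \<beta>) UNIV"
    proof (rule norm_summable_imp_has_sum)
      show "(\<lambda>m. taylor n j m * w ^ m) sums f_coeff V Q j z \<alpha> \<beta>"
        unfolding z_def by (rule taylor_sums) (use w in simp)
      show "summable (\<lambda>m. norm (taylor n j m * w ^ m))"
      proof (rule summable_comparison_test'[of "\<lambda>m. (9 * b) ^ Suc j * norm w ^ m" 0])
        show "summable (\<lambda>m. (9 * b) ^ Suc j * norm w ^ m)" by (intro summable_mult summable_geometric) (use w in simp)
        show "norm (norm (taylor n j m * w ^ m)) \<le> (9 * b) ^ Suc j * norm w ^ m" for m
          using mult_right_mono[OF taylor_bound[of n j m], of "norm w ^ m"] by (simp add: norm_mult norm_power)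
      qed
    qed
    have sk: "((\<lambda>k. of_nat ((j + k) choose k) * (- (of_real x * w)) ^ k) has_sum (1 / (1 - - (of_real x * w))) ^ Suc j) UNIV"
      by (rule norm_summable_imp_has_sum[OF negative_binomial_sums(2)[OF xw] negative_binomial_sums(1)[OF xw]])
    have skm: "((\<lambda>(k, m). T (j, k, m)) has_sum f_coeff V Q j z \<alpha> \<beta> / z ^ Suc j) UNIV"
    proof -
      have "(\<lambda>km. norm (T (j, km))) summable_on UNIV"
        by (rule summable_on_comparison_test[OF has_sum_imp_summable[OF MajD[of j]]]) (use TM in auto)
      then have "(\<lambda>km. T (j, km)) summable_on UNIV" by (rule abs_summable_summable)
      then obtain R where R: "((\<lambda>km. T (j, km)) has_sum R) UNIV" by (auto simp: summable_on_def)
      have "((\<lambda>k. of_real x ^ Suc j * (of_nat ((j + k) choose k) * (- (of_real x * w)) ^ k) * f_coeff V Q j z \<alpha> \<beta>) has_sum R) UNIV"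
      proof (rule has_sum_pairD[OF R])
        fix k
        show "((\<lambda>m. T (j, k, m)) has_sum (of_real x ^ Suc j * (of_nat ((j + k) choose k) * (- (of_real x * w)) ^ k) * f_coeff V Q j z \<alpha> \<beta>)) UNIV"
        proof -
          have e: "(- (of_real x * w)) ^ k = (-1) ^ k * (of_real x ^ k * w ^ k)"
            by (subst power_minus) (simp add: power_mult_distrib)
          have "T (j, k, m) = of_real x ^ Suc j * (of_nat ((j + k) choose k) * (- (of_real x * w)) ^ k) * (taylor n j m * w ^ m)" for m
            unfolding T_def e by (simp add: power_add mult_ac)
          then show ?thesis
            using has_sum_cmult_right[OF sm, of "of_real x ^ Suc j * (of_nat ((j + k) choose k) * (- (of_real x * w)) ^ k)"]
            by (simp only:)
        qed
      qed
      moreover have "((\<lambda>k. of_real x ^ Suc j * (of_nat ((j + k) choose k) * (- (of_real x * w)) ^ k) * f_coeff V Q j z \<alpha> \<beta>)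
          has_sum (of_real x ^ Suc j * (1 / (1 - - (of_real x * w))) ^ Suc j * f_coeff V Q j z \<alpha> \<beta>)) UNIV"
        by (intro has_sum_cmult_left has_sum_cmult_right sk)
      ultimately have "R = (of_real x * (1 / (1 - - (of_real x * w)))) ^ Suc j * f_coeff V Q j z \<alpha> \<beta>"
        unfolding power_mult_distrib using has_sum_unique by blast
      then have "R = f_coeff V Q j z \<alpha> \<beta> / z ^ Suc j" unfolding xz by (simp add: power_divide)
      then show ?thesis using R by (simp add: case_prod_unfold)
    qed
    then show "((\<lambda>km. T (j, km)) has_sum f_coeff V Q j z \<alpha> \<beta> / z ^ Suc j) UNIV" by (simp add: case_prod_unfold)
  qed
  \<comment> \<open>The powers of \<open>w\<close> and \<open>x\<close> are \<open>t = k + m\<close> and \<open>l + 1 = j + k + 1\<close>.\<close>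
  let ?A = "SIGMA tl:UNIV. {snd tl - fst tl..snd tl :: nat}"
  have "((\<lambda>(tl, j). T (j, snd tl - j, fst tl + j - snd tl)) has_sum ST) ?A = (T has_sum ST) UNIV"
    by (rule has_sum_reindex_bij_witness[of _ "\<lambda>(j, k, m). ((k + m, j + k), j)" "\<lambda>(tl, j). (j, snd tl - j, fst tl + j - snd tl)"]) auto
  then have h: "((\<lambda>(tl, j). T (j, snd tl - j, fst tl + j - snd tl)) has_sum ST) ?A" using ST by simp
  have "((\<lambda>tl. of_real x * (E_coeff V Q (fst tl) (Suc (snd tl)) n \<alpha> \<beta> * of_real x ^ snd tl * w ^ fst tl)) has_sum ST) UNIV"
  proof (rule has_sum_SigmaD[OF h])
    fix tl :: "nat \<times> nat"
    obtain t l where tl: "tl = (t, l)" by (cases tl)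
    show "((\<lambda>j. case (tl, j) of (tl, j) \<Rightarrow> T (j, snd tl - j, fst tl + j - snd tl)) has_sum
        of_real x * (E_coeff V Q (fst tl) (Suc (snd tl)) n \<alpha> \<beta> * of_real x ^ snd tl * w ^ fst tl)) {snd tl - fst tl..snd tl}"
    proof (rule has_sum_finiteI)
      have "T (j, l - j, t + j - l) = of_real x * of_real x ^ l * w ^ t * ((-1) ^ (l - j) * of_nat (l choose j) * taylor n j (t + j - l))"
        if "j \<in> {l - t..l}" for j
      proof -
        have "j + (l - j) = l" "l - j + (t + j - l) = t" "j + 1 + (l - j) = Suc l" using that by auto
        moreover have "l choose (l - j) = l choose j" using that by (simp add: binomial_symmetric[symmetric])
        ultimately show ?thesis by (simp add: T_def mult_ac)
      qed
      then show "of_real x * (E_coeff V Q (fst tl) (Suc (snd tl)) n \<alpha> \<beta> * of_real x ^ snd tl * w ^ fst tl)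
          = (\<Sum>j\<in>{snd tl - fst tl..snd tl}. case (tl, j) of (tl, j) \<Rightarrow> T (j, snd tl - j, fst tl + j - snd tl))"
        unfolding E_coeff_Suc tl by (simp add: sum_distrib_left sum_distrib_right mult_ac)
    qed simp
  qed
  from has_sum_cmult_right[OF this, of "of_real (1 / x)"]
  have "((\<lambda>(t, l). E_coeff V Q t (Suc l) n \<alpha> \<beta> * of_real x ^ l * w ^ t) has_sum (of_real (1 / x) * ST)) UNIV"
    using x0 by (simp add: case_prod_unfold)
  moreover have "of_real x * (of_real (1 / x) * ST) = ST" using x0 by simp
  ultimately show ?thesis using has_sum_imp_sums[OF C1] unfolding z_def
    by (intro exI[of _ "of_real (1 / x) * ST"]) simp
qed

end

section \<open>Eigenfunctions satisfy the characteristic equation\<close>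

context delay_coefficients
begin

text \<open>Testing the eigenvalue equation with a solution \<open>g\<close> of \<open>g'' = - z\<^sup>2 g\<close> leaves only boundary terms. The choices
  \<open>sin z(x - t)\<close> and \<open>cos z(1 - t)\<close> of \<open>g(t)\<close> give the variation of constants formula and its derivative at \<open>1\<close>.\<close>

lemma eigenfunction_green:
  assumes y: "W22 y y' y''" and ae: "AE t in leb01. z\<^sup>2 * y t = - y'' t + B y t"
    and g: "\<And>t. t \<in> {0..1} \<Longrightarrow> (g has_vector_derivative g' t) (at t within {0..1})"
    and g': "\<And>t. t \<in> {0..1} \<Longrightarrow> (g' has_vector_derivative - z\<^sup>2 * g t) (at t within {0..1})"
    and x: "x \<in> {0..1}"
  shows "integral {0..x} (\<lambda>t. B y t * g t) = y' x * g x - y' 0 * g 0 - y x * g' x + y 0 * g' 0"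
proof -
  have gc: "continuous_on {0..1} g" "continuous_on {0..1} g'"
    using g g' by (metis continuous_on_eq_continuous_within has_vector_derivative_continuous)+
  note d = W22_derivative[OF y]
  have yc: "continuous_on {0..1} y" using W22_imp_X[OF y] X_cont by blast
  have y'c: "continuous_on {0..1} y'"
  proof (rule continuous_on_eq)
    show "continuous_on {0..1} (\<lambda>x. y' 0 + integral {0..x} y'')"
      using d(1) set_lebesgue_integral_eq_integral(1) by (intro continuous_intros indefinite_integral_continuous_1) blast
  qed (use d(2) in metis)
  have ibp1: "integral {0..x} (\<lambda>t. y'' t * g t) = y' x * g x - y' 0 * g 0 - integral {0..x} (\<lambda>t. y' t * g' t)"
    by (rule integral_by_parts_absolutely_continuous[OF d(1,2) g gc(2) x])
  have ibp2: "integral {0..x} (\<lambda>t. y' t * g' t) = y x * g' x - y 0 * g' 0 - integral {0..x} (\<lambda>t. y t * (- z\<^sup>2 * g t))"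
  proof (rule integral_by_parts_absolutely_continuous[OF absolutely_integrable_continuous_real[OF y'c] _ g' _ x])
    show "y t = y 0 + integral {0..t} y'" if "t \<in> {0..1}" for t
      using fundamental_theorem_of_calculus[of 0 t y y'] that has_vector_derivative_within_subset[OF d(3), of _ "{0..t}"]
      by (auto dest!: integral_unique)
    show "continuous_on {0..1} (\<lambda>t. - z\<^sup>2 * g t)" by (intro continuous_intros gc)
  qed
  have i1: "(\<lambda>t. y'' t * g t) integrable_on {0..x}"
  proof -
    have "(\<lambda>t. y'' t * g t) integrable_on {0..1}"
      using absolutely_integrable_mult_continuous[OF d(1) gc(1)] set_lebesgue_integral_eq_integral(1) by blast
    then show ?thesis by (rule integrable_on_subinterval) (use x in auto)
  qed
  have sub: "continuous_on {0..x} h" if "continuous_on {0..1} h" for h :: "real \<Rightarrow> complex"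
    by (rule continuous_on_subset[OF that]) (use x in auto)
  have i2: "(\<lambda>t. z\<^sup>2 * (y t * g t)) integrable_on {0..x}"
    by (intro integrable_continuous_real continuous_intros sub yc gc)
  have "AE t in leb01. B y t = y'' t + z\<^sup>2 * y t" using ae by eventually_elim (simp add: algebra_simps)
  then have "integral {0..x} (\<lambda>t. B y t * g t) = integral {0..x} (\<lambda>t. (y'' t + z\<^sup>2 * y t) * g t)"
    using x by (intro AE_leb01_integral_cong) auto
  also have "\<dots> = integral {0..x} (\<lambda>t. y'' t * g t) + integral {0..x} (\<lambda>t. z\<^sup>2 * (y t * g t))"
    by (subst integral_add[OF i1 i2, symmetric]) (simp add: algebra_simps)
  also have "integral {0..x} (\<lambda>t. y t * (- z\<^sup>2 * g t)) = - integral {0..x} (\<lambda>t. z\<^sup>2 * (y t * g t))"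
    by (subst integral_neg[symmetric]) (simp add: mult_ac)
  ultimately show ?thesis unfolding ibp1 ibp2
    using \<open>integral {0..x} (\<lambda>t. y t * (- z\<^sup>2 * g t)) = - integral {0..x} (\<lambda>t. z\<^sup>2 * (y t * g t))\<close> by simp
qed

lemma sin_shift_derivative:
  fixes z :: complex
  shows "((\<lambda>t. sin (z * of_real (x - t))) has_vector_derivative - z * cos (z * of_real (x - t))) (at t within S)"
proof -
  have "((\<lambda>w. sin (z * (of_real x - w))) has_field_derivative - z * cos (z * (of_real x - of_real t))) (at (of_real t))"
    by (auto intro!: derivative_eq_intros)
  from has_vector_derivative_real_field[OF this] show ?thesis by simp
qed

lemma cos_shift_derivative:
  fixes z :: complex
  shows "((\<lambda>t. cos (z * of_real (x - t))) has_vector_derivative z * sin (z * of_real (x - t))) (at t within S)"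
proof -
  have "((\<lambda>w. cos (z * (of_real x - w))) has_field_derivative z * sin (z * (of_real x - of_real t))) (at (of_real t))"
    by (auto intro!: derivative_eq_intros)
  from has_vector_derivative_real_field[OF this] show ?thesis by simp
qed

lemma eigenfunction_integral_equations:
  assumes "H_op V Q \<alpha> \<beta> y (\<lambda>x. z\<^sup>2 * y x)"
  shows "\<And>x. x \<in> {0..1} \<Longrightarrow> M z y x = z * (y x - y 0 * cos (z * of_real x))"
    and "L z y 1 = y 0 * (z * sin z)"
proof -
  obtain y' y'' where y: "W22 y y' y''" "y' 0 = 0" "y' 1 = 0" "AE t in leb01. z\<^sup>2 * y t = - y'' t + B y t"
    using assms unfolding H_op_def by blast
  have yc: "continuous_on {0..1} y" using W22_imp_X[OF y(1)] X_cont by blast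
  show "M z y x = z * (y x - y 0 * cos (z * of_real x))" if "x \<in> {0..1}" for x
  proof -
    have "integral {0..x} (\<lambda>t. B y t * sin (z * of_real (x - t))) = y' x * sin (z * of_real (x - x)) - y' 0 * sin (z * of_real (x - 0))
        - y x * (- z * cos (z * of_real (x - x))) + y 0 * (- z * cos (z * of_real (x - 0)))"
    proof (rule eigenfunction_green[OF y(1,4) sin_shift_derivative _ that])
      show "((\<lambda>t. - z * cos (z * of_real (x - t))) has_vector_derivative - z\<^sup>2 * sin (z * of_real (x - t))) (at t within {0..1})" for t
        using has_vector_derivative_mult_right[OF cos_shift_derivative, of "- z" z x t] by (simp add: power2_eq_square mult.assoc)
    qed
    then show ?thesis unfolding M_eq[OF yc] using y(2) by (simp add: algebra_simps)
  qed
  have "integral {0..1} (\<lambda>t. B y t * cos (z * of_real (1 - t))) = y' 1 * cos (z * of_real (1 - 1)) - y' 0 * cos (z * of_real (1 - 0))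
      - y 1 * (z * sin (z * of_real (1 - 1))) + y 0 * (z * sin (z * of_real (1 - 0)))"
  proof (rule eigenfunction_green[OF y(1,4) cos_shift_derivative])
    show "((\<lambda>t. z * sin (z * of_real (1 - t))) has_vector_derivative - z\<^sup>2 * cos (z * of_real (1 - t))) (at t within {0..1})" for t
      using has_vector_derivative_mult_right[OF sin_shift_derivative, of z z 1 t] by (simp add: power2_eq_square mult.assoc)
  qed simp
  then show "L z y 1 = y 0 * (z * sin z)" unfolding L_eq[OF yc] using y(2,3) by simp
qed

lemma trig_ops_linear:
  assumes "continuous_on {0..1} u" "continuous_on {0..1} v"
  shows "M z (\<lambda>x. a * u x + c * v x) x = a * M z u x + c * M z v x"
    "L z (\<lambda>x. a * u x + c * v x) x = a * L z u x + c * L z v x"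
proof -
  have uv: "continuous_on {0..1} (\<lambda>x. a * u x + c * v x)" by (intro continuous_intros assms)
  have Buv: "B (\<lambda>x. a * u x + c * v x) t = a * B u t + c * B v t" for t by (simp add: B_add B_cmult)
  note i = B_trig_integrable[OF assms(1)] B_trig_integrable[OF assms(2)]
  have "integral {0..x} (\<lambda>t. B (\<lambda>x. a * u x + c * v x) t * h t) = a * integral {0..x} (\<lambda>t. B u t * h t) + c * integral {0..x} (\<lambda>t. B v t * h t)"
    if "(\<lambda>t. B u t * h t) integrable_on {0..x}" "(\<lambda>t. B v t * h t) integrable_on {0..x}" for h
  proof -
    have "integral {0..x} (\<lambda>t. B (\<lambda>x. a * u x + c * v x) t * h t) = integral {0..x} (\<lambda>t. a * (B u t * h t) + c * (B v t * h t))"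
      unfolding Buv by (simp add: algebra_simps)
    also have "\<dots> = integral {0..x} (\<lambda>t. a * (B u t * h t)) + integral {0..x} (\<lambda>t. c * (B v t * h t))"
      by (intro integral_add integrable_on_mult_right that)
    finally show ?thesis by (simp only: integral_mult_right)
  qed
  note lin = this
  show "M z (\<lambda>x. a * u x + c * v x) x = a * M z u x + c * M z v x"
    unfolding M_eq[OF uv] M_eq[OF assms(1)] M_eq[OF assms(2)] by (rule lin[OF i(1) i(3)])
  show "L z (\<lambda>x. a * u x + c * v x) x = a * L z u x + c * L z v x"
    unfolding L_eq[OF uv] L_eq[OF assms(1)] L_eq[OF assms(2)] by (rule lin[OF i(2) i(4)])
qed

lemma trig_ops_cong:
  assumes "\<And>x. x \<in> {0..1} \<Longrightarrow> u x = v x"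
  shows "M z u = M z v" "L z u = L z v"
  using B_cong[OF assms] by (simp_all add: M_op_def[abs_def] L_op_def[abs_def])

text \<open>Iterating \<open>y = y(0) \<Phi> + z\<^sup>-\<^sup>1 M y\<close> expresses \<open>y\<close> by its value at \<open>0\<close>, which cannot vanish. Inserting the resulting
  series into the condition \<open>y'(1) = 0\<close> gives \<open>z sin z = \<Sum>\<^sub>j z\<^sup>-\<^sup>j f\<^sub>j(z)\<close>.\<close>

theorem eigenvalue_characteristic_equation:
  assumes ev: "is_eigenvalue V Q \<alpha> \<beta> (z\<^sup>2)" and z: "\<bar>Im z\<bar> \<le> 1" "6 * b \<le> norm z"
  shows "(\<lambda>j. f_coeff V Q j z \<alpha> \<beta> / z ^ Suc j) sums sin z"
proof -
  obtain y where y: "y \<noteq> (\<lambda>x. 0)" "H_op V Q \<alpha> \<beta> y (\<lambda>x. z\<^sup>2 * y x)" using ev unfolding is_eigenvalue_def by blast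
  note eqs = eigenfunction_integral_equations[OF y(2)]
  have yX: "y \<in> X" using H_op_X[OF y(2)] .
  have yc: "continuous_on {0..1} y" using X_cont[OF yX] .
  have z0: "z \<noteq> 0" using z b1 by auto
  define R where "R J = (M z ^^ J) y" for J
  have RS: "R (Suc J) = M z (R J)" for J by (simp add: R_def)
  have Rc: "continuous_on {0..1} (R J)" for J
    by (induction J) (auto simp: RS yc M_continuous, simp add: R_def yc)
  obtain K where K: "\<And>x. x \<in> {0..1} \<Longrightarrow> norm (y x) \<le> K" using continuous_bounded01[OF yc] by blast
  have K0: "0 \<le> K" using order_trans[OF norm_ge_zero K[of 0]] by simp
  have S: "norm (sin (z * of_real s)) \<le> 3 \<and> norm (cos (z * of_real s)) \<le> 3" if "0 \<le> s" "s \<le> 1" for s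
    using norm_trig_le[OF that z(1)] by blast
  have Rb: "norm (R J x) \<le> K * (3 * b) ^ J" if "x \<in> {0..1}" for J x
    using that
  proof (induction J arbitrary: x)
    case (Suc J)
    have "norm (R (Suc J) x) \<le> b * (K * (3 * b) ^ J) * 3"
      unfolding RS by (rule trig_ops_bound(1)[OF Rc Suc.IH Suc.prems S])
    then show ?case by (simp add: mult_ac)
  qed (simp add: R_def K)
  have half: "(3 * b) ^ J / norm z ^ J \<le> (1/2) ^ J" for J
  proof -
    have "3 * b / norm z \<le> 1/2" using z(2) z0 by (simp add: divide_le_eq)
    then have "(3 * b / norm z) ^ J \<le> (1/2) ^ J" using b1 by (intro power_mono) auto
    then show ?thesis by (simp add: power_divide)
  qed
  \<comment> \<open>Applying \<open>M\<close> repeatedly to \<open>y = y(0) \<Phi> + z\<^sup>-\<^sup>1 M y\<close>.\<close>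
  have step: "R J x = y 0 * U J z x + (1 / z) * R (Suc J) x" if "x \<in> {0..1}" for J x
    using that
  proof (induction J arbitrary: x)
    case 0
    show ?case using eqs(1)[OF 0] z0 by (simp add: R_def U_0 field_simps)
  next
    case (Suc J)
    have "M z (R J) = M z (\<lambda>x. y 0 * U J z x + (1 / z) * R (Suc J) x)"
      by (rule trig_ops_cong(1)[OF Suc.IH])
    then have "R (Suc J) x = M z (\<lambda>x. y 0 * U J z x + (1 / z) * R (Suc J) x) x"
      using RS[of J] by metis
    also have "\<dots> = y 0 * U (Suc J) z x + (1 / z) * R (Suc (Suc J)) x"
      unfolding trig_ops_linear(1)[OF U_continuous Rc] by (simp add: U_Suc RS)
    finally show ?case .
  qed
  have lim0: "(\<lambda>J. c * (1/2::real) ^ J) \<longlonglongrightarrow> 0" for c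
    by (rule tendsto_mult_right_zero) (simp add: LIMSEQ_power_zero)
  have y0: "y 0 \<noteq> 0"
  proof
    assume y00: "y 0 = 0"
    have "y x = 0" if x: "x \<in> {0..1}" for x
    proof -
      have RSx: "R (Suc J) x = z * R J x" for J using step[OF x, of J] y00 z0 by (simp add: field_simps)
      have "R J x = z ^ J * y x" for J
      proof (induction J)
        case 0
        show ?case by (simp add: R_def)
      next
        case (Suc J)
        then show ?case using RSx[of J] by simp
      qed
      then have "norm (y x) \<le> K * (1/2) ^ J" for J
      proof -
        assume "\<And>J. R J x = z ^ J * y x"
        then have "norm (y x) = norm (R J x) / norm z ^ J" using z0 by (simp add: norm_mult norm_power)
        also have "\<dots> \<le> K * (3 * b) ^ J / norm z ^ J" by (intro divide_right_mono Rb x) auto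
        also have "\<dots> \<le> K * (1/2) ^ J" using mult_left_mono[OF half K0] by simp
        finally show ?thesis .
      qed
      then have "norm (y x) \<le> 0" by (intro tendsto_lowerbound[OF lim0[of K]]) auto
      then show ?thesis by simp
    qed
    then have "y = (\<lambda>x. 0)" using yX by (auto simp: X_def fun_eq_iff)
    then show False using y(1) by blast
  qed
  \<comment> \<open>The partial sums of the series telescope to differences of these numbers.\<close>
  define a where "a J = L z (R J) 1 / z ^ J" for J
  have astep: "a J - a (Suc J) = y 0 * (f_coeff V Q J z \<alpha> \<beta> / z ^ J)" for J
  proof -
    have "L z (R J) 1 = L z (\<lambda>x. y 0 * U J z x + (1 / z) * R (Suc J) x) 1"
      by (rule fun_cong[OF trig_ops_cong(2)[OF step]])
    also have "\<dots> = y 0 * f_coeff V Q J z \<alpha> \<beta> + (1 / z) * L z (R (Suc J)) 1"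
      unfolding trig_ops_linear(2)[OF U_continuous Rc] by (simp add: f_coeff_eq)
    finally show ?thesis using z0 by (simp add: a_def field_simps)
  qed
  have "a \<longlonglongrightarrow> 0"
  proof (rule Lim_null_comparison[OF _ lim0[of "3 * b * K"]])
    have "norm (a J) \<le> 3 * b * K * (1/2) ^ J" for J
    proof -
      have "norm (L z (R J) 1) \<le> b * (K * (3 * b) ^ J) * 3"
        by (rule trig_ops_bound(2)[OF Rc Rb _ S]) auto
      then have "norm (a J) \<le> b * (K * (3 * b) ^ J) * 3 / norm z ^ J"
        unfolding a_def norm_divide norm_power by (intro divide_right_mono) auto
      also have "\<dots> = 3 * b * K * ((3 * b) ^ J / norm z ^ J)" by simp
      also have "\<dots> \<le> 3 * b * K * (1/2) ^ J" using K0 b1 by (intro mult_left_mono half) auto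
      finally show ?thesis .
    qed
    then show "\<forall>\<^sub>F J in sequentially. norm (a J) \<le> 3 * b * K * (1/2) ^ J" by (intro always_eventually allI)
  qed
  then have "(\<lambda>J. a J - a (Suc J)) sums (a 0 - 0)" by (rule telescope_sums')
  then have "(\<lambda>J. y 0 * (f_coeff V Q J z \<alpha> \<beta> / z ^ J)) sums (y 0 * (z * sin z))"
    unfolding astep using eqs(2) by (simp add: a_def R_def)
  from sums_mult[OF this, of "1 / (y 0 * z)"]
  show ?thesis using y0 z0 by simp
qed

end

section \<open>Uniqueness of the root near \<open>\<pi> n\<close>\<close>

lemma sin_expanding:
  fixes v w :: complex
  assumes "norm v \<le> 1/2" "norm w \<le> 1/2"
  shows "norm (v - w) \<le> 2 * norm (sin v - sin w)"
proof -
  have e: "exp (1/2 :: real) \<le> 7/4"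
  proof (rule power2_le_imp_le)
    have "(exp (1/2 :: real))\<^sup>2 = exp 1" by (simp add: exp_double[symmetric])
    then show "(exp (1/2 :: real))\<^sup>2 \<le> (7/4)\<^sup>2" using exp_le by (simp add: power2_eq_square)
  qed simp
  have c: "norm (cos u) \<le> 7/4" if "u \<in> cball 0 (1/2)" for u :: complex
  proof -
    have "norm (cos u) \<le> exp (norm u)" using norm_trig_le_exp(2)[of 1 u] by simp
    also have "\<dots> \<le> exp (1/2)" using that by simp
    finally show ?thesis using e by simp
  qed
  have s: "norm (sin u) \<le> 7/8" if "u \<in> cball 0 (1/2)" for u :: complex
  proof -
    have "norm (sin u - sin 0) \<le> 7/4 * norm (u - 0)"
      by (rule field_differentiable_bound[of "cball 0 (1/2)" sin cos])
         (use that c in \<open>auto intro!: derivative_eq_intros\<close>)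
    then show ?thesis using that by simp
  qed
  have d: "norm (cos u - 1) \<le> 1/2" if "u \<in> cball 0 (1/2)" for u :: complex
  proof -
    have "norm (cos u - cos 0) \<le> 7/8 * norm (u - 0)"
      by (rule field_differentiable_bound[of "cball 0 (1/2)" cos "\<lambda>u. - sin u"])
         (use that s in \<open>auto intro!: derivative_eq_intros\<close>)
    then show ?thesis using that by simp
  qed
  have "norm ((sin v - v) - (sin w - w)) \<le> 1/2 * norm (v - w)"
  proof (rule field_differentiable_bound[of "cball 0 (1/2)" "\<lambda>u. sin u - u" "\<lambda>u. cos u - 1"])
    show "((\<lambda>u. sin u - u) has_field_derivative cos u - 1) (at u within cball 0 (1/2))" for u :: complex
      by (auto intro!: derivative_eq_intros)
  qed (use assms d in simp_all)
  moreover have "norm (v - w) \<le> norm (sin v - sin w) + norm ((sin v - v) - (sin w - w))"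
    using norm_triangle_ineq4[of "sin v - sin w" "(sin v - v) - (sin w - w)"] by simp
  ultimately show ?thesis by simp
qed

lemma norm_power_diff_half:
  fixes v w :: complex
  assumes "norm v \<le> 1/2" "norm w \<le> 1/2"
  shows "norm (v ^ t - w ^ t) \<le> 4 * (3/4) ^ t * norm (v - w)"
proof -
  have "norm ((2 * v) ^ t - (2 * w) ^ t) \<le> real t * norm (2 * v - 2 * w)"
    by (rule norm_power_diff) (use assms in \<open>auto simp: norm_mult\<close>)
  moreover have "norm ((2 * v) ^ t - (2 * w) ^ t) = 2 ^ t * norm (v ^ t - w ^ t)"
  proof -
    have "(2 * v) ^ t - (2 * w) ^ t = 2 ^ t * (v ^ t - w ^ t)" by (simp add: power_mult_distrib algebra_simps)
    then show ?thesis by (simp add: norm_mult norm_power)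
  qed
  moreover have "norm (2 * v - 2 * w) = 2 * norm (v - w)"
  proof -
    have "2 * v - 2 * w = 2 * (v - w)" by (simp add: algebra_simps)
    then show ?thesis by (simp only: norm_mult norm_numeral)
  qed
  ultimately have "2 ^ t * norm (v ^ t - w ^ t) \<le> real t * (2 * norm (v - w))" by simp
  also have "\<dots> \<le> 2 * (3/2) ^ t * (2 * norm (v - w))"
  proof (rule mult_right_mono)
    have "1 + real t * (1/2) \<le> (1 + 1/2) ^ t" by (rule Bernoulli_inequality) simp
    then show "real t \<le> 2 * (3/2) ^ t" by simp
  qed simp
  finally have "norm (v ^ t - w ^ t) \<le> 2 * (3/2) ^ t * (2 * norm (v - w)) / 2 ^ t" by (simp add: field_simps)
  also have "\<dots> = 4 * ((3/2) ^ t / 2 ^ t) * norm (v - w)" by simp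
  also have "(3/2::real) ^ t / 2 ^ t = (3/4) ^ t" by (simp flip: power_divide)
  finally show ?thesis .
qed

text \<open>On the disc of radius \<open>1/2\<close> the sine shrinks distances by a factor of at most two, whereas the right-hand side of
  the equation is Lipschitz with a constant of order \<open>x\<close>.\<close>

lemma small_root_unique:
  fixes E :: "nat \<Rightarrow> nat \<Rightarrow> complex"
  assumes E: "\<And>t l. norm (E t (Suc l)) \<le> C ^ Suc l" and C: "1 \<le> C" and x: "0 < x" "128 * C * x \<le> 1"
    and \<sigma>: "norm \<sigma> = 1" and v: "norm v \<le> 1/2" and w: "norm w \<le> 1/2"
    and S: "((\<lambda>(t, l). E t (Suc l) * of_real x ^ l * v ^ t) has_sum S) UNIV" "sin v = \<sigma> * of_real x * S"
    and R: "((\<lambda>(t, l). E t (Suc l) * of_real x ^ l * w ^ t) has_sum R) UNIV" "sin w = \<sigma> * of_real x * R"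
  shows "v = w"
proof -
  define D where "D = norm (v - w)"
  have Cx: "0 < C * x" "C * x \<le> 1/128" using C x by auto
  define Maj where "Maj = (\<lambda>(t, l). 4 * (3/4) ^ t * D * (C * (C * x) ^ l))"
  have "((\<lambda>l. (C * x) ^ l) has_sum 1 / (1 - C * x)) UNIV"
    using Cx by (intro norm_summable_imp_has_sum geometric_sums) auto
  then have in_l: "((\<lambda>l. C * (C * x) ^ l) has_sum C * (1 / (1 - C * x))) UNIV" by (rule has_sum_cmult_right)
  have "((\<lambda>t. (3/4::real) ^ t) has_sum 1 / (1 - 3/4)) UNIV"
    by (intro norm_summable_imp_has_sum geometric_sums) auto
  from has_sum_cmult_left[OF has_sum_cmult_left[OF has_sum_cmult_right[OF this, of 4], of D], of "C * (1 / (1 - C * x))"]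
  have in_t: "((\<lambda>t. 4 * (3/4) ^ t * D * (C * (1 / (1 - C * x)))) has_sum (4 * (1 / (1 - 3/4)) * D * (C * (1 / (1 - C * x))))) UNIV" .
  have Maj: "(Maj has_sum (4 * (1 / (1 - 3/4)) * D * (C * (1 / (1 - C * x))))) UNIV"
  proof (rule has_sum_pair_nonneg[OF _ in_t])
    show "((\<lambda>l. Maj (t, l)) has_sum 4 * (3/4) ^ t * D * (C * (1 / (1 - C * x)))) UNIV" for t
      unfolding Maj_def prod.case by (rule has_sum_cmult_right[OF in_l])
  qed (use Cx C in \<open>auto simp: Maj_def D_def\<close>)
  have diff: "((\<lambda>(t, l). E t (Suc l) * of_real x ^ l * (v ^ t - w ^ t)) has_sum (S - R)) UNIV"
    using has_sum_add[OF S(1) has_sum_cmult_right[OF R(1), of "-1"]] by (simp add: case_prod_unfold right_diff_distrib)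
  have le: "norm (case s of (t, l) \<Rightarrow> E t (Suc l) * of_real x ^ l * (v ^ t - w ^ t)) \<le> Maj s" for s
  proof -
    obtain t l where s: "s = (t, l)" by (cases s)
    have "norm (E t (Suc l) * of_real x ^ l * (v ^ t - w ^ t)) = norm (E t (Suc l)) * x ^ l * norm (v ^ t - w ^ t)"
      using x by (simp add: norm_mult norm_power)
    also have "\<dots> \<le> C ^ Suc l * x ^ l * (4 * (3/4) ^ t * D)"
      unfolding D_def using E x C norm_power_diff_half[OF v w] by (intro mult_mono) auto
    also have "\<dots> = Maj s" by (simp add: s Maj_def power_mult_distrib mult_ac)
    finally show ?thesis by (simp add: s)
  qed
  have sm: "(\<lambda>s. norm (case s of (t, l) \<Rightarrow> E t (Suc l) * of_real x ^ l * (v ^ t - w ^ t))) summable_on UNIV"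
    by (rule summable_on_comparison_test[OF has_sum_imp_summable[OF Maj]]) (use le in auto)
  have "norm (S - R) \<le> 4 * (1 / (1 - 3/4)) * D * (C * (1 / (1 - C * x)))"
  proof -
    have "norm (S - R) \<le> infsum (\<lambda>s. norm (case s of (t, l) \<Rightarrow> E t (Suc l) * of_real x ^ l * (v ^ t - w ^ t))) UNIV"
      using norm_infsum_bound[OF sm] infsumI[OF diff] by simp
    also have "\<dots> \<le> 4 * (1 / (1 - 3/4)) * D * (C * (1 / (1 - C * x)))"
      by (rule has_sum_mono[OF has_sum_infsum[OF sm] Maj]) (use le in auto)
    finally show ?thesis .
  qed
  also have "\<dots> \<le> 4 * 4 * D * (C * 2)"
    using Cx C by (intro mult_mono) (auto simp: D_def field_simps)
  finally have SR: "norm (S - R) \<le> 32 * D * C" by simp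
  have "sin v - sin w = \<sigma> * of_real x * (S - R)" using S(2) R(2) by (simp add: right_diff_distrib)
  then have "norm (sin v - sin w) = x * norm (S - R)" using x \<sigma> by (simp add: norm_mult)
  also have "\<dots> \<le> x * (32 * D * C)" using SR x by (intro mult_left_mono) auto
  also have "\<dots> = 32 * D * (C * x)" by simp
  also have "\<dots> \<le> 32 * D * (1/128)" using Cx by (intro mult_left_mono) (auto simp: D_def)
  finally have "norm (sin v - sin w) \<le> D / 4" by simp
  then have "norm (v - w) \<le> 0" using sin_expanding[OF v w] unfolding D_def by linarith
  then show ?thesis by simp
qed

section \<open>The eigenvalue formula for bounded coefficients\<close>

context delay_coefficients
begin

lemma coefficient_recursion_rho:
  "coefficient_recursion (\<lambda>t l. E_coeff V Q t l n \<alpha> \<beta>) (rho V Q n \<alpha> \<beta>) ((-1) ^ n) (1 + 9 * b)"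
proof
  show "norm (E_coeff V Q t (Suc l) n \<alpha> \<beta>) \<le> (1 + 9 * b) ^ Suc l" for t l by (rule E_coeff_bound)
  show "1 \<le> 1 + 9 * b" using b1 by simp
  show "norm ((- 1) ^ n :: complex) = 1" by (simp add: norm_power)
  show "rho V Q n \<alpha> \<beta> i = (- 1) ^ n * (\<Sum>p = 0..i. \<Sum>t = 0..i - p. E_coeff V Q t (i + 1 - t - p) n \<alpha> \<beta> * multi_sum (rho V Q n \<alpha> \<beta>) t p)
      - (\<Sum>s = 1..i div 2. H_coeff (rho V Q n \<alpha> \<beta>) s (i - 2 * s))" for i
    by (subst rho.simps) (simp add: omega_def)
qed

text \<open>Both the displacement \<open>w\<close> of the root \<open>z = \<pi>n + w\<close> of the eigenvalue and \<open>1/(\<pi>n)\<close> times the sum of the series solve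
  the same equation, which has only one solution in the disc of radius \<open>1/2\<close>.\<close>

theorem eigenvalue_formula:
  assumes lam: "enumerates_eigenvalues V Q \<alpha> \<beta> lam"
    and N: "1 \<le> N" and small: "32 * b * gap N \<le> 1" "32 * b * gap (Suc N) \<le> 1"
    and big: "128 * (1 + 9 * b) \<le> real (Suc N)"
  shows "simple_eigenvalue V Q \<alpha> \<beta> (lam (Suc N))"
    and "lam (Suc N) = (of_real (pi * real (Suc N)) + 1 / of_real (pi * real (Suc N))
       * (\<Sum>i. rho V Q (Suc N) \<alpha> \<beta> i / of_real (pi * real (Suc N)) ^ i))\<^sup>2"
proof -
  define n where "n = Suc N"
  define x where "x = 1 / (pi * real n)"
  define z where "z = csqrt (lam n)"
  define w where "w = z - of_real (pi * real n)"
  interpret coefficient_recursion "\<lambda>t l. E_coeff V Q t l n \<alpha> \<beta>" "rho V Q n \<alpha> \<beta>" "(-1) ^ n" "1 + 9 * b"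
    by (rule coefficient_recursion_rho)
  note nth = nth_eigenvalue[OF lam N small]
  show "simple_eigenvalue V Q \<alpha> \<beta> (lam (Suc N))" by (rule nth(1))
  have n1: "1 \<le> n" by (simp add: n_def)
  have big': "128 * (1 + 9 * b) \<le> pi * real n"
  proof -
    have "1 * real n \<le> pi * real n" using pi_gt3 by (intro mult_right_mono) auto
    then have "real n \<le> pi * real n" by simp
    then show ?thesis by (rule order_trans[OF big[folded n_def]])
  qed
  have pn: "0 < pi * real n" using n1 by simp
  have x: "0 < x" "128 * (1 + 9 * b) * x \<le> 1" using pn big' by (auto simp: x_def field_simps)
  have z2: "z\<^sup>2 = lam n" by (simp add: z_def)
  have w_bound: "norm w \<le> 1/2"
  proof -
    have "(z - of_real (pi * real n)) * (z + of_real (pi * real n)) = lam n - of_real (ev n)"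
      using z2 by (simp add: ev_def power2_eq_square algebra_simps)
    then have "norm w * norm (z + of_real (pi * real n)) \<le> 4 * b"
      using nth(2) unfolding w_def n_def by (metis norm_mult)
    moreover have "pi * real n \<le> norm (z + of_real (pi * real n))"
    proof -
      have "0 \<le> Re z" unfolding z_def using csqrt_principal[of "lam n"] by auto
      then show ?thesis using complex_Re_le_cmod[of "z + of_real (pi * real n)"] by simp
    qed
    ultimately have "norm w * (pi * real n) \<le> 4 * b"
      using mult_left_mono[of "pi * real n" "norm (z + of_real (pi * real n))" "norm w"] by simp
    also have "\<dots> \<le> 1/2 * (pi * real n)" using big' b1 by simp
    finally show ?thesis by (rule mult_right_le_imp_le[OF _ pn])
  qed
  have zw: "z = of_real (pi * real n) + w" by (simp add: w_def)
  have S: "\<exists>S. ((\<lambda>(t, l). E_coeff V Q t (Suc l) n \<alpha> \<beta> * of_real x ^ l * w ^ t) has_sum S) UNIV \<and> sin w = (-1) ^ n * of_real x * S"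
  proof -
    have "36 * b * x \<le> 128 * (1 + 9 * b) * x" using x(1) b1 by (intro mult_right_mono) auto
    then have "36 * b * x \<le> 1" using x(2) by simp
    then obtain S where S: "((\<lambda>(t, l). E_coeff V Q t (Suc l) n \<alpha> \<beta> * of_real x ^ l * w ^ t) has_sum S) UNIV"
        "(\<lambda>j. f_coeff V Q j z \<alpha> \<beta> / z ^ Suc j) sums (of_real x * S)"
      using characteristic_function_expansion[OF n1 x_def w_bound] unfolding zw by blast
    have "(\<lambda>j. f_coeff V Q j z \<alpha> \<beta> / z ^ Suc j) sums sin z"
    proof (rule eigenvalue_characteristic_equation)
      show "is_eigenvalue V Q \<alpha> \<beta> (z\<^sup>2)" unfolding z2 n_def using nth(1) by (simp add: simple_eigenvalue_def)
      have "Im z = Im w" by (simp add: w_def)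
      then show "\<bar>Im z\<bar> \<le> 1" using abs_Im_le_cmod[of w] w_bound by simp
      have "pi * real n \<le> norm z + norm w" using norm_triangle_ineq4[of z w] pn by (simp add: w_def norm_mult)
      then show "6 * b \<le> norm z" using big' b1 w_bound by simp
    qed
    then have "sin z = of_real x * S" using S(2) sums_unique2 by blast
    moreover have "sin z = (-1) ^ n * sin w"
    proof -
      have "sin (complex_of_real (pi * real n)) = 0" "cos (complex_of_real (pi * real n)) = (-1) ^ n"
        using sin_npi[of n] cos_npi[of n] by (simp_all only: sin_of_real cos_of_real mult.commute[of pi]) simp_all
      then show ?thesis unfolding zw sin_add by simp
    qed
    ultimately have "sin w = (-1) ^ n * (of_real x * S)"
      by (metis (no_types, lifting) mult.assoc mult_1 power_mult_distrib power_one square_eq_1_iff minus_one_mult_self)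
    then show ?thesis using S(1) by (intro exI[of _ S]) (simp add: mult.assoc)
  qed
  have "16 * (1 + 9 * b) * x \<le> 128 * (1 + 9 * b) * x" using x(1) b1 by (intro mult_right_mono) auto
  then have x16: "16 * (1 + 9 * b) * x \<le> 1" using x(2) by simp
  have "w = root_shift x"
  proof -
    obtain S R where "((\<lambda>(t, l). E_coeff V Q t (Suc l) n \<alpha> \<beta> * of_real x ^ l * w ^ t) has_sum S) UNIV" "sin w = (-1) ^ n * of_real x * S"
      "((\<lambda>(t, l). E_coeff V Q t (Suc l) n \<alpha> \<beta> * of_real x ^ l * root_shift x ^ t) has_sum R) UNIV" "sin (root_shift x) = (-1) ^ n * of_real x * R"
      using S root_shift_solves[OF x(1) x16] by blast
    then show ?thesis
      by (rule small_root_unique[OF E C x \<sigma> w_bound norm_root_shift_le[OF x(1) x16]])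
  qed
  then have "w = 1 / of_real (pi * real n) * (\<Sum>i. rho V Q n \<alpha> \<beta> i / of_real (pi * real n) ^ i)"
  proof -
    have "complex_of_real x = 1 / of_real (pi * real n)" by (simp add: x_def)
    then show ?thesis using \<open>w = root_shift x\<close>
      by (simp only: root_shift_def power_one_over times_divide_eq_right mult_1_right)
  qed
  then have "lam n = (of_real (pi * real n) + 1 / of_real (pi * real n) * (\<Sum>i. rho V Q n \<alpha> \<beta> i / of_real (pi * real n) ^ i))\<^sup>2"
    using z2 zw by simp
  then show "lam (Suc N) = (of_real (pi * real (Suc N)) + 1 / of_real (pi * real (Suc N))
       * (\<Sum>i. rho V Q (Suc N) \<alpha> \<beta> i / of_real (pi * real (Suc N)) ^ i))\<^sup>2" by (simp only: n_def)
qed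

end

section \<open>Independence of the representatives of the coefficients\<close>

lemma AE_leb01_imp_AE_lebesgue:
  assumes "AE x in leb01. P x"
  shows "AE x in lebesgue. x \<in> {0<..<1} \<longrightarrow> P x"
  using assms AE_restrict_space_iff[of "{0<..<1::real}" lebesgue P] by simp

text \<open>If one of the functions fails to be integrable, then so does the other, and both integrals are \<open>0\<close> by convention.\<close>

lemma set_integral_spike:
  fixes f g :: "real \<Rightarrow> complex"
  assumes N: "negligible N" and eq: "\<And>x. x \<notin> N \<Longrightarrow> f x = g x"
  shows "(LINT t:S|lebesgue. f t) = (LINT t:S|lebesgue. g t)"
proof (cases "f absolutely_integrable_on S")
  case True
  then have "g absolutely_integrable_on S"
    by (rule absolutely_integrable_spike[OF _ N]) (use eq in auto)
  then show ?thesis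
    using set_lebesgue_integral_eq_integral(2)[OF True] set_lebesgue_integral_eq_integral(2)[of S g]
      integral_spike[OF N, of S g f] eq by auto
next
  case False
  moreover have "\<not> g absolutely_integrable_on S"
  proof
    assume "g absolutely_integrable_on S"
    then have "f absolutely_integrable_on S"
      by (rule absolutely_integrable_spike[OF _ N]) (use eq in auto)
    then show False using False by blast
  qed
  ultimately show ?thesis
    by (simp add: set_lebesgue_integral_def set_integrable_def not_integrable_integral_eq)
qed

text \<open>The operator, its root subspaces and the coefficients \<open>\<rho>\<^sub>i\<close> depend only on the classes of \<open>V\<close> and \<open>Q\<close> modulo null
  sets, so that essentially bounded coefficients may be replaced by bounded ones.\<close>

context
  fixes V V' Q Q' :: "real \<Rightarrow> complex"
  assumes V': "AE x in leb01. V x = V' x" and Q': "AE x in leb01. Q x = Q' x"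
begin

lemma B_op_spike: "\<exists>N. negligible N \<and> (\<forall>u x. x \<notin> N \<longrightarrow> B_op V Q \<alpha> \<beta> u x = B_op V' Q' \<alpha> \<beta> u x)"
proof -
  have "AE x in lebesgue. (x \<in> {0<..<1} \<longrightarrow> V x = V' x) \<and> (x \<in> {0<..<1} \<longrightarrow> Q x = Q' x)"
    using AE_leb01_imp_AE_lebesgue[OF V'] AE_leb01_imp_AE_lebesgue[OF Q'] by eventually_elim blast
  then obtain N where N: "N \<in> null_sets lebesgue"
      "{x \<in> space (lebesgue :: real measure). \<not> ((x \<in> {0<..<1} \<longrightarrow> V x = V' x) \<and> (x \<in> {0<..<1} \<longrightarrow> Q x = Q' x))} \<subseteq> N"
    unfolding eventually_ae_filter by blast
  have "negligible N" using N(1) by (simp add: negligible_iff_null_sets)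
  moreover have "B_op V Q \<alpha> \<beta> u x = B_op V' Q' \<alpha> \<beta> u x" if "x \<notin> N" for u x
  proof (cases "x \<in> {0<..<1}")
    case True
    then have "V x = V' x" "Q x = Q' x" using N(2) that by auto
    then show ?thesis by (simp add: B_op_def)
  qed (auto simp: B_op_def restriction_def)
  ultimately show ?thesis by blast
qed

lemma M_op_AE_cong: "M_op V Q z \<alpha> \<beta> = M_op V' Q' z \<alpha> \<beta>" and L_op_AE_cong: "L_op V Q z \<alpha> \<beta> = L_op V' Q' z \<alpha> \<beta>"
proof -
  obtain N where N: "negligible N" "\<And>u x. x \<notin> N \<Longrightarrow> B_op V Q \<alpha> \<beta> u x = B_op V' Q' \<alpha> \<beta> u x" using B_op_spike by blast
  have "M_op V Q z \<alpha> \<beta> u x = M_op V' Q' z \<alpha> \<beta> u x" for u x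
    unfolding M_op_def by (rule set_integral_spike[OF N(1)]) (simp add: N(2))
  then show "M_op V Q z \<alpha> \<beta> = M_op V' Q' z \<alpha> \<beta>" by blast
  have "L_op V Q z \<alpha> \<beta> u x = L_op V' Q' z \<alpha> \<beta> u x" for u x
    unfolding L_op_def by (rule set_integral_spike[OF N(1)]) (simp add: N(2))
  then show "L_op V Q z \<alpha> \<beta> = L_op V' Q' z \<alpha> \<beta>" by blast
qed

lemma f_coeff_AE_cong: "f_coeff V Q j z \<alpha> \<beta> = f_coeff V' Q' j z \<alpha> \<beta>"
  by (simp add: f_coeff_def M_op_AE_cong L_op_AE_cong)

lemma rho_AE_cong: "rho V Q n \<alpha> \<beta> = rho V' Q' n \<alpha> \<beta>"
proof
  fix i
  show "rho V Q n \<alpha> \<beta> i = rho V' Q' n \<alpha> \<beta> i"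
  proof (induction i rule: less_induct)
    case (less i)
    have E: "E_coeff V Q t l n \<alpha> \<beta> = E_coeff V' Q' t l n \<alpha> \<beta>" for t l
      by (simp add: E_coeff_def f_coeff_AE_cong)
    have "omega V Q n \<alpha> \<beta> (rho V Q n \<alpha> \<beta>) i = omega V' Q' n \<alpha> \<beta> (rho V Q n \<alpha> \<beta>) i"
      by (simp add: omega_def E)
    also have "\<dots> = omega V' Q' n \<alpha> \<beta> (rho V' Q' n \<alpha> \<beta>) i"
      by (rule omega_cong) (use less in auto)
    finally have om: "omega V Q n \<alpha> \<beta> (rho V Q n \<alpha> \<beta>) i = omega V' Q' n \<alpha> \<beta> (rho V' Q' n \<alpha> \<beta>) i" .
    have H: "H_coeff (rho V Q n \<alpha> \<beta>) s (i - 2 * s) = H_coeff (rho V' Q' n \<alpha> \<beta>) s (i - 2 * s)" if "s \<in> {1..i div 2}" for s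
      by (rule H_coeff_cong) (use less that in auto)
    show ?case
      by (subst (1 2) rho.simps) (simp add: om H)
  qed
qed

lemma H_op_AE_cong: "H_op V Q \<alpha> \<beta> y w \<longleftrightarrow> H_op V' Q' \<alpha> \<beta> y w"
proof -
  have e: "AE x in leb01. B_op V Q \<alpha> \<beta> y x = B_op V' Q' \<alpha> \<beta> y x"
    using V' Q' by eventually_elim (simp add: B_op_def)
  have "(AE x in leb01. w x = - y'' x + B_op V Q \<alpha> \<beta> y x) \<longleftrightarrow> (AE x in leb01. w x = - y'' x + B_op V' Q' \<alpha> \<beta> y x)" for y''
  proof
    assume "AE x in leb01. w x = - y'' x + B_op V Q \<alpha> \<beta> y x"
    then show "AE x in leb01. w x = - y'' x + B_op V' Q' \<alpha> \<beta> y x" using e by eventually_elim simp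
  next
    assume "AE x in leb01. w x = - y'' x + B_op V' Q' \<alpha> \<beta> y x"
    then show "AE x in leb01. w x = - y'' x + B_op V Q \<alpha> \<beta> y x" using e by eventually_elim simp
  qed
  then show ?thesis unfolding H_op_def by simp
qed

lemma ker_pow_AE_cong: "ker_pow V Q \<alpha> \<beta> \<mu> k = ker_pow V' Q' \<alpha> \<beta> \<mu> k"
  by (induction k) (simp_all add: H_op_AE_cong)

lemma spectrum_AE_cong:
  "is_eigenvalue V Q \<alpha> \<beta> = is_eigenvalue V' Q' \<alpha> \<beta>"
  "has_multiplicity V Q \<alpha> \<beta> = has_multiplicity V' Q' \<alpha> \<beta>"
  by (simp_all add: fun_eq_iff is_eigenvalue_def has_multiplicity_def root_subspace_def H_op_AE_cong ker_pow_AE_cong)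

lemma simple_eigenvalue_AE_cong: "simple_eigenvalue V Q \<alpha> \<beta> = simple_eigenvalue V' Q' \<alpha> \<beta>"
  and enumerates_eigenvalues_AE_cong: "enumerates_eigenvalues V Q \<alpha> \<beta> = enumerates_eigenvalues V' Q' \<alpha> \<beta>"
  by (simp_all add: fun_eq_iff simple_eigenvalue_def enumerates_eigenvalues_def spectrum_AE_cong)

end

lemma L_inf_bounded_representative:
  assumes "V \<in> L_inf"
  obtains V' C where "V' \<in> borel_measurable lebesgue" "\<And>x. norm (V' x) \<le> C" "AE x in leb01. V x = V' x"
proof -
  obtain C where V: "V \<in> borel_measurable leb01" "AE x in leb01. norm (V x) \<le> C" using assms by (auto simp: L_inf_def)
  define V' where "V' x = indicator {0<..<1} x *\<^sub>R (if norm (V x) \<le> C then V x else 0)" for x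
  show ?thesis
  proof
    have "(\<lambda>x. if norm (V x) \<le> C then V x else 0) \<in> borel_measurable leb01"
      using V(1) by measurable
    then show "V' \<in> borel_measurable lebesgue"
      unfolding V'_def[abs_def] by (simp add: borel_measurable_restrict_space_iff)
    show "norm (V' x) \<le> \<bar>C\<bar>" for x by (auto simp: V'_def indicator_def)
    show "AE x in leb01. V x = V' x"
      using V(2) AE_space by eventually_elim (auto simp: V'_def)
  qed
qed

section \<open>Uniform asymptotics of the eigenvalues\<close>

theorem theorem2:
  fixes V Q :: "real \<Rightarrow> complex"
    and lam :: "real \<Rightarrow> real \<Rightarrow> nat \<Rightarrow> complex"
  assumes V: "V \<in> L_inf" and Q: "Q \<in> L_inf"
    and lam: "\<And>\<alpha> \<beta>. \<alpha> \<in> {0..1} \<Longrightarrow> \<beta> \<in> {0..1} \<Longrightarrow> enumerates_eigenvalues V Q \<alpha> \<beta> (lam \<alpha> \<beta>)"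
  shows "\<exists>n0::nat. n0 > 0 \<and>
    (\<forall>\<alpha>\<in>{0..1}. \<forall>\<beta>\<in>{0..1}. \<forall>n\<ge>n0.
       simple_eigenvalue V Q \<alpha> \<beta> (lam \<alpha> \<beta> n) \<and>
       lam \<alpha> \<beta> n =
         (of_real (pi * real n)
          + 1 / of_real (pi * real n) * (\<Sum>i. rho V Q n \<alpha> \<beta> i / of_real (pi * real n) ^ i))\<^sup>2) \<and>
    uniform_limit ({n0..} \<times> {0..1} \<times> {0..1})
      (\<lambda>N (n, \<alpha>, \<beta>). \<Sum>i<N. rho V Q n \<alpha> \<beta> i / of_real (pi * real n) ^ i)
      (\<lambda>(n, \<alpha>, \<beta>). \<Sum>i. rho V Q n \<alpha> \<beta> i / of_real (pi * real n) ^ i) sequentially \<and>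
    (\<exists>c1 c2 :: real.
       (\<forall>i. \<forall>n\<ge>1. \<forall>\<alpha>\<in>{0..1}. \<forall>\<beta>\<in>{0..1}. norm (rho V Q n \<alpha> \<beta> i) \<le> c1 * c2 ^ i) \<and>
       (\<forall>N\<ge>1. \<forall>n\<ge>n0. \<forall>\<alpha>\<in>{0..1}. \<forall>\<beta>\<in>{0..1}.
          norm (\<Sum>i. rho V Q n \<alpha> \<beta> (i + N) / of_real (pi * real n) ^ (i + N))
            \<le> 2 * c1 * c2 ^ N / (pi ^ N * real n ^ N)))"
proof -
  obtain V' CV where V': "V' \<in> borel_measurable lebesgue" "\<And>x. norm (V' x) \<le> CV" "AE x in leb01. V x = V' x"
    using L_inf_bounded_representative[OF V] by blast
  obtain Q' CQ where Q': "Q' \<in> borel_measurable lebesgue" "\<And>x. norm (Q' x) \<le> CQ" "AE x in leb01. Q x = Q' x"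
    using L_inf_bounded_representative[OF Q] by blast
  note cong = rho_AE_cong[OF V'(3) Q'(3)] simple_eigenvalue_AE_cong[OF V'(3) Q'(3)] enumerates_eigenvalues_AE_cong[OF V'(3) Q'(3)]
  define b where "b = max 1 (CV + CQ)"
  have dc: "delay_coefficients V' Q' b"
  proof
    show "norm (V' x) + norm (Q' x) \<le> b" for x using V'(2)[of x] Q'(2)[of x] by (simp add: b_def max_def)
  qed (use V' Q' in \<open>auto simp: b_def\<close>)
  then interpret delay_coefficients V' Q' b \<alpha> \<beta> for \<alpha> \<beta> .
  define c where "c = 1 + 9 * b"
  have c: "1 \<le> c" using b1 by (simp add: c_def)
  have bound: "norm (rho V' Q' n \<alpha> \<beta> i) \<le> 4 * c * (8 * c) ^ i" for n \<alpha> \<beta> i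
    unfolding c_def by (rule coefficient_recursion.coefficient_bound[OF coefficient_recursion_rho])
  \<comment> \<open>From \<open>m\<close> on the discs around the origin contain the expected number of eigenvalues.\<close>
  define m where "m = max 1 (nat \<lceil>(32 * b * gap_const)\<^sup>2\<rceil>)"
  have gap_small: "32 * b * gap N \<le> 1" if "m \<le> N" for N
  proof -
    have "(32 * b * gap_const)\<^sup>2 \<le> real (nat \<lceil>(32 * b * gap_const)\<^sup>2\<rceil>)" by (rule real_nat_ceiling_ge)
    also have "\<dots> \<le> real N" using that unfolding m_def of_nat_le_iff by (rule max.boundedE)
    finally have "32 * b * gap_const \<le> sqrt (real N)" by (rule real_le_rsqrt)
    moreover have "0 < sqrt (real N)" using that by (simp add: m_def)
    ultimately show ?thesis by (simp add: gap_def divide_simps)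
  qed
  \<comment> \<open>Beyond \<open>n0\<close> both the disc of index \<open>n - 1\<close> and that of index \<open>n\<close> are admissible.\<close>
  define n0 where "n0 = Suc (max m (nat \<lceil>128 * c\<rceil>))"
  have n0_pos: "0 < n0" by (simp add: n0_def)
  have n0_big: "128 * c \<le> real n" "m \<le> n - 1" "1 \<le> n - 1" "n = Suc (n - 1)" if "n0 \<le> n" for n
  proof -
    show "m \<le> n - 1" "n = Suc (n - 1)" using that by (auto simp: n0_def)
    then show "1 \<le> n - 1" by (simp add: m_def)
    have "128 * c \<le> real (nat \<lceil>128 * c\<rceil>)" by (rule real_nat_ceiling_ge)
    also have "\<dots> \<le> real n" unfolding of_nat_le_iff using that unfolding n0_def by linarith
    finally show "128 * c \<le> real n" .
  qed
  have formula: "simple_eigenvalue V Q \<alpha> \<beta> (lam \<alpha> \<beta> n) \<and>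
       lam \<alpha> \<beta> n = (of_real (pi * real n) + 1 / of_real (pi * real n) * (\<Sum>i. rho V Q n \<alpha> \<beta> i / of_real (pi * real n) ^ i))\<^sup>2"
    if "\<alpha> \<in> {0..1}" "\<beta> \<in> {0..1}" "n0 \<le> n" for \<alpha> \<beta> n
  proof -
    have e: "enumerates_eigenvalues V' Q' \<alpha> \<beta> (lam \<alpha> \<beta>)" using lam[OF that(1,2)] by (simp add: cong)
    have N: "1 \<le> n - 1" "32 * b * gap (n - 1) \<le> 1" "32 * b * gap (Suc (n - 1)) \<le> 1" "128 * (1 + 9 * b) \<le> real (Suc (n - 1))"
      using n0_big[OF that(3)] gap_small[of "n - 1"] gap_small[of "Suc (n - 1)"] by (auto simp: c_def)
    show ?thesis using eigenvalue_formula[OF e N] n0_big(4)[OF that(3)] by (simp add: cong)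
  qed
  have ratio: "8 * c / (pi * real n) \<le> 1/2" if "n0 \<le> n" for n
  proof -
    have "1 * real n \<le> pi * real n" using pi_gt3 by (intro mult_right_mono) auto
    then have "real n \<le> pi * real n" by simp
    then have "128 * c \<le> pi * real n" by (rule order_trans[OF n0_big(1)[OF that]])
    then have "16 * c \<le> pi * real n" using c by linarith
    then show ?thesis using c by (simp add: divide_simps)
  qed
  have term_bound: "norm (rho V Q n \<alpha> \<beta> i / of_real (pi * real n) ^ i) \<le> 4 * c * (8 * c / (pi * real n)) ^ i" for n \<alpha> \<beta> i
    using divide_right_mono[OF bound[of n \<alpha> \<beta> i], of "(pi * real n) ^ i"]
    by (simp add: cong norm_divide norm_power norm_mult power_divide power_mult_distrib)
  have pow_bound: "4 * c * (8 * c / (pi * real n)) ^ i \<le> 4 * c * (1/2) ^ i" if "n0 \<le> n" for n i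
    using ratio[OF that] c by (intro mult_left_mono power_mono) auto
  have unif: "uniform_limit ({n0..} \<times> {0..1} \<times> {0..1})
      (\<lambda>N (n, \<alpha>, \<beta>). \<Sum>i<N. rho V Q n \<alpha> \<beta> i / of_real (pi * real n) ^ i)
      (\<lambda>(n, \<alpha>, \<beta>). \<Sum>i. rho V Q n \<alpha> \<beta> i / of_real (pi * real n) ^ i) sequentially"
  proof -
    have "uniform_limit ({n0..} \<times> {0..1} \<times> {0..1})
      (\<lambda>N s. \<Sum>i<N. (\<lambda>i (n, \<alpha>, \<beta>). rho V Q n \<alpha> \<beta> i / of_real (pi * real n) ^ i) i s)
      (\<lambda>s. \<Sum>i. (\<lambda>i (n, \<alpha>, \<beta>). rho V Q n \<alpha> \<beta> i / of_real (pi * real n) ^ i) i s) sequentially"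
    proof (rule Weierstrass_m_test)
      show "summable (\<lambda>i. 4 * c * (1/2) ^ i)" by (intro summable_mult summable_geometric) simp
      show "norm ((\<lambda>i (n, \<alpha>, \<beta>). rho V Q n \<alpha> \<beta> i / of_real (pi * real n) ^ i) i s) \<le> 4 * c * (1/2) ^ i"
        if "s \<in> {n0..} \<times> {0..1} \<times> {0..1}" for i s
      proof -
        obtain n \<alpha> \<beta> where s: "s = (n, \<alpha>, \<beta>)" by (cases s)
        show ?thesis using order_trans[OF term_bound pow_bound, of n \<alpha> \<beta> i] that by (simp add: s)
      qed
    qed
    then show ?thesis by (simp add: case_prod_unfold)
  qed
  have tail: "norm (\<Sum>i. rho V Q n \<alpha> \<beta> (i + N) / of_real (pi * real n) ^ (i + N)) \<le> 2 * (4 * c) * (8 * c) ^ N / (pi ^ N * real n ^ N)"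
    if "n0 \<le> n" for n \<alpha> \<beta> N
  proof -
    define q where "q = 8 * c / (pi * real n)"
    have q: "0 \<le> q" "q \<le> 1/2" using ratio[OF that] c by (auto simp: q_def)
    have le: "norm (rho V Q n \<alpha> \<beta> (i + N) / of_real (pi * real n) ^ (i + N)) \<le> 4 * c * q ^ N * q ^ i" for i
      using term_bound[of n \<alpha> \<beta> "i + N"] by (simp add: q_def power_add mult_ac)
    have g: "(\<lambda>i. 4 * c * q ^ N * q ^ i) sums (4 * c * q ^ N * (1 / (1 - q)))"
      by (intro sums_mult geometric_sums) (use q in auto)
    have s: "summable (\<lambda>i. norm (rho V Q n \<alpha> \<beta> (i + N) / of_real (pi * real n) ^ (i + N)))"
      by (rule summable_comparison_test'[OF sums_summable[OF g], of 0]) (use le in auto)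
    have "norm (\<Sum>i. rho V Q n \<alpha> \<beta> (i + N) / of_real (pi * real n) ^ (i + N)) \<le> 4 * c * q ^ N * (1 / (1 - q))"
      using order_trans[OF summable_norm[OF s] suminf_le[OF le s sums_summable[OF g]]] sums_unique[OF g] by simp
    also have "\<dots> \<le> 4 * c * q ^ N * 2"
      using q c by (intro mult_left_mono) (auto simp: field_simps)
    also have "\<dots> = 2 * (4 * c) * (8 * c) ^ N / (pi ^ N * real n ^ N)"
      by (simp add: q_def power_divide power_mult_distrib)
    finally show ?thesis .
  qed
  show ?thesis
  proof (intro exI[of _ n0] conjI)
    show "0 < n0" by (rule n0_pos)
    show "\<forall>\<alpha>\<in>{0..1}. \<forall>\<beta>\<in>{0..1}. \<forall>n\<ge>n0. simple_eigenvalue V Q \<alpha> \<beta> (lam \<alpha> \<beta> n) \<and>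
        lam \<alpha> \<beta> n = (of_real (pi * real n) + 1 / of_real (pi * real n) * (\<Sum>i. rho V Q n \<alpha> \<beta> i / of_real (pi * real n) ^ i))\<^sup>2"
      using formula by blast
    show "\<exists>c1 c2 :: real.
       (\<forall>i. \<forall>n\<ge>1. \<forall>\<alpha>\<in>{0..1}. \<forall>\<beta>\<in>{0..1}. norm (rho V Q n \<alpha> \<beta> i) \<le> c1 * c2 ^ i) \<and>
       (\<forall>N\<ge>1. \<forall>n\<ge>n0. \<forall>\<alpha>\<in>{0..1}. \<forall>\<beta>\<in>{0..1}.
          norm (\<Sum>i. rho V Q n \<alpha> \<beta> (i + N) / of_real (pi * real n) ^ (i + N))
            \<le> 2 * c1 * c2 ^ N / (pi ^ N * real n ^ N))"
      using bound tail by (intro exI[of _ "4 * c"] exI[of _ "8 * c"]) (simp add: cong)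
  qed (rule unif)
qed

end
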